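(* In each of the three cases A, B, C described in the context, if $\operatorname{rank}\mathfrak g\le\operatorname{rank}K$, then the surjective homomorphism $\phi:U(\mathfrak g)\to\mathcal D(V)^K$ is an isomorphism.
   Context: $F$ is an algebraically closed field of characteristic zero. $M_{a,b}$ denotes $a\times b$ matrices over $F$. Consider the following pairs $(K,V)$ with $K$ acting linearly on $V$: Case A: $K=GL_k(F)$, $V=M_{p,k}\times M_{k,q}$, $g\cdot(a,b)=(ag^{-1},gb)$; $\mathfrak g=\mathfrak{gl}_{p+q}$ (set $n=p+q$). Case B: $K=O_k(F)$, $V=M_{k,n}$, $g\cdot a=ga$; $\mathfrak g=\mathfrak{sp}_{2n}$. Case C: $K=Sp_{2k}(F)$, $V$ the space of $2k\times n$ matrices, $g\cdot a=ga$; $\mathfrak g=\mathfrak{so}_{2n}$. $\mathcal D(V)$ is the algebra of polynomial-coefficient differential operators on $V$, with the induced $K$-action, and $\mathcal D(V)^K$ its subalgebra of $K$-invariants. In each case (Howe duality) the $K$-invariant operators of degree at most 2 in the Bernstein filtration contain a Lie subalgebra isomorphic to $\mathfrak g$ which generates $\mathcal D(V)^K$ as an associative algebra; this gives a surjective algebra homomorphism $\phi:U(\mathfrak g)\to\mathcal D(V)^K$ mapping $\mathfrak g$ onto that Lie subalgebra. *)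

theory Defs
  imports "HOL-Library.Poly_Mapping" "HOL-Computational_Algebra.Polynomial" "Jordan_Normal_Form.Matrix"
begin

definition alg_closed :: "'a::field itself \<Rightarrow> bool" where
  "alg_closed _ \<longleftrightarrow> (\<forall>p::'a poly. Polynomial.degree p > 0 \<longrightarrow> (\<exists>x. poly p x = 0))"

type_synonym ('v, 'a) mpoly = "('v \<Rightarrow>\<^sub>0 nat) \<Rightarrow>\<^sub>0 'a"
type_synonym ('v, 'a) dop = "('v, 'a) mpoly \<Rightarrow> ('v, 'a) mpoly"

definition const_poly :: "'a::comm_ring_1 \<Rightarrow> ('v, 'a) mpoly" where
  "const_poly c = Poly_Mapping.single 0 c"

definition Xvar :: "'v \<Rightarrow> ('v, 'a::comm_ring_1) mpoly" where
  "Xvar v = Poly_Mapping.single (Poly_Mapping.single v 1) 1"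

definition dX :: "'v \<Rightarrow> ('v, 'a::comm_ring_1) mpoly \<Rightarrow> ('v, 'a) mpoly" where
  "dX v p = (\<Sum>m\<in>Poly_Mapping.keys p. Poly_Mapping.single (m - Poly_Mapping.single v 1)
                                (of_nat (Poly_Mapping.lookup m v) * Poly_Mapping.lookup p m))"

definition subst :: "('v \<Rightarrow> ('v, 'a) mpoly) \<Rightarrow> ('v, 'a::comm_ring_1) mpoly \<Rightarrow> ('v, 'a) mpoly" where
  "subst \<sigma> p = (\<Sum>m\<in>Poly_Mapping.keys p. const_poly (Poly_Mapping.lookup p m) * (\<Prod>v\<in>Poly_Mapping.keys m. \<sigma> v ^ Poly_Mapping.lookup m v))"

text \<open>The algebra D(V) of polynomial-coefficient differential operators in the coordinates Vs
  (realised faithfully as operators on polynomials).\<close>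
inductive_set weyl :: "'v set \<Rightarrow> ('v, 'a::comm_ring_1) dop set" for Vs where
  scal: "(\<lambda>p. const_poly c * p) \<in> weyl Vs"
| mulx: "v \<in> Vs \<Longrightarrow> (\<lambda>p. Xvar v * p) \<in> weyl Vs"
| der: "v \<in> Vs \<Longrightarrow> dX v \<in> weyl Vs"
| add: "D \<in> weyl Vs \<Longrightarrow> E \<in> weyl Vs \<Longrightarrow> (\<lambda>p. D p + E p) \<in> weyl Vs"
| comp: "D \<in> weyl Vs \<Longrightarrow> E \<in> weyl Vs \<Longrightarrow> D \<circ> E \<in> weyl Vs"

definition weyl_gens :: "'v set \<Rightarrow> ('v, 'a::comm_ring_1) dop set" where
  "weyl_gens Vs = {(\<lambda>p. Xvar v * p) | v. v \<in> Vs} \<union> {dX v | v. v \<in> Vs}"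

inductive_set weyl_le2 :: "'v set \<Rightarrow> ('v, 'a::comm_ring_1) dop set" for Vs where
  deg0: "(\<lambda>p. const_poly c * p) \<in> weyl_le2 Vs"
| deg1: "G \<in> weyl_gens Vs \<Longrightarrow> (\<lambda>p. const_poly c * G p) \<in> weyl_le2 Vs"
| deg2: "G \<in> weyl_gens Vs \<Longrightarrow> H \<in> weyl_gens Vs \<Longrightarrow> (\<lambda>p. const_poly c * G (H p)) \<in> weyl_le2 Vs"
| add: "D \<in> weyl_le2 Vs \<Longrightarrow> E \<in> weyl_le2 Vs \<Longrightarrow> (\<lambda>p. D p + E p) \<in> weyl_le2 Vs"

inductive_set alg_gen :: "('v, 'a::comm_ring_1) dop set \<Rightarrow> ('v, 'a) dop set" for S where
  scal: "(\<lambda>p. const_poly c * p) \<in> alg_gen S"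
| gen: "D \<in> S \<Longrightarrow> D \<in> alg_gen S"
| add: "D \<in> alg_gen S \<Longrightarrow> E \<in> alg_gen S \<Longrightarrow> (\<lambda>p. D p + E p) \<in> alg_gen S"
| comp: "D \<in> alg_gen S \<Longrightarrow> E \<in> alg_gen S \<Longrightarrow> D \<circ> E \<in> alg_gen S"

text \<open>Invariants: an operator D is invariant under g iff it commutes with the pull-back
  f \<mapsto> f \<circ> g, given as a substitution.\<close>
definition invariant_ops :: "'v set \<Rightarrow> ('v \<Rightarrow> ('v, 'a) mpoly) set \<Rightarrow> ('v, 'a::comm_ring_1) dop set" where
  "invariant_ops Vs \<Sigma> = {D \<in> weyl Vs. \<forall>\<sigma>\<in>\<Sigma>. D \<circ> subst \<sigma> = subst \<sigma> \<circ> D}"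

definition Jmat :: "nat \<Rightarrow> 'a::comm_ring_1 mat" where
  "Jmat m = mat (2*m) (2*m) (\<lambda>(i,j). if i < m \<and> j = i + m then 1
                                     else if m \<le> i \<and> j + m = i then -1 else 0)"

definition GL_pairs :: "nat \<Rightarrow> ('a::comm_ring_1 mat \<times> 'a mat) set" where
  "GL_pairs k = {(g,h). g \<in> carrier_mat k k \<and> h \<in> carrier_mat k k \<and> g * h = 1\<^sub>m k \<and> h * g = 1\<^sub>m k}"

definition O_grp :: "nat \<Rightarrow> 'a::comm_ring_1 mat set" where
  "O_grp k = {g \<in> carrier_mat k k. transpose_mat g * g = 1\<^sub>m k}"

definition Sp_grp :: "nat \<Rightarrow> 'a::comm_ring_1 mat set" where
  "Sp_grp k = {g \<in> carrier_mat (2*k) (2*k). transpose_mat g * Jmat k * g = Jmat k}"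

definition gl_alg :: "nat \<Rightarrow> 'a::comm_ring_1 mat set" where
  "gl_alg n = carrier_mat n n"

definition sp_alg :: "nat \<Rightarrow> 'a::comm_ring_1 mat set" where
  "sp_alg n = {X \<in> carrier_mat (2*n) (2*n). transpose_mat X * Jmat n + Jmat n * X = 0\<^sub>m (2*n) (2*n)}"

definition so_alg :: "nat \<Rightarrow> 'a::comm_ring_1 mat set" where
  "so_alg n = {X \<in> carrier_mat (2*n) (2*n). transpose_mat X + X = 0\<^sub>m (2*n) (2*n)}"

text \<open>Case A: coordinates (True,i,j) = a_ij (i<p, j<k), (False,j,l) = b_jl (j<k, l<q).
  (g,h) with h = g^-1; pull-back along (a,b) \<mapsto> (a h, g b).\<close>
definition VarsA :: "nat \<Rightarrow> nat \<Rightarrow> nat \<Rightarrow> (bool \<times> nat \<times> nat) set" where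
  "VarsA p q k = {(True,i,j) | i j. i < p \<and> j < k} \<union> {(False,j,l) | j l. j < k \<and> l < q}"

definition pullA :: "nat \<Rightarrow> nat \<Rightarrow> nat \<Rightarrow> 'a mat \<Rightarrow> 'a mat \<Rightarrow> bool \<times> nat \<times> nat \<Rightarrow> (bool \<times> nat \<times> nat, 'a::comm_ring_1) mpoly" where
  "pullA p q k g h = (\<lambda>(b,i,j).
     if (b,i,j) \<in> VarsA p q k then
       (if b then (\<Sum>l<k. const_poly (h $$ (l,j)) * Xvar (True,i,l))
        else (\<Sum>l<k. const_poly (g $$ (i,l)) * Xvar (False,l,j)))
     else Xvar (b,i,j))"

definition DK_A :: "nat \<Rightarrow> nat \<Rightarrow> nat \<Rightarrow> (bool \<times> nat \<times> nat, 'a::comm_ring_1) dop set" where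
  "DK_A p q k = invariant_ops (VarsA p q k) {pullA p q k g h | g h. (g,h) \<in> GL_pairs k}"

text \<open>Cases B and C: coordinates (i,j) of an r \<times> n matrix a; pull-back along a \<mapsto> g a.\<close>
definition VarsM :: "nat \<Rightarrow> nat \<Rightarrow> (nat \<times> nat) set" where
  "VarsM r n = {(i,j). i < r \<and> j < n}"

definition pullM :: "nat \<Rightarrow> nat \<Rightarrow> 'a mat \<Rightarrow> nat \<times> nat \<Rightarrow> (nat \<times> nat, 'a::comm_ring_1) mpoly" where
  "pullM r n g = (\<lambda>(i,j). if (i,j) \<in> VarsM r n
       then (\<Sum>l<r. const_poly (g $$ (i,l)) * Xvar (l,j)) else Xvar (i,j))"

definition DK_B :: "nat \<Rightarrow> nat \<Rightarrow> (nat \<times> nat, 'a::comm_ring_1) dop set" where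
  "DK_B k n = invariant_ops (VarsM k n) (pullM k n ` O_grp k)"

definition DK_C :: "nat \<Rightarrow> nat \<Rightarrow> (nat \<times> nat, 'a::comm_ring_1) dop set" where
  "DK_C k n = invariant_ops (VarsM (2*k) n) (pullM (2*k) n ` Sp_grp k)"

text \<open>Free associative algebra on the set L: finitely supported functions on words.\<close>
definition fa_on :: "'g set \<Rightarrow> ('g list \<Rightarrow>\<^sub>0 'a::comm_ring_1) set" where
  "fa_on L = {f. \<forall>w\<in>Poly_Mapping.keys f. set w \<subseteq> L}"

definition fa_mult :: "('g list \<Rightarrow>\<^sub>0 'a::comm_ring_1) \<Rightarrow> ('g list \<Rightarrow>\<^sub>0 'a) \<Rightarrow> ('g list \<Rightarrow>\<^sub>0 'a)" where
  "fa_mult f g = (\<Sum>u\<in>Poly_Mapping.keys f. \<Sum>w\<in>Poly_Mapping.keys g. Poly_Mapping.single (u @ w) (Poly_Mapping.lookup f u * Poly_Mapping.lookup g w))"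

definition lie_rels :: "'a::comm_ring_1 mat set \<Rightarrow> ('a mat list \<Rightarrow>\<^sub>0 'a) set" where
  "lie_rels L =
     {Poly_Mapping.single [x + y] 1 - Poly_Mapping.single [x] 1 - Poly_Mapping.single [y] 1 | x y. x \<in> L \<and> y \<in> L}
   \<union> {Poly_Mapping.single [c \<cdot>\<^sub>m x] 1 - Poly_Mapping.single [x] c | c x. x \<in> L}
   \<union> {Poly_Mapping.single [x, y] 1 - Poly_Mapping.single [y, x] 1 - Poly_Mapping.single [x * y - y * x] 1
        | x y. x \<in> L \<and> y \<in> L}"

inductive_set fa_ideal :: "'g set \<Rightarrow> ('g list \<Rightarrow>\<^sub>0 'a::comm_ring_1) set \<Rightarrow> ('g list \<Rightarrow>\<^sub>0 'a) set"
  for L R where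
  gen: "r \<in> R \<Longrightarrow> r \<in> fa_ideal L R"
| zero: "0 \<in> fa_ideal L R"
| add: "f \<in> fa_ideal L R \<Longrightarrow> g \<in> fa_ideal L R \<Longrightarrow> f + g \<in> fa_ideal L R"
| lmul: "f \<in> fa_ideal L R \<Longrightarrow> a \<in> fa_on L \<Longrightarrow> fa_mult a f \<in> fa_ideal L R"
| rmul: "f \<in> fa_ideal L R \<Longrightarrow> a \<in> fa_on L \<Longrightarrow> fa_mult f a \<in> fa_ideal L R"

text \<open>The algebra homomorphism from the free algebra induced by iota: a word x1...xm goes to
  iota x1 \<circ> ... \<circ> iota xm.  It factors through U(L) = fa_on L / fa_ideal L (lie_rels L).\<close>
definition word_op :: "('g \<Rightarrow> ('v, 'a) dop) \<Rightarrow> 'g list \<Rightarrow> ('v, 'a::comm_ring_1) dop" where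
  "word_op \<iota> w = foldr (\<lambda>x D. \<iota> x \<circ> D) w id"

definition fa_hom :: "('g \<Rightarrow> ('v, 'a) dop) \<Rightarrow> ('g list \<Rightarrow>\<^sub>0 'a) \<Rightarrow> ('v, 'a::comm_ring_1) dop" where
  "fa_hom \<iota> f = (\<lambda>p. \<Sum>w\<in>Poly_Mapping.keys f. const_poly (Poly_Mapping.lookup f w) * word_op \<iota> w p)"

definition howe_embedding :: "'a::comm_ring_1 mat set \<Rightarrow> ('a mat \<Rightarrow> ('v, 'a) dop) \<Rightarrow> 'v set \<Rightarrow> ('v, 'a) dop set \<Rightarrow> bool" where
  "howe_embedding L \<iota> Vs DK \<longleftrightarrow>
     (\<forall>x\<in>L. \<forall>y\<in>L. \<iota> (x + y) = (\<lambda>p. \<iota> x p + \<iota> y p)) \<and>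
     (\<forall>c. \<forall>x\<in>L. \<iota> (c \<cdot>\<^sub>m x) = (\<lambda>p. const_poly c * \<iota> x p)) \<and>
     (\<forall>x\<in>L. \<forall>y\<in>L. \<iota> (x * y - y * x) = (\<lambda>p. \<iota> x (\<iota> y p) - \<iota> y (\<iota> x p))) \<and>
     inj_on \<iota> L \<and>
     \<iota> ` L \<subseteq> DK \<inter> weyl_le2 Vs \<and>
     alg_gen (\<iota> ` L) = DK"

text \<open>phi : U(L) \<rightarrow> DK is an isomorphism: its kernel is exactly the defining ideal of U(L)
  (injectivity on the quotient) and it is onto DK.\<close>
definition phi_iso :: "'a::comm_ring_1 mat set \<Rightarrow> ('a mat \<Rightarrow> ('v, 'a) dop) \<Rightarrow> ('v, 'a) dop set \<Rightarrow> bool" where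
  "phi_iso L \<iota> DK \<longleftrightarrow>
     (\<forall>f\<in>fa_on L. fa_hom \<iota> f = (\<lambda>p. 0) \<longrightarrow> f \<in> fa_ideal L (lie_rels L)) \<and>
     fa_hom \<iota> ` fa_on L = DK"

end

theory Submission
  imports Defs "HOL-Library.Multiset_Order" "HOL-Library.Product_Lexorder" "HOL-Library.FuncSet"
    "Jordan_Normal_Form.Determinant"
begin

text \<open>
  The kernel is controlled by growth, without computing the symbols of the generators. Let \<open>N\<close>
  be the number of elements of a spanning set of the Lie algebra; ordered monomials in them span the
  enveloping algebra. If some nontrivial combination of ordered monomials were killed by \<open>\<phi>\<close>, all
  monomials divisible by its leading monomial would be redundant in the image, so that the elements of
  the image of degree at most \<open>m\<close> would span a space of dimension \<open>O(m\<^sup>N\<^sup>-\<^sup>1)\<close>. On the other hand the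
  algebra of invariants contains \<open>N\<close> quadratic operators: the pairings of all the vectors
  (coordinates and derivatives) under the form that defines the group. The rank condition leaves enough room to
  choose weights on the generators of the Weyl algebra for which their leading monomials are
  multiplicatively independent, as in a Cholesky decomposition of a generic Gram matrix. Hence the
  monomials in these operators are linearly independent and the growth is at least \<open>m\<^sup>N\<close>.
\<close>

section \<open>Filtered algebras\<close>

text \<open>The obstacle is that \<iota> is given only abstractly: its image generates the
  invariants, but the images of individual Lie algebra elements are unknown, so their leading terms
  cannot be inspected. What remains is that every explicit invariant is a polynomial of some finite
  degree in these images. Finitely many invariants share a degree bound \<open>r\<close>, so that
  their (t+1)^N products with exponents at most t have degree at most rNt, which fixes the scale of
  the comparison. The number N is dim g and also counts the pairings: (p+q)^2 pairs of a covector
  and a vector for gl; n(2n+1) unordered pairs, repetition allowed, of 2n vectors for sp; n(2n-1)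
  pairs of distinct vectors for so, where the form is skew. The rank inequality says that the number
  of vectors (p+q, 2n, 2n) is at most the dimension of the standard representation (k, k, 2k). Each
  vector can thus be given a coordinate of its own, on which its weight is largest.\<close>

locale falgebra = vector_space scale
  for scale :: "'a::field \<Rightarrow> 'r::ring_1 \<Rightarrow> 'r" (infixr "*s" 75) +
  assumes scale_mult_left: "(c *s x) * y = c *s (x * y)"
    and scale_mult_right: "x * (c *s y) = c *s (x * y)"
begin

lemma span_mult_left:
  assumes "x \<in> span S" and "\<And>b. b \<in> S \<Longrightarrow> a * b \<in> span T"
  shows "a * x \<in> span T"
  using assms(1)
proof (induction rule: span_induct_alt)
  case base
  show ?case by (simp add: span_zero)
next
  case (step c b y)
  then show ?case
    by (simp add: distrib_left scale_mult_right span_add span_scale assms(2))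
qed

lemma span_mult_right:
  assumes "x \<in> span S" and "\<And>b. b \<in> S \<Longrightarrow> b * a \<in> span T"
  shows "x * a \<in> span T"
  using assms(1)
proof (induction rule: span_induct_alt)
  case base
  show ?case by (simp add: span_zero)
next
  case (step c b y)
  then show ?case
    by (simp add: distrib_right scale_mult_left span_add span_scale assms(2))
qed

lemma span_imageE:
  assumes "x \<in> span (f ` A)"
  obtains B b where "finite B" "B \<subseteq> A" "x = (\<Sum>\<mu>\<in>B. b \<mu> *s f \<mu>)"
proof -
  have "\<exists>B b. finite B \<and> B \<subseteq> A \<and> x = (\<Sum>\<mu>\<in>B. b \<mu> *s f \<mu>)"
    using assms
  proof (induction rule: span_induct_alt)
    case base
    show ?case by (intro exI[of _ "{}"]) simp
  next
    case (step c z y)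
    then obtain \<nu> B b where \<nu>: "\<nu> \<in> A" "z = f \<nu>"
      and B: "finite B" "B \<subseteq> A" "y = (\<Sum>\<mu>\<in>B. b \<mu> *s f \<mu>)" by blast
    define b' where "b' \<mu> = (if \<mu> \<in> B then b \<mu> else 0) + (if \<mu> = \<nu> then c else 0)" for \<mu>
    have "(\<Sum>\<mu>\<in>insert \<nu> B. b' \<mu> *s f \<mu>)
        = (\<Sum>\<mu>\<in>insert \<nu> B. (if \<mu> \<in> B then b \<mu> else 0) *s f \<mu>)
          + (\<Sum>\<mu>\<in>insert \<nu> B. (if \<mu> = \<nu> then c else 0) *s f \<mu>)"
      unfolding b'_def by (simp add: scale_left_distrib sum.distrib)
    also have "(\<Sum>\<mu>\<in>insert \<nu> B. (if \<mu> \<in> B then b \<mu> else 0) *s f \<mu>) = y"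
      unfolding B(3) using B(1) by (intro sum.mono_neutral_cong_right) auto
    also have "(\<Sum>\<mu>\<in>insert \<nu> B. (if \<mu> = \<nu> then c else 0) *s f \<mu>) = c *s f \<nu>"
      using B(1) sum.remove[of "insert \<nu> B" \<nu> "\<lambda>\<mu>. (if \<mu> = \<nu> then c else 0) *s f \<mu>"]
      by simp
    finally show ?case
      using B \<nu> by (intro exI[of _ "insert \<nu> B"] exI[of _ b']) (auto simp: add.commute)
  qed
  then show thesis using that by blast
qed

end

text \<open>One setting for three filtrations: U(L), lifted to the free algebra with its defining
  ideal as \<open>K\<close>; its image in the operators; and the Weyl algebra with chosen weights.
  An ordered monomial is whatever word \<open>lst\<close> picks for a multiset; any choice works
  once letters commute up to lower weight.\<close>

locale word_filtration = falgebra scale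
  for scale :: "'a::field \<Rightarrow> 'r::ring_1 \<Rightarrow> 'r" (infixr "*s" 75) +
  fixes K :: "'r set" and I :: "'i set" and g :: "'i \<Rightarrow> 'r" and wt :: "'i \<Rightarrow> nat"
    and lst :: "'i multiset \<Rightarrow> 'i list"
  assumes K_left: "i \<in> I \<Longrightarrow> x \<in> K \<Longrightarrow> g i * x \<in> K"
    and K_right: "i \<in> I \<Longrightarrow> x \<in> K \<Longrightarrow> x * g i \<in> K"
    and mset_lst [simp]: "mset (lst \<mu>) = \<mu>"
begin

definition word :: "'i list \<Rightarrow> 'r" where "word w = prod_list (map g w)"

definition weight :: "'i list \<Rightarrow> nat" where "weight w = sum_list (map wt w)"

definition mweight :: "'i multiset \<Rightarrow> nat" where "mweight \<mu> = sum_mset (image_mset wt \<mu>)"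

definition mon :: "'i multiset \<Rightarrow> 'r" where "mon \<mu> = word (lst \<mu>)"

text \<open>\<open>K\<close> plays the role of an ideal whose elements all have weight zero, so that the filtration
  lives on the quotient by \<open>K\<close> without forming it.\<close>
definition low :: "nat \<Rightarrow> 'r set" where
  "low n = span (K \<union> {word w | w. set w \<subseteq> I \<and> weight w < n})"

lemma word_simps [simp]:
  "word [] = 1" "word (i # w) = g i * word w" "word (u @ v) = word u * word v"
  by (simp_all add: word_def)

lemma weight_simps [simp]:
  "weight [] = 0" "weight (i # w) = wt i + weight w" "weight (u @ v) = weight u + weight v"
  by (simp_all add: weight_def)

lemma mweight_mset: "mweight (mset w) = weight w"
  by (simp add: mweight_def weight_def flip: sum_mset_sum_list)

lemma mweight_add [simp]: "mweight (\<mu> + \<nu>) = mweight \<mu> + mweight \<nu>"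
  by (simp add: mweight_def)

lemma weight_lst [simp]: "weight (lst \<mu>) = mweight \<mu>"
  by (simp flip: mweight_mset)

lemma set_lst [simp]: "set (lst \<mu>) = set_mset \<mu>"
  by (simp flip: set_mset_mset)

lemma word_in_low: "set w \<subseteq> I \<Longrightarrow> weight w < n \<Longrightarrow> word w \<in> low n"
  unfolding low_def by (intro span_base) auto

lemma low_mono: "x \<in> low m \<Longrightarrow> m \<le> n \<Longrightarrow> x \<in> low n"
proof -
  assume "x \<in> low m" "m \<le> n"
  moreover have "low m \<subseteq> low n" if "m \<le> n"
    unfolding low_def using that by (intro span_mono) fastforce
  ultimately show ?thesis by blast
qed

lemmas low_add = span_add[of _ "K \<union> {word w | w. set w \<subseteq> I \<and> weight w < n}" for n, folded low_def]
lemmas low_diff = span_diff[of _ "K \<union> {word w | w. set w \<subseteq> I \<and> weight w < n}" for n, folded low_def]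
lemmas low_neg = span_neg[of _ "K \<union> {word w | w. set w \<subseteq> I \<and> weight w < n}" for n, folded low_def]
lemmas low_scale = span_scale[of _ "K \<union> {word w | w. set w \<subseteq> I \<and> weight w < n}" for n, folded low_def]
lemmas low_sum = span_sum[of _ _ "K \<union> {word w | w. set w \<subseteq> I \<and> weight w < n}" for n, folded low_def]
lemmas low_zero = span_zero[of "K \<union> {word w | w. set w \<subseteq> I \<and> weight w < n}" for n, folded low_def]

lemma low_gen_left:
  assumes "i \<in> I" "x \<in> low n"
  shows "g i * x \<in> low (wt i + n)"
  using assms(2) unfolding low_def
proof (rule span_mult_left)
  fix b
  assume "b \<in> K \<union> {word w | w. set w \<subseteq> I \<and> weight w < n}"
  then show "g i * b \<in> span (K \<union> {word w | w. set w \<subseteq> I \<and> weight w < wt i + n})"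
  proof
    assume "b \<in> K"
    then show ?thesis using assms(1) by (intro span_base) (simp add: K_left)
  next
    assume "b \<in> {word w | w. set w \<subseteq> I \<and> weight w < n}"
    then obtain w where "b = word w" "set w \<subseteq> I" "weight w < n" by blast
    then show ?thesis using assms(1)
      by (intro span_base) (auto intro!: exI[of _ "i # w"])
  qed
qed

lemma low_gen_right:
  assumes "i \<in> I" "x \<in> low n"
  shows "x * g i \<in> low (n + wt i)"
  using assms(2) unfolding low_def
proof (rule span_mult_right)
  fix b
  assume "b \<in> K \<union> {word w | w. set w \<subseteq> I \<and> weight w < n}"
  then show "b * g i \<in> span (K \<union> {word w | w. set w \<subseteq> I \<and> weight w < n + wt i})"
  proof
    assume "b \<in> K"
    then show ?thesis using assms(1) by (intro span_base) (simp add: K_right)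
  next
    assume "b \<in> {word w | w. set w \<subseteq> I \<and> weight w < n}"
    then obtain w where "b = word w" "set w \<subseteq> I" "weight w < n" by blast
    then show ?thesis using assms(1)
      by (intro span_base) (auto intro!: exI[of _ "w @ [i]"])
  qed
qed

lemma low_word_left: "set w \<subseteq> I \<Longrightarrow> x \<in> low n \<Longrightarrow> word w * x \<in> low (weight w + n)"
proof (induction w)
  case (Cons i w)
  then have "g i * (word w * x) \<in> low (wt i + (weight w + n))"
    by (intro low_gen_left) auto
  then show ?case by (simp add: mult.assoc add.assoc)
qed simp

lemma low_word_right: "set w \<subseteq> I \<Longrightarrow> x \<in> low n \<Longrightarrow> x * word w \<in> low (n + weight w)"
proof (induction w arbitrary: x n)
  case (Cons i w)
  then have "(x * g i) * word w \<in> low ((n + wt i) + weight w)"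
    by (intro Cons.IH low_gen_right) auto
  then show ?case by (simp add: mult.assoc add.assoc)
qed simp

end

text \<open>The associated graded algebra, modulo \<open>K\<close>, is commutative: in U(L) because
  a bracket has degree one, in the Weyl algebra because commutators of generators are
  scalars.\<close>

locale commutative_filtration = word_filtration +
  assumes commutator_low:
    "i \<in> I \<Longrightarrow> j \<in> I \<Longrightarrow> g i * g j - g j * g i \<in> low (wt i + wt j)"
begin

lemma word_move_front:
  assumes "i \<in> I" "set u \<subseteq> I"
  shows "g i * word u - word u * g i \<in> low (wt i + weight u)"
  using assms(2)
proof (induction u)
  case Nil
  then show ?case by (simp add: low_zero)
next
  case (Cons j u)
  have "g i * word (j # u) - word (j # u) * g i
      = (g i * g j - g j * g i) * word u + g j * (g i * word u - word u * g i)"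
    by (simp add: algebra_simps)
  moreover have "(g i * g j - g j * g i) * word u \<in> low ((wt i + wt j) + weight u)"
    using Cons.prems assms(1) by (intro low_word_right commutator_low) auto
  moreover have "g j * (g i * word u - word u * g i) \<in> low (wt j + (wt i + weight u))"
    using Cons by (intro low_gen_left) auto
  ultimately show ?case by (simp add: low_add add_ac)
qed

text \<open>The first letter of \<open>w\<close> is located in \<open>w'\<close> and pulled to the
  front at the cost of lower weight; the remaining words have equal multisets and are handled by
  induction.\<close>

lemma word_permute:
  assumes "mset w = mset w'" "set w \<subseteq> I"
  shows "word w - word w' \<in> low (weight w)"
  using assms
proof (induction w arbitrary: w')
  case Nil
  then show ?case by (simp add: low_zero)
next
  case (Cons i w)
  then have "i \<in> set w'" by (metis list.set_intros(1) set_mset_mset)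
  then obtain u v where w': "w' = u @ i # v" by (meson split_list)
  have m: "mset w = mset (u @ v)" using Cons.prems(1) by (simp add: w')
  have sub: "set u \<subseteq> I" "set v \<subseteq> I" "i \<in> I" "set w \<subseteq> I"
    using Cons.prems mset_eq_setD[OF m] by (auto simp: w')
  have wt: "weight w = weight u + weight v"
    using m by (metis mweight_mset weight_simps(3))
  have "word (i # w) - word w' = g i * (word w - word (u @ v)) + (g i * word u - word u * g i) * word v"
    by (simp add: w' algebra_simps)
  moreover have "g i * (word w - word (u @ v)) \<in> low (wt i + weight w)"
    using Cons.IH[OF m] sub by (intro low_gen_left) auto
  moreover have "(g i * word u - word u * g i) * word v \<in> low ((wt i + weight u) + weight v)"
    using sub by (intro low_word_right word_move_front)
  ultimately show ?case by (simp add: wt low_add add_ac)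
qed

lemma word_mon: "set w \<subseteq> I \<Longrightarrow> word w - mon (mset w) \<in> low (weight w)"
  unfolding mon_def by (rule word_permute) auto

text \<open>The spanning half of the Poincare-Birkhoff-Witt theorem. Induction on weight rather than
  length also copes with letters of weight zero, since every correction has strictly smaller
  weight.\<close>

lemma low_subset_span_mon:
  "low n \<subseteq> span (K \<union> mon ` {\<mu>. set_mset \<mu> \<subseteq> I \<and> mweight \<mu> < n})"
proof (induction n rule: less_induct)
  case (less n)
  let ?S = "K \<union> mon ` {\<mu>. set_mset \<mu> \<subseteq> I \<and> mweight \<mu> < n}"
  have "word w \<in> span ?S" if w: "set w \<subseteq> I" "weight w < n" for w
  proof -
    have "low (weight w) \<subseteq> span ?S"
      using w(2) by (intro order_trans[OF less.IH[OF w(2)]] span_mono) auto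
    then have "word w - mon (mset w) \<in> span ?S"
      using word_mon[OF w(1)] by blast
    moreover have "mon (mset w) \<in> span ?S"
      using w by (intro span_base) (auto simp: mweight_mset)
    ultimately show ?thesis
      using span_add by fastforce
  qed
  then show ?case
    unfolding low_def by (intro span_minimal subspace_span) (auto intro: span_base)
qed

end

section \<open>Independent families and leading monomials\<close>

context falgebra
begin

text \<open>Independence of a family rather than of its set of values: a repeated value is already a
  dependence. This allows index sets of monomials to be counted against spanning sets.\<close>

definition indep_family :: "('s \<Rightarrow> 'r) \<Rightarrow> 's set \<Rightarrow> bool" where
  "indep_family f A \<longleftrightarrow>
     (\<forall>B b. finite B \<longrightarrow> B \<subseteq> A \<longrightarrow> (\<Sum>s\<in>B. b s *s f s) = 0 \<longrightarrow> (\<forall>s\<in>B. b s = 0))"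

lemma indep_familyD:
  "indep_family f A \<Longrightarrow> finite B \<Longrightarrow> B \<subseteq> A \<Longrightarrow> (\<Sum>s\<in>B. b s *s f s) = 0 \<Longrightarrow> s \<in> B \<Longrightarrow> b s = 0"
  unfolding indep_family_def by blast

lemma indep_family_subset: "indep_family f A \<Longrightarrow> B \<subseteq> A \<Longrightarrow> indep_family f B"
  unfolding indep_family_def by (meson order_trans)

lemma indep_family_card_le:
  assumes "indep_family f A" "finite A" "f ` A \<subseteq> span T" "finite T"
  shows "card A \<le> card T"
proof -
  have inj: "inj_on f A"
  proof (rule inj_onI, rule ccontr)
    fix s t assume st: "s \<in> A" "t \<in> A" "f s = f t" "s \<noteq> t"
    have "(\<Sum>x\<in>{s, t}. (if x = s then 1 else - 1) *s f x) = 0"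
      using st by simp
    from indep_familyD[OF assms(1) _ _ this, of s] st show False by simp
  qed
  have "independent (f ` A)"
    unfolding independent_explicit_module
  proof (intro allI impI)
    fix t u v
    assume t: "finite t" "t \<subseteq> f ` A" "(\<Sum>v\<in>t. u v *s v) = 0" "v \<in> t"
    obtain B where B: "B \<subseteq> A" "t = f ` B" using t(2) by (auto simp: subset_image_iff)
    have injB: "inj_on f B" using inj B(1) by (rule inj_on_subset)
    have "(\<Sum>s\<in>B. u (f s) *s f s) = 0"
      using t(3) unfolding B(2) by (simp add: sum.reindex[OF injB])
    moreover have "finite B" using assms(2) B(1) by (rule finite_subset[rotated])
    ultimately show "u v = 0"
      using indep_familyD[OF assms(1) _ B(1), of "u \<circ> f"] t(4) B(2) by auto
  qed
  from independent_span_bound[OF assms(4) this assms(3)] have "card (f ` A) \<le> card T" by simp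
  then show ?thesis by (simp add: card_image[OF inj])
qed

end

locale filtration = commutative_filtration scale "{}" I g wt lst
  for scale :: "'a::field \<Rightarrow> 'r::ring_1 \<Rightarrow> 'r" (infixr "*s" 75) and I :: "'i set" and g wt lst
begin

lemma low_subset_span_mon0: "low n \<subseteq> span (mon ` {\<mu>. set_mset \<mu> \<subseteq> I \<and> mweight \<mu> < n})"
  using low_subset_span_mon[of n] by simp

text \<open>\<open>low n\<close> means weight strictly below \<open>n\<close>, so
  \<open>low (Suc b)\<close> means weight at most \<open>b\<close>; a strict and a weak bound add up
  to a strict one.\<close>

lemma low_mult:
  assumes "x \<in> low a" "y \<in> low (Suc b)"
  shows "x * y \<in> low (a + b)"
proof -
  have "word w * y \<in> low (a + b)" if "set w \<subseteq> I" "weight w < a" for w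
    using low_word_left[OF that(1) assms(2)] by (rule low_mono) (use that(2) in simp)
  then show ?thesis
    using assms(1) span_mult_right[of x _ y] unfolding low_def by blast
qed

lemma mon_in_low: "set_mset \<mu> \<subseteq> I \<Longrightarrow> mweight \<mu> < n \<Longrightarrow> mon \<mu> \<in> low n"
  unfolding mon_def by (rule word_in_low) auto

lemma mon_empty [simp]: "mon {#} = 1"
proof -
  have "lst {#} = []" by (metis mset_lst mset_zero_iff)
  then show ?thesis by (simp add: mon_def)
qed

lemma mon_mult:
  assumes "set_mset \<mu> \<subseteq> I" "set_mset \<nu> \<subseteq> I"
  shows "mon \<mu> * mon \<nu> - mon (\<mu> + \<nu>) \<in> low (mweight \<mu> + mweight \<nu>)"
  using word_mon[of "lst \<mu> @ lst \<nu>"] assms by (simp add: mon_def)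

definition leading :: "'r \<Rightarrow> 'a \<Rightarrow> 'i multiset \<Rightarrow> bool" where
  "leading x c \<mu> \<longleftrightarrow> set_mset \<mu> \<subseteq> I \<and> x - c *s mon \<mu> \<in> low (mweight \<mu>)"

lemma leading_one: "leading 1 1 {#}"
  by (simp add: leading_def low_zero)

lemma leading_in_low:
  assumes "leading x c \<mu>"
  shows "x \<in> low (Suc (mweight \<mu>))"
proof -
  have "c *s mon \<mu> \<in> low (Suc (mweight \<mu>))"
    using assms unfolding leading_def by (intro low_scale mon_in_low) auto
  moreover have "x - c *s mon \<mu> \<in> low (Suc (mweight \<mu>))"
    using assms unfolding leading_def by (auto intro: low_mono)
  ultimately show ?thesis using low_add by fastforce
qed

lemma leading_mult:
  assumes "leading x c \<mu>" "leading y d \<nu>"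
  shows "leading (x * y) (c * d) (\<mu> + \<nu>)"
proof -
  have x: "set_mset \<mu> \<subseteq> I" "x - c *s mon \<mu> \<in> low (mweight \<mu>)"
    and y: "set_mset \<nu> \<subseteq> I" "y - d *s mon \<nu> \<in> low (mweight \<nu>)"
    using assms by (auto simp: leading_def)
  have "x * y - (c * d) *s mon (\<mu> + \<nu>)
      = (x - c *s mon \<mu>) * y + c *s (mon \<mu> * (y - d *s mon \<nu>))
        + (c * d) *s (mon \<mu> * mon \<nu> - mon (\<mu> + \<nu>))"
    by (simp add: algebra_simps scale_mult_left scale_mult_right scale_right_diff_distrib)
  moreover have "(x - c *s mon \<mu>) * y \<in> low (mweight \<mu> + mweight \<nu>)"
    by (rule low_mult[OF x(2) leading_in_low[OF assms(2)]])
  moreover have "mon \<mu> * (y - d *s mon \<nu>) \<in> low (mweight \<mu> + mweight \<nu>)"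
    using low_word_left[of "lst \<mu>", OF _ y(2)] x(1) by (simp add: mon_def)
  ultimately show ?thesis
    using x y by (auto simp: leading_def intro!: low_add low_scale mon_mult)
qed

lemma leading_prod_list:
  assumes "\<And>j. j \<in> set js \<Longrightarrow> leading (Q j) (c j) (m j)"
  shows "leading (prod_list (map Q js)) (prod_list (map c js)) (sum_list (map m js))"
  using assms by (induction js) (auto intro: leading_mult simp: leading_one)

text \<open>In a relation, the terms whose leading monomials have maximal weight \<open>d\<close>
  must cancel modulo \<open>low d\<close>. As \<open>low d\<close> is spanned by monomials of weight
  below \<open>d\<close>, this would be a relation between distinct independent monomials.\<close>

lemma indep_family_leading:
  assumes indep: "indep_family mon {\<mu>. set_mset \<mu> \<subseteq> I}"
    and lead: "\<And>s. s \<in> S \<Longrightarrow> leading (D s) (c s) (m s)" and c: "\<And>s. s \<in> S \<Longrightarrow> c s \<noteq> 0"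
    and inj: "inj_on m S"
  shows "indep_family D S"
  unfolding indep_family_def
proof (intro allI impI, rule ccontr)
  fix B b
  assume B: "finite B" "B \<subseteq> S" "(\<Sum>s\<in>B. b s *s D s) = 0" and "\<not> (\<forall>s\<in>B. b s = 0)"
  define T where "T = {s \<in> B. b s \<noteq> 0}"
  have T: "finite T" "T \<subseteq> S" "T \<noteq> {}"
    using B \<open>\<not> _\<close> by (auto simp: T_def)
  have sumT: "(\<Sum>s\<in>T. b s *s D s) = 0"
    using B(3) sum.mono_neutral_left[of B T "\<lambda>s. b s *s D s"] B(1) by (simp add: T_def)
  define d where "d = Max ((mweight \<circ> m) ` T)"
  have d_ge: "mweight (m s) \<le> d" if "s \<in> T" for s
    using T that unfolding d_def by (intro Max_ge) auto
  obtain s0 where s0: "s0 \<in> T" "mweight (m s0) = d"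
    using Max_in[of "(mweight \<circ> m) ` T"] T unfolding d_def by fastforce
  define Td where "Td = {s \<in> T. mweight (m s) = d}"
  have Td: "finite Td" "Td \<subseteq> T" "s0 \<in> Td" using T s0 by (auto simp: Td_def)
  define x where "x = (\<Sum>s\<in>Td. (b s * c s) *s mon (m s))"
  have "x = - (\<Sum>s\<in>Td. b s *s (D s - c s *s mon (m s))) - (\<Sum>s\<in>T - Td. b s *s D s)"
    using sumT sum.subset_diff[OF Td(2) T(1), of "\<lambda>s. b s *s D s"]
    by (simp add: x_def scale_right_diff_distrib sum_subtractf algebra_simps)
  also have "\<dots> \<in> low d"
  proof (rule low_diff; intro low_neg low_sum low_scale)
    fix s assume "s \<in> Td"
    then show "D s - c s *s mon (m s) \<in> low d"
      using lead[of s] T(2) by (auto simp: Td_def leading_def)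
  next
    fix s assume s: "s \<in> T - Td"
    then have "mweight (m s) < d" using d_ge[of s] by (auto simp: Td_def)
    then show "D s \<in> low d"
      using low_mono[OF leading_in_low[OF lead[of s]], of d] s T(2) by auto
  qed
  finally have "x \<in> span (mon ` {\<mu>. set_mset \<mu> \<subseteq> I \<and> mweight \<mu> < d})"
    using low_subset_span_mon0[of d] by blast
  then obtain C e where C: "finite C" "C \<subseteq> {\<mu>. set_mset \<mu> \<subseteq> I \<and> mweight \<mu> < d}"
    "x = (\<Sum>\<mu>\<in>C. e \<mu> *s mon \<mu>)"
    by (rule span_imageE)
  have injT: "inj_on m Td" using inj T(2) Td(2) by (meson inj_on_subset)
  \<comment> \<open>The two expressions for \<open>x\<close> merge into one relation: coefficients
    \<open>- e\<close> on monomials of weight below \<open>d\<close>, and \<open>b s * c s\<close>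
    on the leading ones. The two sets of monomials are disjoint by weight.\<close>
  define h where "h \<mu> = (if \<mu> \<in> C then - e \<mu> else b (the_inv_into Td m \<mu>) * c (the_inv_into Td m \<mu>))" for \<mu>
  have disj: "C \<inter> m ` Td = {}" using C(2) by (auto simp: Td_def)
  have h: "h (m s) = b s * c s" if "s \<in> Td" for s
    using disj that the_inv_into_f_f[OF injT] by (auto simp: h_def)
  have "(\<Sum>\<mu>\<in>C \<union> m ` Td. h \<mu> *s mon \<mu>) = (\<Sum>\<mu>\<in>C. h \<mu> *s mon \<mu>) + (\<Sum>\<mu>\<in>m ` Td. h \<mu> *s mon \<mu>)"
    using C(1) Td(1) disj by (intro sum.union_disjoint) auto
  also have "(\<Sum>\<mu>\<in>C. h \<mu> *s mon \<mu>) = - x"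
    unfolding C(3) by (simp add: h_def flip: sum_negf)
  also have "(\<Sum>\<mu>\<in>m ` Td. h \<mu> *s mon \<mu>) = x"
    unfolding x_def by (simp add: sum.reindex[OF injT] h)
  finally have "(\<Sum>\<mu>\<in>C \<union> m ` Td. h \<mu> *s mon \<mu>) = 0" by simp
  moreover have "C \<union> m ` Td \<subseteq> {\<mu>. set_mset \<mu> \<subseteq> I}"
    using C(2) Td(2) T(2) lead unfolding leading_def by blast
  ultimately have "h (m s0) = 0"
    using indep_familyD[OF indep, of "C \<union> m ` Td" h] C(1) Td by auto
  then have "b s0 * c s0 = 0" using h[OF Td(3)] by simp
  then show False using s0(1) c[of s0] T(2) by (auto simp: T_def)
qed

end

section \<open>Growth\<close>

text \<open>A monomial that \<alpha> does not divide has, in some variable \<open>i\<close>, one of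
  the \<open>count \<alpha> i\<close> exponents below that of \<alpha>; the other
  \<open>card I - 1\<close> exponents are at most \<open>m\<close>. Summing over \<open>i\<close>
  gives the factor \<open>size \<alpha>\<close>.\<close>

lemma card_multisets_not_above:
  fixes \<alpha> :: "'i multiset"
  assumes "finite I" "set_mset \<alpha> \<subseteq> I"
  shows "finite {\<gamma>. set_mset \<gamma> \<subseteq> I \<and> size \<gamma> \<le> m \<and> \<not> \<alpha> \<subseteq># \<gamma>}"
    and "card {\<gamma>. set_mset \<gamma> \<subseteq> I \<and> size \<gamma> \<le> m \<and> \<not> \<alpha> \<subseteq># \<gamma>} \<le> size \<alpha> * Suc m ^ (card I - 1)"
proof -
  let ?N = "{\<gamma>. set_mset \<gamma> \<subseteq> I \<and> size \<gamma> \<le> m \<and> \<not> \<alpha> \<subseteq># \<gamma>}"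
  let ?F = "\<lambda>\<gamma>. restrict (count \<gamma>) I"
  let ?T = "\<Union>i\<in>I. \<Union>v\<in>{..<count \<alpha> i}. (\<lambda>f. f(i := v)) ` (PiE (I - {i}) (\<lambda>_. {..m}))"
  have inj: "inj_on ?F ?N"
  proof (rule inj_onI)
    fix \<gamma> \<delta> assume *: "\<gamma> \<in> ?N" "\<delta> \<in> ?N" "?F \<gamma> = ?F \<delta>"
    have "count \<gamma> i = count \<delta> i" for i
    proof (cases "i \<in> I")
      case True
      then show ?thesis using fun_cong[OF *(3), of i] by simp
    next
      case False
      then show ?thesis using * by (metis (no_types, lifting) count_eq_zero_iff mem_Collect_eq subsetD)
    qed
    then show "\<gamma> = \<delta>" by (rule multiset_eqI)
  qed
  have sub: "?F ` ?N \<subseteq> ?T"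
  proof
    fix f assume "f \<in> ?F ` ?N"
    then obtain \<gamma> where \<gamma>: "set_mset \<gamma> \<subseteq> I" "size \<gamma> \<le> m" "\<not> \<alpha> \<subseteq># \<gamma>" "f = ?F \<gamma>" by blast
    obtain i where i: "count \<gamma> i < count \<alpha> i"
      using \<gamma>(3) by (auto simp: subseteq_mset_def not_le)
    then have "i \<in> I" using assms(2) by (metis count_greater_zero_iff gr_implies_not0 neq0_conv subsetD)
    moreover have "f = (restrict (count \<gamma>) (I - {i}))(i := count \<gamma> i)"
      using \<open>i \<in> I\<close> \<gamma>(4) by (auto simp: restrict_def)
    moreover have "restrict (count \<gamma>) (I - {i}) \<in> PiE (I - {i}) (\<lambda>_. {..m})"
      using \<gamma>(2) by (auto intro: order_trans[OF count_le_size])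
    ultimately show "f \<in> ?T" using i by blast
  qed
  have finT: "finite ?T" using assms(1) by (auto intro!: finite_PiE)
  show "finite ?N" using finite_imageD[OF finite_subset[OF sub finT] inj] .
  have "card ?N = card (?F ` ?N)" by (simp add: card_image[OF inj])
  also have "\<dots> \<le> card ?T" by (rule card_mono[OF finT sub])
  also have "\<dots> \<le> (\<Sum>i\<in>I. card (\<Union>v\<in>{..<count \<alpha> i}. (\<lambda>f. f(i := v)) ` (PiE (I - {i}) (\<lambda>_. {..m}))))"
    by (rule card_UN_le[OF assms(1)])
  also have "\<dots> \<le> (\<Sum>i\<in>I. count \<alpha> i * Suc m ^ (card I - 1))"
  proof (rule sum_mono)
    fix i assume i: "i \<in> I"
    have "card (\<Union>v\<in>{..<count \<alpha> i}. (\<lambda>f. f(i := v)) ` (PiE (I - {i}) (\<lambda>_. {..m})))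
        \<le> (\<Sum>v\<in>{..<count \<alpha> i}. card ((\<lambda>f. f(i := v)) ` (PiE (I - {i}) (\<lambda>_. {..m}))))"
      by (rule card_UN_le) simp
    also have "\<dots> \<le> (\<Sum>v\<in>{..<count \<alpha> i}. Suc m ^ (card I - 1))"
    proof (rule sum_mono)
      fix v
      have "card ((\<lambda>f. f(i := v)) ` (PiE (I - {i}) (\<lambda>_. {..m}))) \<le> card (PiE (I - {i}) (\<lambda>_. {..m}))"
        using assms(1) by (intro card_image_le finite_PiE) auto
      also have "\<dots> = Suc m ^ (card I - 1)"
        using assms(1) i by (simp add: card_PiE card_Diff_singleton)
      finally show "card ((\<lambda>f. f(i := v)) ` (PiE (I - {i}) (\<lambda>_. {..m}))) \<le> Suc m ^ (card I - 1)" .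
    qed
    finally show "card (\<Union>v\<in>{..<count \<alpha> i}. (\<lambda>f. f(i := v)) ` (PiE (I - {i}) (\<lambda>_. {..m})))
        \<le> count \<alpha> i * Suc m ^ (card I - 1)" by simp
  qed
  also have "\<dots> = size \<alpha> * Suc m ^ (card I - 1)"
  proof -
    have "size \<alpha> = (\<Sum>i\<in>I. count \<alpha> i)"
      unfolding size_multiset_overloaded_eq using assms
      by (intro sum.mono_neutral_left) (auto simp: count_eq_zero_iff)
    then show ?thesis by (simp add: sum_distrib_right)
  qed
  finally show "card ?N \<le> size \<alpha> * Suc m ^ (card I - 1)" .
qed

definition box_multiset :: "'j set \<Rightarrow> ('j \<Rightarrow> nat) \<Rightarrow> 'j multiset" where
  "box_multiset J f = (\<Sum>j\<in>J. replicate_mset (f j) j)"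

lemma count_box_multiset:
  assumes "finite J"
  shows "count (box_multiset J f) j = (if j \<in> J then f j else 0)"
proof -
  have "count (box_multiset J f) j = (\<Sum>i\<in>J. if j = i then f i else 0)"
    unfolding box_multiset_def count_sum by (intro sum.cong) auto
  then show ?thesis using assms by simp
qed

lemma card_multiset_box:
  assumes "finite J"
  shows "finite (box_multiset J ` PiE J (\<lambda>_. {..t}))" "card (box_multiset J ` PiE J (\<lambda>_. {..t})) = Suc t ^ card J"
    and "\<gamma> \<in> box_multiset J ` PiE J (\<lambda>_. {..t}) \<Longrightarrow> set_mset \<gamma> \<subseteq> J \<and> size \<gamma> \<le> card J * t"
proof -
  have "inj_on (box_multiset J) (PiE J (\<lambda>_. {..t}))"
  proof (rule inj_onI)
    fix f h assume *: "f \<in> PiE J (\<lambda>_. {..t})" "h \<in> PiE J (\<lambda>_. {..t})" "box_multiset J f = box_multiset J h"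
    have "f j = h j" if "j \<in> J" for j
      using arg_cong[OF *(3), of "\<lambda>\<gamma>. count \<gamma> j"] that by (simp add: count_box_multiset[OF assms])
    then show "f = h" using * by (intro PiE_ext)
  qed
  then show "card (box_multiset J ` PiE J (\<lambda>_. {..t})) = Suc t ^ card J"
    using assms by (simp add: card_image card_PiE)
  show "finite (box_multiset J ` PiE J (\<lambda>_. {..t}))"
    using assms by (simp add: finite_PiE)
  assume "\<gamma> \<in> box_multiset J ` PiE J (\<lambda>_. {..t})"
  then obtain f where f: "f \<in> PiE J (\<lambda>_. {..t})" "\<gamma> = box_multiset J f" by blast
  have sub: "set_mset \<gamma> \<subseteq> J"
  proof
    fix j assume "j \<in># \<gamma>"
    then have "count (box_multiset J f) j \<noteq> 0" by (simp add: f(2))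
    then show "j \<in> J" unfolding count_box_multiset[OF assms] by (metis (full_types))
  qed
  have "size \<gamma> = (\<Sum>j\<in>J. count \<gamma> j)"
    unfolding size_multiset_overloaded_eq using assms sub
    by (intro sum.mono_neutral_left) (auto simp: count_eq_zero_iff)
  also have "\<dots> \<le> (\<Sum>j\<in>J. t)"
    using f by (intro sum_mono) (auto simp: count_box_multiset[OF assms])
  finally show "set_mset \<gamma> \<subseteq> J \<and> size \<gamma> \<le> card J * t" using sub by simp
qed

text \<open>Weight is word length here. The well-order on letters induces one on multisets that is
  compatible with addition; it supplies leading monomials and the termination of reductions.\<close>

locale unit_filtration = filtration scale I g "\<lambda>_. Suc 0" lst
  for scale :: "'a::field \<Rightarrow> 'r::ring_1 \<Rightarrow> 'r" (infixr "*s" 75)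
    and I :: "'i::wellorder set" and g lst +
  assumes finite_I: "finite I"
begin

lemma mweight_size [simp]: "mweight \<mu> = size \<mu>"
  by (induction \<mu>) (simp_all add: mweight_def)

lemma prod_list_in_low:
  assumes "\<And>j. j \<in> set js \<Longrightarrow> Q j \<in> low (Suc r)"
  shows "prod_list (map Q js) \<in> low (Suc (r * length js))"
  using assms
proof (induction js)
  case Nil
  then show ?case using word_in_low[of "[]" 1] by simp
next
  case (Cons j js)
  then have "Q j * prod_list (map Q js) \<in> low (Suc r + r * length js)"
    by (intro low_mult) auto
  then show ?case by simp
qed

text \<open>A linear relation between ordered monomials makes all monomials divisible by its leading
  one redundant, which lowers the growth of the algebra by one order.\<close>
lemma low_subset_span_not_above:
  assumes S: "finite S" "S \<subseteq> {\<mu>. set_mset \<mu> \<subseteq> I}" and rel: "(\<Sum>\<gamma>\<in>S. c \<gamma> *s mon \<gamma>) = 0"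
    and nz: "\<gamma>\<^sub>0 \<in> S" "c \<gamma>\<^sub>0 \<noteq> 0"
  obtains \<alpha> where "set_mset \<alpha> \<subseteq> I"
    "\<And>m. low (Suc m) \<subseteq> span (mon ` {\<gamma>. set_mset \<gamma> \<subseteq> I \<and> size \<gamma> \<le> m \<and> \<not> \<alpha> \<subseteq># \<gamma>})"
proof -
  define T where "T = {\<gamma> \<in> S. c \<gamma> \<noteq> 0}"
  have T: "finite T" "T \<subseteq> {\<mu>. set_mset \<mu> \<subseteq> I}" "T \<noteq> {}" using S nz by (auto simp: T_def)
  have relT: "(\<Sum>\<gamma>\<in>T. c \<gamma> *s mon \<gamma>) = 0"
    using rel sum.mono_neutral_left[of S T "\<lambda>\<gamma>. c \<gamma> *s mon \<gamma>"] S(1) by (simp add: T_def)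
  \<comment> \<open>Degree first, then the multiset order: commutators lower the degree, hence also
    the key, so corrections never reach the leading monomial.\<close>
  let ?key = "\<lambda>\<gamma>::'i multiset. (size \<gamma>, \<gamma>)"
  have fin: "finite (?key ` T)" "?key ` T \<noteq> {}" using T by auto
  obtain \<alpha> where \<alpha>: "\<alpha> \<in> T" "?key \<alpha> = Max (?key ` T)" using Max_in[OF fin] by auto
  have \<alpha>I: "set_mset \<alpha> \<subseteq> I" using \<alpha>(1) T(2) by auto
  have max: "?key \<gamma> < ?key \<alpha>" if "\<gamma> \<in> T" "\<gamma> \<noteq> \<alpha>" for \<gamma>
  proof -
    have "?key \<gamma> \<le> ?key \<alpha>" unfolding \<alpha>(2) using fin(1) that(1) by (intro Max_ge) auto
    then show ?thesis using that(2) by (simp add: less_le)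
  qed
  have reduce: "mon \<delta> \<in> span (mon ` {\<gamma>. set_mset \<gamma> \<subseteq> I \<and> ?key \<gamma> < ?key \<delta>})"
    if \<delta>: "set_mset \<delta> \<subseteq> I" "\<alpha> \<subseteq># \<delta>" for \<delta>
  proof -
    let ?S = "mon ` {\<gamma>. set_mset \<gamma> \<subseteq> I \<and> ?key \<gamma> < ?key \<delta>}"
    \<comment> \<open>The relation is multiplied on the left by the cofactor of \<alpha> in
      \<delta>. Up to lower degree, this turns \<alpha> into \<delta> and every other monomial of
      the relation into one with smaller key.\<close>
    define \<beta> where "\<beta> = \<delta> - \<alpha>"
    have \<beta>: "\<delta> = \<beta> + \<alpha>" "set_mset \<beta> \<subseteq> I" using \<delta> by (auto simp: \<beta>_def dest: in_diffD)
    have lowS: "low (size \<delta>) \<subseteq> span ?S"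
      by (rule order_trans[OF low_subset_span_mon0 span_mono]) auto
    have diff: "mon \<beta> * mon \<gamma> - mon (\<beta> + \<gamma>) \<in> span ?S" if "\<gamma> \<in> T" for \<gamma>
    proof -
      have "size \<gamma> \<le> size \<alpha>" using max[OF that] by fastforce
      then have "low (size \<beta> + size \<gamma>) \<subseteq> low (size \<delta>)"
        using low_mono by (auto simp: \<beta>(1))
      moreover have "mon \<beta> * mon \<gamma> - mon (\<beta> + \<gamma>) \<in> low (size \<beta> + size \<gamma>)"
        using mon_mult[of \<beta> \<gamma>] \<beta>(2) T(2) that by auto
      ultimately show ?thesis using lowS by blast
    qed
    have "c \<alpha> *s (mon \<beta> * mon \<alpha>) = - (\<Sum>\<gamma>\<in>T - {\<alpha>}. c \<gamma> *s (mon \<beta> * mon \<gamma>))"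
    proof -
      have "mon \<beta> * (\<Sum>\<gamma>\<in>T. c \<gamma> *s mon \<gamma>) = 0" by (simp add: relT)
      then have "(\<Sum>\<gamma>\<in>T. c \<gamma> *s (mon \<beta> * mon \<gamma>)) = 0"
        by (simp add: sum_distrib_left scale_mult_right)
      then show ?thesis
        using sum.remove[OF T(1) \<alpha>(1), of "\<lambda>\<gamma>. c \<gamma> *s (mon \<beta> * mon \<gamma>)"]
        by (simp add: eq_neg_iff_add_eq_0)
    qed
    also have "\<dots> \<in> span ?S"
    proof (intro span_neg span_sum span_scale)
      fix \<gamma> assume \<gamma>: "\<gamma> \<in> T - {\<alpha>}"
      then have "?key (\<beta> + \<gamma>) < ?key \<delta>" using max[of \<gamma>] by (auto simp: \<beta>(1))
      then have "mon (\<beta> + \<gamma>) \<in> span ?S"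
        using \<gamma> T(2) \<beta>(2) by (intro span_base) auto
      then show "mon \<beta> * mon \<gamma> \<in> span ?S"
        using diff[of \<gamma>] \<gamma> span_add by fastforce
    qed
    finally have "c \<alpha> *s (mon \<beta> * mon \<alpha>) \<in> span ?S" .
    then have "inverse (c \<alpha>) *s (c \<alpha> *s (mon \<beta> * mon \<alpha>)) \<in> span ?S" by (rule span_scale)
    then have "mon \<beta> * mon \<alpha> \<in> span ?S" using \<alpha>(1) by (simp add: T_def)
    then show ?thesis
      using span_diff[OF _ diff[OF \<alpha>(1)], of "mon \<beta> * mon \<alpha>"] by (simp add: \<beta>(1))
  qed
  have normal: "mon \<delta> \<in> span (mon ` {\<gamma>. set_mset \<gamma> \<subseteq> I \<and> size \<gamma> \<le> size \<delta> \<and> \<not> \<alpha> \<subseteq># \<gamma>})"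
    if "set_mset \<delta> \<subseteq> I" for \<delta>
    using that
  proof (induction "?key \<delta>" arbitrary: \<delta> rule: less_induct)
    case (less \<delta>)
    let ?N = "mon ` {\<gamma>. set_mset \<gamma> \<subseteq> I \<and> size \<gamma> \<le> size \<delta> \<and> \<not> \<alpha> \<subseteq># \<gamma>}"
    show ?case
    proof (cases "\<alpha> \<subseteq># \<delta>")
      case False
      then show ?thesis using less.prems by (intro span_base) auto
    next
      case True
      have "mon \<gamma> \<in> span ?N" if \<gamma>: "set_mset \<gamma> \<subseteq> I" "?key \<gamma> < ?key \<delta>" for \<gamma>
      proof -
        have "size \<gamma> \<le> size \<delta>" using \<gamma>(2) by auto
        then have "span (mon ` {\<gamma>'. set_mset \<gamma>' \<subseteq> I \<and> size \<gamma>' \<le> size \<gamma> \<and> \<not> \<alpha> \<subseteq># \<gamma>'}) \<subseteq> span ?N"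
          by (intro span_mono) auto
        then show ?thesis using less.hyps[OF \<gamma>(2,1)] by blast
      qed
      then have "span (mon ` {\<gamma>. set_mset \<gamma> \<subseteq> I \<and> ?key \<gamma> < ?key \<delta>}) \<subseteq> span ?N"
        by (intro span_minimal subspace_span) auto
      then show ?thesis using reduce[OF less.prems True] by blast
    qed
  qed
  show thesis
  proof (rule that[OF \<alpha>I])
    fix m
    have "mon \<delta> \<in> span (mon ` {\<gamma>. set_mset \<gamma> \<subseteq> I \<and> size \<gamma> \<le> m \<and> \<not> \<alpha> \<subseteq># \<gamma>})"
      if "set_mset \<delta> \<subseteq> I" "size \<delta> \<le> m" for \<delta>
    proof -
      have "span (mon ` {\<gamma>. set_mset \<gamma> \<subseteq> I \<and> size \<gamma> \<le> size \<delta> \<and> \<not> \<alpha> \<subseteq># \<gamma>})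
        \<subseteq> span (mon ` {\<gamma>. set_mset \<gamma> \<subseteq> I \<and> size \<gamma> \<le> m \<and> \<not> \<alpha> \<subseteq># \<gamma>})"
        using that(2) by (intro span_mono) auto
      then show ?thesis using normal[OF that(1)] by blast
    qed
    then show "low (Suc m) \<subseteq> span (mon ` {\<gamma>. set_mset \<gamma> \<subseteq> I \<and> size \<gamma> \<le> m \<and> \<not> \<alpha> \<subseteq># \<gamma>})"
      by (intro order_trans[OF low_subset_span_mon0] span_minimal subspace_span) (auto simp: less_Suc_eq_le)
  qed
qed

text \<open>Independence passes from the \<open>Q j\<close>, of which there are at least as many as
  letters, to the letters: a relation between ordered monomials would leave too few spanning
  elements to hold the independent products of the \<open>Q j\<close>.\<close>

theorem indep_family_mon:
  fixes Q :: "'j \<Rightarrow> 'r" and lst' :: "'j multiset \<Rightarrow> 'j list"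
  assumes J: "finite J" "card I \<le> card J" and lst': "\<And>\<gamma>. mset (lst' \<gamma>) = \<gamma>"
    and Q: "\<And>j. j \<in> J \<Longrightarrow> \<exists>n. Q j \<in> low n"
    and indep: "indep_family (\<lambda>\<gamma>. prod_list (map Q (lst' \<gamma>))) {\<gamma>. set_mset \<gamma> \<subseteq> J}"
  shows "indep_family mon {\<mu>. set_mset \<mu> \<subseteq> I}"
proof (rule ccontr)
  assume "\<not> ?thesis"
  then obtain S c \<gamma>\<^sub>0 where rel: "finite S" "S \<subseteq> {\<mu>. set_mset \<mu> \<subseteq> I}"
    "(\<Sum>\<gamma>\<in>S. c \<gamma> *s mon \<gamma>) = 0" "\<gamma>\<^sub>0 \<in> S" "c \<gamma>\<^sub>0 \<noteq> 0"
    unfolding indep_family_def by blast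
  obtain \<alpha> where \<alpha>: "set_mset \<alpha> \<subseteq> I"
    "\<And>m. low (Suc m) \<subseteq> span (mon ` {\<gamma>. set_mset \<gamma> \<subseteq> I \<and> size \<gamma> \<le> m \<and> \<not> \<alpha> \<subseteq># \<gamma>})"
    using low_subset_span_not_above[OF rel] by blast
  from Q obtain n where n: "\<And>j. j \<in> J \<Longrightarrow> Q j \<in> low (n j)" by metis
  define r where "r = (\<Sum>j\<in>J. n j)"
  have r: "Q j \<in> low (Suc r)" if "j \<in> J" for j
  proof -
    have "n j \<le> Suc r"
      using member_le_sum[of j J n] J(1) that by (simp add: r_def)
    then show ?thesis using n[OF that] low_mono by blast
  qed
  define N where "N = card J"
  \<comment> \<open>Since \<open>Suc (r * (N * t))\<close> is at most
    \<open>Suc (r * N) * Suc t\<close>, the constant \<open>A\<close> gathers all that does not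
    depend on \<open>t\<close>.\<close>
  define A where "A = size \<alpha> * Suc (r * N) ^ (card I - 1)"
  have bound: "Suc t ^ N \<le> A * Suc t ^ (card I - 1)" for t
  proof -
    let ?B = "box_multiset J ` PiE J (\<lambda>_. {..t})"
    let ?f = "\<lambda>\<gamma>. prod_list (map Q (lst' \<gamma>))"
    let ?T = "{\<gamma>. set_mset \<gamma> \<subseteq> I \<and> size \<gamma> \<le> r * (N * t) \<and> \<not> \<alpha> \<subseteq># \<gamma>}"
    note B = card_multiset_box[OF J(1), where t = t]
    have fB: "?f \<gamma> \<in> span (mon ` ?T)" if "\<gamma> \<in> ?B" for \<gamma>
    proof -
      have len: "length (lst' \<gamma>) = size \<gamma>" "set (lst' \<gamma>) = set_mset \<gamma>"
        using lst'[of \<gamma>] by (metis size_mset, metis set_mset_mset)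
      have "?f \<gamma> \<in> low (Suc (r * length (lst' \<gamma>)))"
        using B(3)[OF that] len by (intro prod_list_in_low r) auto
      moreover have "r * length (lst' \<gamma>) \<le> r * (N * t)"
        using B(3)[OF that] len by (simp add: N_def)
      ultimately have "?f \<gamma> \<in> low (Suc (r * (N * t)))" using low_mono by blast
      then show ?thesis using \<alpha>(2) by blast
    qed
    have "?B \<subseteq> {\<gamma>. set_mset \<gamma> \<subseteq> J}" using B(3) by blast
    then have "indep_family ?f ?B" by (rule indep_family_subset[OF indep])
    then have "card ?B \<le> card (mon ` ?T)"
      using fB card_multisets_not_above(1)[OF finite_I \<alpha>(1)] B(1)
      by (intro indep_family_card_le) auto
    also have "\<dots> \<le> card ?T"
      by (intro card_image_le card_multisets_not_above(1) finite_I \<alpha>(1))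
    also have "\<dots> \<le> size \<alpha> * Suc (r * (N * t)) ^ (card I - 1)"
      by (rule card_multisets_not_above(2)[OF finite_I \<alpha>(1)])
    also have "\<dots> \<le> size \<alpha> * (Suc (r * N) * Suc t) ^ (card I - 1)"
      by (intro mult_left_mono power_mono) (auto simp: algebra_simps)
    also have "\<dots> = A * Suc t ^ (card I - 1)"
      by (simp only: A_def power_mult_distrib mult.assoc)
    finally show ?thesis using B(2) by (simp add: N_def)
  qed
  show False
  \<comment> \<open>Truncated subtraction makes \<open>card I - 1\<close> zero for empty
    \<open>I\<close>; then \<alpha> is empty and \<open>A = 0\<close>, which \<open>t = 0\<close>
    refutes. Otherwise \<open>t = A\<close> is large enough, as \<open>Suc A\<close> exceeds
    \<open>A\<close>.\<close>
  proof (cases "card I = 0")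
    case True
    then have "\<alpha> = {#}" using \<alpha>(1) finite_I by auto
    then have "A = 0" by (simp add: A_def)
    then show False using bound[of 0] by simp
  next
    case False
    have "Suc A * Suc A ^ (card I - 1) = Suc A ^ card I"
      using False by (metis power_eq_if)
    also have "\<dots> \<le> Suc A ^ N" using J(2) by (intro power_increasing) (auto simp: N_def)
    also have "\<dots> \<le> A * Suc A ^ (card I - 1)" by (rule bound)
    finally show False by simp
  qed
qed

end

section \<open>Polynomials, derivatives and substitutions\<close>

abbreviation "lookup \<equiv> Poly_Mapping.lookup"
abbreviation "keys \<equiv> Poly_Mapping.keys"
abbreviation "single \<equiv> Poly_Mapping.single"

lemma poly_mapping_sum_single:
  fixes p :: "'k \<Rightarrow>\<^sub>0 'a::comm_monoid_add"
  shows "p = (\<Sum>k\<in>keys p. single k (lookup p k))"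
proof (rule poly_mapping_eqI)
  fix k
  have "(\<Sum>x\<in>keys p. lookup (single x (lookup p x)) k) = (\<Sum>x\<in>keys p. if x = k then lookup p k else 0)"
    by (intro sum.cong) (auto simp: lookup_single)
  then show "lookup p k = lookup (\<Sum>k\<in>keys p. single k (lookup p k)) k"
    by (simp add: lookup_sum in_keys_iff)
qed

lemma poly_mapping_single_induct [case_names single add]:
  fixes p :: "'k \<Rightarrow>\<^sub>0 'a::comm_monoid_add"
  assumes "\<And>k c. P (single k c)" and "\<And>p q. P p \<Longrightarrow> P q \<Longrightarrow> P (p + q)"
  shows "P p"
proof -
  have "P (\<Sum>k\<in>A. single k (lookup p k))" if "finite A" for A
    using that
  proof (induction A rule: finite_induct)
    case empty
    show ?case using assms(1)[of undefined 0] by simp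
  qed (use assms in simp)
  then show ?thesis by (subst poly_mapping_sum_single) simp
qed

lemma const_poly_simps [simp]:
  "const_poly 0 = 0" "const_poly 1 = 1"
  by (simp_all add: const_poly_def)

lemma const_poly_add: "const_poly (c + d) = const_poly c + const_poly d"
  and const_poly_mult: "const_poly (c * d) = const_poly c * const_poly d"
  by (simp_all add: const_poly_def single_add mult_single)

lemma const_poly_sum: "const_poly (sum f A) = (\<Sum>x\<in>A. const_poly (f x))"
  by (induction A rule: infinite_finite_induct) (auto simp: const_poly_add)

lemma const_poly_mult_single: "const_poly c * single m d = single m (c * d)"
  by (simp add: const_poly_def mult_single)

lemma dX_single: "dX v (single m c) = single (m - single v 1) (of_nat (lookup m v) * c)"
  by (cases "c = 0") (simp_all add: dX_def)

lemma dX_add: "dX v (p + q) = dX v p + dX v q"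
  unfolding dX_def
  by (rule setsum_keys_plus_distrib) (simp_all add: single_add distrib_left)

lemma dX_mult: "dX v (p * q) = dX v p * q + p * dX v q"
proof (induction p rule: poly_mapping_single_induct)
  case (single m c)
  show ?case
  proof (induction q rule: poly_mapping_single_induct)
    case (single n d)
    \<comment> \<open>Exponents are subtracted with truncation at zero, so these identities hold
      only if \<open>v\<close> occurs; if it does not, the coefficient \<open>of_nat 0\<close>
      removes the term.\<close>
    have 1: "m - single v 1 + n = m + n - single v 1" if "lookup m v \<noteq> 0"
      using that by (intro poly_mapping_eqI) (auto simp: lookup_add lookup_minus lookup_single when_def)
    have 2: "m + (n - single v 1) = m + n - single v 1" if "lookup n v \<noteq> 0"
      using that by (intro poly_mapping_eqI) (auto simp: lookup_add lookup_minus lookup_single when_def)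
    have "dX v (single m c * single n d)
        = single (m + n - single v 1) (of_nat (lookup m v) * c * d)
          + single (m + n - single v 1) (c * (of_nat (lookup n v) * d))"
      by (simp add: mult_single dX_single lookup_add algebra_simps flip: single_add)
    also have "single (m + n - single v 1) (of_nat (lookup m v) * c * d) = dX v (single m c) * single n d"
      using 1 by (cases "lookup m v = 0") (simp_all add: mult_single dX_single)
    also have "single (m + n - single v 1) (c * (of_nat (lookup n v) * d)) = single m c * dX v (single n d)"
      using 2 by (cases "lookup n v = 0") (simp_all add: mult_single dX_single)
    finally show ?case .
  next
    case (add p q)
    then show ?case by (simp add: distrib_left dX_add algebra_simps)
  qed
next
  case (add p q)
  then show ?case by (simp add: distrib_right dX_add algebra_simps)
qed

lemma dX_const [simp]: "dX v (const_poly c) = 0"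
  by (simp add: const_poly_def dX_single)

lemma dX_const_mult: "dX v (const_poly c * p) = const_poly c * dX v p"
  by (simp add: dX_mult)

lemma dX_Xvar: "dX v (Xvar w) = (if v = w then 1 else 0)"
  by (auto simp: Xvar_def dX_single lookup_single)

lemma dX_commute: "dX v (dX w p) = dX w (dX v p)"
proof (induction p rule: poly_mapping_single_induct)
  case (single m c)
  have "m - single w 1 - single v 1 = m - single v 1 - (single w 1 :: _ \<Rightarrow>\<^sub>0 nat)"
    by (intro poly_mapping_eqI) (auto simp: lookup_minus)
  then show ?case
    by (auto simp: dX_single lookup_minus lookup_single when_def algebra_simps)
next
  case (add p q)
  then show ?case by (simp add: dX_add)
qed

lemma dX_zero [simp]: "dX v 0 = 0"
  by (simp add: dX_def)

lemma dX_sum: "dX v (sum f A) = (\<Sum>x\<in>A. dX v (f x))"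
  by (induction A rule: infinite_finite_induct) (auto simp: dX_add)

lemma subst_single: "subst \<sigma> (single m c) = const_poly c * (\<Prod>v\<in>keys m. \<sigma> v ^ lookup m v)"
  by (cases "c = 0") (simp_all add: subst_def)

lemma subst_add: "subst \<sigma> (p + q) = subst \<sigma> p + subst \<sigma> q"
  unfolding subst_def
  by (rule setsum_keys_plus_distrib) (simp_all add: const_poly_add distrib_right)

lemma prod_keys_superset:
  fixes \<sigma> :: "'v \<Rightarrow> 'b::comm_monoid_mult"
  assumes "finite A" "keys m \<subseteq> A"
  shows "(\<Prod>v\<in>keys m. \<sigma> v ^ lookup m v) = (\<Prod>v\<in>A. \<sigma> v ^ lookup m v)"
  using assms by (intro prod.mono_neutral_left) (auto simp: in_keys_iff)

lemma prod_keys_add: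
  fixes \<sigma> :: "'v \<Rightarrow> 'b::comm_monoid_mult"
  shows "(\<Prod>v\<in>keys (m + n). \<sigma> v ^ lookup (m + n) v)
    = (\<Prod>v\<in>keys m. \<sigma> v ^ lookup m v) * (\<Prod>v\<in>keys n. \<sigma> v ^ lookup n v)"
proof -
  let ?A = "keys m \<union> keys n"
  have "(\<Prod>v\<in>keys (m + n). \<sigma> v ^ lookup (m + n) v) = (\<Prod>v\<in>?A. \<sigma> v ^ lookup (m + n) v)"
    using keys_add[of m n] by (intro prod_keys_superset) auto
  also have "\<dots> = (\<Prod>v\<in>?A. \<sigma> v ^ lookup m v) * (\<Prod>v\<in>?A. \<sigma> v ^ lookup n v)"
    by (simp add: lookup_add power_add prod.distrib)
  also have "(\<Prod>v\<in>?A. \<sigma> v ^ lookup m v) = (\<Prod>v\<in>keys m. \<sigma> v ^ lookup m v)"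
    by (rule prod_keys_superset[symmetric]) auto
  also have "(\<Prod>v\<in>?A. \<sigma> v ^ lookup n v) = (\<Prod>v\<in>keys n. \<sigma> v ^ lookup n v)"
    by (rule prod_keys_superset[symmetric]) auto
  finally show ?thesis .
qed

lemma subst_mult: "subst \<sigma> (p * q) = subst \<sigma> p * subst \<sigma> q"
proof (induction p rule: poly_mapping_single_induct)
  case (single m c)
  show ?case
  proof (induction q rule: poly_mapping_single_induct)
    case (single n d)
    show ?case by (simp add: mult_single subst_single prod_keys_add const_poly_mult algebra_simps)
  next
    case (add p q)
    then show ?case by (simp add: distrib_left subst_add)
  qed
next
  case (add p q)
  then show ?case by (simp add: distrib_right subst_add)
qed

lemma subst_const [simp]: "subst \<sigma> (const_poly c) = const_poly c"
  by (simp add: const_poly_def[of c] subst_single)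

lemma subst_Xvar [simp]: "subst \<sigma> (Xvar v) = \<sigma> v"
  by (simp add: Xvar_def subst_single)

lemma subst_zero [simp]: "subst \<sigma> 0 = 0"
  by (simp add: subst_def)

lemma subst_one [simp]: "subst \<sigma> 1 = 1"
  using subst_const[of \<sigma> 1] by simp

lemma mpoly_induct [case_names const var add mult]:
  fixes p :: "('v, 'a::comm_ring_1) mpoly"
  assumes const: "\<And>c. P (const_poly c)" and var: "\<And>v. P (Xvar v)"
    and add: "\<And>p q. P p \<Longrightarrow> P q \<Longrightarrow> P (p + q)" and mult: "\<And>p q. P p \<Longrightarrow> P q \<Longrightarrow> P (p * q)"
  shows "P p"
proof -
  have one: "P (single m 1)" for m :: "'v \<Rightarrow>\<^sub>0 nat"
  proof (induction m rule: poly_mapping_single_induct)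
    case (single v k)
    show ?case
    proof (induction k)
      case 0
      then show ?case using const[of 1] by simp
    next
      case (Suc k)
      have "single (single v (Suc k)) (1::'a) = Xvar v * single (single v k) 1"
        by (simp add: Xvar_def mult_single flip: single_add)
      then show ?case using mult[OF var[of v] Suc] by simp
    qed
  next
    case (add m n)
    then show ?case using mult[OF add] by (simp add: mult_single)
  qed
  show ?thesis
  proof (induction p rule: poly_mapping_single_induct)
    case (single m c)
    then show ?case using mult[OF const[of c] one[of m]] by (simp add: const_poly_mult_single)
  qed (rule add)
qed

text \<open>The chain rule. Both sides obey the same Leibniz rule relative to
  \<open>subst \<sigma>\<close>, so it suffices to compare them on constants and variables.\<close>

lemma dX_subst_linear:
  fixes \<sigma> :: "'v \<Rightarrow> ('v, 'a::comm_ring_1) mpoly"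
  assumes "finite Vs" and S: "\<And>w. w \<in> Vs \<Longrightarrow> dX v (\<sigma> w) = const_poly (S w)"
    and "\<And>w. w \<notin> Vs \<Longrightarrow> dX v (\<sigma> w) = 0"
  shows "dX v (subst \<sigma> p) = (\<Sum>w\<in>Vs. const_poly (S w) * subst \<sigma> (dX w p))"
proof (induction p rule: mpoly_induct)
  case (const c)
  show ?case by simp
next
  case (var u)
  have "(\<Sum>w\<in>Vs. const_poly (S w) * subst \<sigma> (dX w (Xvar u)))
      = (\<Sum>w\<in>Vs. if w = u then const_poly (S w) else 0)"
    by (intro sum.cong) (auto simp: dX_Xvar)
  then show ?case using assms by simp
next
  case (add p q)
  then show ?case by (simp add: subst_add dX_add sum.distrib distrib_left)
next
  case (mult p q)
  then show ?case
    by (simp add: subst_mult subst_add dX_mult sum.distrib distrib_left sum_distrib_left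
        sum_distrib_right mult_ac)
qed

section \<open>The ring of linear operators\<close>

definition linear_op :: "('v, 'a::comm_ring_1) dop \<Rightarrow> bool" where
  "linear_op D \<longleftrightarrow> (\<forall>p q. D (p + q) = D p + D q) \<and> (\<forall>c p. D (const_poly c * p) = const_poly c * D p)"

text \<open>Arbitrary maps do not form a ring under composition, because composing with a map on the
  left distributes over sums only if that map is additive. Linear operators do, which makes ring and
  vector space reasoning available.\<close>

typedef (overloaded) ('v, 'a) lop = "{D :: ('v, 'a::comm_ring_1) dop. linear_op D}"
  morphisms app Lop
  by (intro exI[of _ "\<lambda>_. 0"]) (simp add: linear_op_def)

lemma linear_op_app: "linear_op (app D)"
  using app[of D] by simp

lemma app_add: "app D (p + q) = app D p + app D q"
  and app_const_mult: "app D (const_poly c * p) = const_poly c * app D p"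
  using linear_op_app[of D] by (auto simp: linear_op_def)

lemma app_Lop: "linear_op D \<Longrightarrow> app (Lop D) = D"
  by (simp add: Lop_inverse)

lemma lop_eqI: "(\<And>p. app D p = app E p) \<Longrightarrow> D = E"
  by (metis app_inject ext)

lemma linear_op_intros:
  "linear_op (\<lambda>_. 0)" "linear_op (\<lambda>p. p)"
  "linear_op D \<Longrightarrow> linear_op E \<Longrightarrow> linear_op (\<lambda>p. D p + E p)"
  "linear_op D \<Longrightarrow> linear_op E \<Longrightarrow> linear_op (\<lambda>p. D p - E p)"
  "linear_op D \<Longrightarrow> linear_op (\<lambda>p. - D p)"
  "linear_op D \<Longrightarrow> linear_op E \<Longrightarrow> linear_op (\<lambda>p. D (E p))"
  "linear_op D \<Longrightarrow> linear_op (\<lambda>p. q * D p)"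
  "linear_op (dX v)" "linear_op (subst \<sigma>)"
  by (simp_all add: linear_op_def distrib_left right_diff_distrib mult.left_commute dX_add
      dX_const_mult subst_add subst_mult)

instantiation lop :: (type, comm_ring_1) ring_1
begin

definition "0 = Lop (\<lambda>_. 0)"
definition "1 = Lop (\<lambda>p. p)"
definition "D + E = Lop (\<lambda>p. app D p + app E p)"
definition "- D = Lop (\<lambda>p. - app D p)"
definition "D - E = Lop (\<lambda>p. app D p - app E p)"
definition "D * E = Lop (\<lambda>p. app D (app E p))"

lemma app_simps [simp]:
  "app (0 :: ('a, 'b) lop) p = 0" "app (1 :: ('a, 'b) lop) p = p"
  "app (D + E) p = app D p + app E p" "app (- D) p = - app D p"
  "app (D - E) p = app D p - app E p" "app (D * E) p = app D (app E p)"
  for D E :: "('a, 'b) lop"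
  by (simp_all add: zero_lop_def one_lop_def plus_lop_def uminus_lop_def minus_lop_def times_lop_def
      app_Lop linear_op_intros linear_op_app)

instance
proof
  have "app (0 :: ('a, 'b) lop) 1 \<noteq> app 1 1" by simp
  then show "(0 :: ('a, 'b) lop) \<noteq> 1" by metis
qed (auto intro!: lop_eqI simp: app_add)

end

lemma app_sum: "app (sum f A) p = (\<Sum>x\<in>A. app (f x) p)"
  by (induction A rule: infinite_finite_induct) auto

definition lscale :: "'a::comm_ring_1 \<Rightarrow> ('v, 'a) lop \<Rightarrow> ('v, 'a) lop" where
  "lscale c D = Lop (\<lambda>p. const_poly c * app D p)"

lemma app_lscale [simp]: "app (lscale c D) p = const_poly c * app D p"
  by (simp add: lscale_def app_Lop linear_op_intros linear_op_app)

interpretation lop: falgebra lscale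
  by unfold_locales
    (auto intro!: lop_eqI simp: const_poly_add const_poly_mult app_const_mult algebra_simps)

definition wgen :: "'v + 'v \<Rightarrow> ('v, 'a::comm_ring_1) lop" where
  "wgen x = (case x of Inl v \<Rightarrow> Lop (\<lambda>p. Xvar v * p) | Inr v \<Rightarrow> Lop (dX v))"

lemma app_wgen [simp]: "app (wgen (Inl v)) p = Xvar v * p" "app (wgen (Inr v)) p = dX v p"
  by (simp_all add: wgen_def app_Lop linear_op_intros)

lemma wgen_commutators:
  "wgen (Inl v) * wgen (Inl w) - wgen (Inl w) * wgen (Inl v) = 0"
  "wgen (Inr v) * wgen (Inr w) - wgen (Inr w) * wgen (Inr v) = 0"
  "wgen (Inr v) * wgen (Inl w) - wgen (Inl w) * wgen (Inr v) = (if v = w then 1 else 0)"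
  "wgen (Inl w) * wgen (Inr v) - wgen (Inr v) * wgen (Inl w) = (if v = w then - 1 else 0)"
  by (auto intro!: lop_eqI simp: dX_commute[of v w] dX_mult dX_Xvar algebra_simps)

section \<open>Normally ordered monomials in the Weyl algebra\<close>

definition xpart :: "('v + 'v) multiset \<Rightarrow> 'v list" where
  "xpart \<mu> = (SOME w. mset w = image_mset projl (filter_mset isl \<mu>))"

definition dpart :: "('v + 'v) multiset \<Rightarrow> 'v list" where
  "dpart \<mu> = (SOME w. mset w = image_mset projr (filter_mset (\<lambda>x. \<not> isl x) \<mu>))"

definition normal_order :: "('v + 'v) multiset \<Rightarrow> ('v + 'v) list" where
  "normal_order \<mu> = map Inl (xpart \<mu>) @ map Inr (dpart \<mu>)"

lemma mset_xpart: "mset (xpart \<mu>) = image_mset projl (filter_mset isl \<mu>)"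
  unfolding xpart_def by (rule someI_ex) (rule ex_mset)

lemma mset_dpart: "mset (dpart \<mu>) = image_mset projr (filter_mset (\<lambda>x. \<not> isl x) \<mu>)"
  unfolding dpart_def by (rule someI_ex) (rule ex_mset)

lemma mset_normal_order: "mset (normal_order \<mu>) = \<mu>"
proof -
  have "image_mset (Inl \<circ> projl) (filter_mset isl \<mu>) = image_mset id (filter_mset isl \<mu>)"
    by (rule image_mset_cong) auto
  moreover have "image_mset (Inr \<circ> projr) (filter_mset (\<lambda>x. \<not> isl x) \<mu>)
      = image_mset id (filter_mset (\<lambda>x. \<not> isl x) \<mu>)"
    by (rule image_mset_cong) auto
  ultimately show ?thesis
    by (simp add: normal_order_def mset_xpart mset_dpart multiset.map_comp
        flip: multiset_partition)
qed

definition lexp :: "'v list \<Rightarrow> 'v \<Rightarrow>\<^sub>0 nat" where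
  "lexp vs = sum_list (map (\<lambda>v. single v 1) vs)"

lemma lexp_simps [simp]: "lexp [] = 0" "lexp (v # vs) = single v 1 + lexp vs"
  by (simp_all add: lexp_def)

lemma lookup_lexp: "lookup (lexp vs) v = count (mset vs) v"
  by (induction vs) (auto simp: lookup_add lookup_single when_def)

lemma lexp_eq_iff: "lexp us = lexp vs \<longleftrightarrow> mset us = mset vs"
  by (auto simp: poly_mapping_eq_iff multiset_eq_iff lookup_lexp fun_eq_iff)

lemma app_prod_Xvar: "app (prod_list (map wgen (map Inl us))) p = single (lexp us) 1 * p"
  by (induction us) (auto simp: Xvar_def mult_single simp flip: mult.assoc)

text \<open>The coefficient \<open>a\<close> is a product of falling factorials. In characteristic
  zero it vanishes exactly when some variable is differentiated more often than its exponent in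
  \<open>m\<close>.\<close>

lemma app_prod_dX:
  fixes m :: "'v \<Rightarrow>\<^sub>0 nat"
  shows "\<exists>a::'a::field_char_0. app (prod_list (map wgen (map Inr vs))) (single m 1) = single (m - lexp vs) a
      \<and> (a \<noteq> 0 \<longleftrightarrow> (\<forall>v. count (mset vs) v \<le> lookup m v))"
proof (induction vs)
  case Nil
  then show ?case by auto
next
  case (Cons u vs)
  then obtain a :: 'a where a: "app (prod_list (map wgen (map Inr vs))) (single m 1) = single (m - lexp vs) a"
    "a \<noteq> 0 \<longleftrightarrow> (\<forall>v. count (mset vs) v \<le> lookup m v)" by blast
  have minus: "m - lexp vs - single u 1 = m - lexp (u # vs)"
    by (intro poly_mapping_eqI) (simp add: lookup_minus lookup_add)
  have "app (prod_list (map wgen (map Inr (u # vs)))) (single m 1)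
      = single (m - lexp (u # vs)) (of_nat (lookup m u - count (mset vs) u) * a)"
    using a(1) minus by (simp add: dX_single lookup_minus lookup_lexp)
  moreover have "of_nat (lookup m u - count (mset vs) u) * a \<noteq> 0
      \<longleftrightarrow> (\<forall>v. count (mset (u # vs)) v \<le> lookup m v)"
  proof -
    have "of_nat (lookup m u - count (mset vs) u) * a \<noteq> 0
        \<longleftrightarrow> count (mset vs) u < lookup m u \<and> (\<forall>v. count (mset vs) v \<le> lookup m v)"
      unfolding mult_eq_0_iff de_Morgan_disj a(2) of_nat_eq_0_iff by auto
    moreover have "count (mset (u # vs)) v = (if v = u then Suc (count (mset vs) u) else count (mset vs) v)" for v
      by simp
    ultimately show ?thesis by (metis Suc_leI Suc_le_eq less_imp_le)
  qed
  ultimately show ?case by blast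
qed

text \<open>A relation is tested on the monomial whose exponents are those of the derivative part of
  a term with fewest derivatives. Every occurring term with another derivative part annihilates it,
  and terms with the same derivative part give different monomials.\<close>

lemma indep_family_normal_order:
  "lop.indep_family (\<lambda>\<mu>. prod_list (map wgen (normal_order \<mu>)) :: ('v, 'a::field_char_0) lop) UNIV"
  unfolding lop.indep_family_def
proof (intro allI impI, rule ccontr)
  fix B and b :: "('v + 'v) multiset \<Rightarrow> 'a"
  let ?M = "\<lambda>\<mu>. prod_list (map wgen (normal_order \<mu>)) :: ('v, 'a) lop"
  assume B: "finite B" "(\<Sum>s\<in>B. lscale (b s) (?M s)) = 0" and "\<not> (\<forall>s\<in>B. b s = 0)"
  then obtain \<mu>1 where "\<mu>1 \<in> B \<and> b \<mu>1 \<noteq> 0" by blast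
  from ex_has_least_nat[of "\<lambda>\<mu>. \<mu> \<in> B \<and> b \<mu> \<noteq> 0", OF this, of "\<lambda>\<mu>. length (dpart \<mu>)"]
  obtain \<mu>0 where \<mu>0: "\<mu>0 \<in> B" "b \<mu>0 \<noteq> 0"
    and least: "\<And>\<mu>. \<mu> \<in> B \<Longrightarrow> b \<mu> \<noteq> 0 \<Longrightarrow> length (dpart \<mu>0) \<le> length (dpart \<mu>)" by blast
  define m where "m = lexp (dpart \<mu>0)"
  have "\<forall>\<mu>. \<exists>a::'a. app (prod_list (map wgen (map Inr (dpart \<mu>)))) (single m 1) = single (m - lexp (dpart \<mu>)) a
      \<and> (a \<noteq> 0 \<longleftrightarrow> (\<forall>v. count (mset (dpart \<mu>)) v \<le> lookup m v))"
    by (intro allI app_prod_dX)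
  then obtain a :: "_ \<Rightarrow> 'a" where a:
    "\<And>\<mu>. app (prod_list (map wgen (map Inr (dpart \<mu>)))) (single m 1) = single (m - lexp (dpart \<mu>)) (a \<mu>)"
    "\<And>\<mu>. a \<mu> \<noteq> 0 \<longleftrightarrow> (\<forall>v. count (mset (dpart \<mu>)) v \<le> lookup m v)" by metis
  have act: "app (?M \<mu>) (single m 1) = single (lexp (xpart \<mu>) + (m - lexp (dpart \<mu>))) (a \<mu>)" for \<mu>
    unfolding normal_order_def using app_prod_Xvar[of "xpart \<mu>", where 'b = 'a]
    by (simp add: a(1)[simplified] mult_single)
  have "0 = lookup (app (\<Sum>s\<in>B. lscale (b s) (?M s)) (single m 1)) (lexp (xpart \<mu>0))"
    using B(2) by simp
  also have "\<dots> = (\<Sum>\<mu>\<in>B. lookup (single (lexp (xpart \<mu>) + (m - lexp (dpart \<mu>))) (b \<mu> * a \<mu>)) (lexp (xpart \<mu>0)))"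
    by (simp add: app_sum lookup_sum act const_poly_mult_single)
  also have "\<dots> = (\<Sum>\<mu>\<in>B. if \<mu> = \<mu>0 then b \<mu>0 * a \<mu>0 else 0)"
  proof (rule sum.cong)
    fix \<mu> assume \<mu>: "\<mu> \<in> B"
    show "lookup (single (lexp (xpart \<mu>) + (m - lexp (dpart \<mu>))) (b \<mu> * a \<mu>)) (lexp (xpart \<mu>0))
        = (if \<mu> = \<mu>0 then b \<mu>0 * a \<mu>0 else 0)"
    proof (cases "b \<mu> * a \<mu> = 0 \<or> \<mu> = \<mu>0")
      case True
      then show ?thesis by (auto simp: m_def)
    next
      case False
      then have "mset (dpart \<mu>) \<subseteq># mset (dpart \<mu>0)"
        using a(2)[of \<mu>] by (simp add: m_def lookup_lexp subseteq_mset_def)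
      moreover have "size (mset (dpart \<mu>0)) \<le> size (mset (dpart \<mu>))"
        using least[OF \<mu>] False by auto
      ultimately have d: "mset (dpart \<mu>) = mset (dpart \<mu>0)"
        by (metis leD mset_subset_size subset_mset.le_less)
      have "lexp (xpart \<mu>) \<noteq> lexp (xpart \<mu>0)"
      proof
        assume "lexp (xpart \<mu>) = lexp (xpart \<mu>0)"
        then have "mset (normal_order \<mu>) = mset (normal_order \<mu>0)"
          using d by (simp add: lexp_eq_iff normal_order_def)
        then show False using False by (simp add: mset_normal_order)
      qed
      moreover have "m - lexp (dpart \<mu>) = 0"
        using d by (simp add: m_def lexp_eq_iff[THEN iffD2, OF d])
      ultimately show ?thesis using False by (simp add: lookup_single)
    qed
  qed simp
  also have "\<dots> = b \<mu>0 * a \<mu>0" using B(1) \<mu>0(1) by simp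
  finally have "a \<mu>0 = 0" using \<mu>0(2) by simp
  then show False using a(2)[of \<mu>0] by (simp add: m_def lookup_lexp)
qed

text \<open>The only nonzero commutators of generators are scalars, of weight zero, coming from a
  variable and its own derivative. They are lower as soon as this pair has positive total weight;
  one of the two weights may be zero, as happens in case A.\<close>

lemma filtration_wgen:
  fixes wt :: "'v + 'v \<Rightarrow> nat"
  assumes "\<And>v. 0 < wt (Inl v) + wt (Inr v)"
  shows "filtration (lscale :: 'a::field \<Rightarrow> _) UNIV wgen wt normal_order"
proof -
  interpret word_filtration "lscale :: 'a \<Rightarrow> _" "{}" UNIV wgen wt normal_order
    by unfold_locales (auto simp: mset_normal_order)
  have one: "1 \<in> low n" if "0 < n" for n
    using word_in_low[of "[]" n] that by simp
  have one': "1 \<in> low (wt (Inl v) + wt (Inr v))" "1 \<in> low (wt (Inr v) + wt (Inl v))" for v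
    using one assms[of v] by (simp_all only: add.commute)
  have "wgen i * wgen j - wgen j * wgen i \<in> low (wt i + wt j)" for i j
    by (cases i; cases j) (auto simp: wgen_commutators low_zero intro!: low_neg one')
  then show ?thesis
    by unfold_locales auto
qed

section \<open>The free associative algebra\<close>

text \<open>With concatenation as addition of exponents, finitely supported functions on words
  become a convolution ring: the free algebra as the monoid algebra of the free monoid.\<close>

instantiation list :: (type) monoid_add
begin

definition "0 = []"
definition "u + v = u @ v"

instance
  by standard (simp_all add: zero_list_def plus_list_def)

end

lemma fa_mult_eq_times: "fa_mult f g = f * g"
proof -
  have "f * g = (\<Sum>u\<in>keys f. single u (lookup f u)) * (\<Sum>w\<in>keys g. single w (lookup g w))"
    by (simp flip: poly_mapping_sum_single)
  then show ?thesis
    by (simp add: fa_mult_def sum_product mult_single plus_list_def)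
qed

definition fscale :: "'a::comm_ring_1 \<Rightarrow> ('g list \<Rightarrow>\<^sub>0 'a) \<Rightarrow> ('g list \<Rightarrow>\<^sub>0 'a)" where
  "fscale c f = single [] c * f"

lemma single_Nil_commute: "f * single [] c = single [] c * f" for f :: "'g list \<Rightarrow>\<^sub>0 'a::comm_ring_1"
proof (induction f rule: poly_mapping_single_induct)
  case (single w d)
  show ?case by (simp add: mult_single plus_list_def mult.commute)
qed (simp add: algebra_simps)

interpretation fa: falgebra fscale
proof
  fix c :: 'a and x y :: "'g list \<Rightarrow>\<^sub>0 'a"
  show "x * fscale c y = fscale c (x * y)"
    by (metis fscale_def mult.assoc single_Nil_commute)
  show "fscale 1 x = x"
    by (metis fscale_def mult_1 single_one zero_list_def)
qed (simp_all add: fscale_def single_add mult_single plus_list_def algebra_simps flip: mult.assoc)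

lemma fscale_single: "fscale c (single w d) = single w (c * d)"
  by (simp add: fscale_def mult_single plus_list_def)

lemma fa_on_add: "f \<in> fa_on L \<Longrightarrow> g \<in> fa_on L \<Longrightarrow> f + g \<in> fa_on L"
  using keys_add[of f g] by (auto simp: fa_on_def)

lemma fa_on_mult: "f \<in> fa_on L \<Longrightarrow> g \<in> fa_on L \<Longrightarrow> f * g \<in> fa_on L"
  using keys_mult[of f g] by (force simp: fa_on_def plus_list_def)

lemma fa_on_single: "set w \<subseteq> L \<Longrightarrow> single w c \<in> fa_on L"
  by (auto simp: fa_on_def)

definition fhom :: "('g \<Rightarrow> ('v, 'a) lop) \<Rightarrow> ('g list \<Rightarrow>\<^sub>0 'a::comm_ring_1) \<Rightarrow> ('v, 'a) lop" where
  "fhom D f = (\<Sum>w\<in>keys f. lscale (lookup f w) (prod_list (map D w)))"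

lemma lscale_zero_left: "lscale 0 x = 0" and lscale_add_left: "lscale (c + d) x = lscale c x + lscale d x"
  and lscale_one: "lscale 1 x = x"
  by (auto intro!: lop_eqI simp: const_poly_add algebra_simps)

lemma fhom_single: "fhom D (single w c) = lscale c (prod_list (map D w))"
  by (cases "c = 0") (simp_all add: fhom_def lscale_zero_left)

lemma fhom_add: "fhom D (f + g) = fhom D f + fhom D g"
  unfolding fhom_def
  by (rule setsum_keys_plus_distrib) (simp_all add: lscale_zero_left lscale_add_left)

lemma fhom_0 [simp]: "fhom D 0 = 0"
  by (simp add: fhom_def)

lemma fhom_diff: "fhom D (f - g) = fhom D f - fhom D g"
  using fhom_add[of D "f - g" g] by simp

lemma fhom_sum: "fhom D (sum f A) = (\<Sum>x\<in>A. fhom D (f x))"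
  by (induction A rule: infinite_finite_induct) (auto simp: fhom_add)

lemma fhom_mult: "fhom D (f * g) = fhom D f * fhom D g"
proof (induction f rule: poly_mapping_single_induct)
  case (single u c)
  show ?case
  proof (induction g rule: poly_mapping_single_induct)
    case (single w d)
    show ?case
      by (intro lop_eqI)
        (simp add: mult_single plus_list_def fhom_single const_poly_mult app_const_mult mult.assoc)
  next
    case (add p q)
    then show ?case by (simp add: distrib_left fhom_add)
  qed
next
  case (add p q)
  then show ?case by (simp add: distrib_right fhom_add)
qed

lemma fhom_fscale: "fhom D (fscale c f) = lscale c (fhom D f)"
  unfolding fscale_def fhom_mult by (intro lop_eqI) (simp add: fhom_single)

lemma app_fhom:
  assumes lin: "\<And>x. x \<in> L \<Longrightarrow> linear_op (\<iota> x)" and f: "f \<in> fa_on L"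
  shows "app (fhom (\<lambda>x. Lop (\<iota> x)) f) = fa_hom \<iota> f"
proof
  fix p
  have word: "app (prod_list (map (\<lambda>x. Lop (\<iota> x)) w)) p = word_op \<iota> w p" if "set w \<subseteq> L" for w
    using that by (induction w) (auto simp: word_op_def app_Lop lin)
  have "app (fhom (\<lambda>x. Lop (\<iota> x)) f) p
      = (\<Sum>w\<in>keys f. const_poly (lookup f w) * app (prod_list (map (\<lambda>x. Lop (\<iota> x)) w)) p)"
    by (simp add: fhom_def app_sum)
  also have "\<dots> = fa_hom \<iota> f p"
    unfolding fa_hom_def using f by (intro sum.cong) (auto simp: fa_on_def word)
  finally show "app (fhom (\<lambda>x. Lop (\<iota> x)) f) p = fa_hom \<iota> f p" .
qed

lemma fa_hom_image:
  fixes \<iota> :: "'g \<Rightarrow> ('v, 'a::comm_ring_1) dop"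
  assumes lin: "\<And>x. x \<in> L \<Longrightarrow> linear_op (\<iota> x)"
  shows "fa_hom \<iota> ` fa_on L = alg_gen (\<iota> ` L)"
proof
  let ?D = "\<lambda>x. Lop (\<iota> x)"
  note app = app_fhom[OF lin]
  have word: "word_op \<iota> w \<in> alg_gen (\<iota> ` L)" if "set w \<subseteq> L" for w
    using that
  proof (induction w)
    case Nil
    have "word_op \<iota> [] = (\<lambda>p. const_poly 1 * p)" by (auto simp: word_op_def)
    then show ?case by (simp only: alg_gen.scal)
  next
    case (Cons x w)
    then have "\<iota> x \<circ> word_op \<iota> w \<in> alg_gen (\<iota> ` L)"
      by (intro alg_gen.comp[OF alg_gen.gen]) auto
    moreover have "word_op \<iota> (x # w) = \<iota> x \<circ> word_op \<iota> w" by (simp add: word_op_def fun_eq_iff)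
    ultimately show ?case by (simp only:)
  qed
  have "(\<lambda>p. 0) = (\<lambda>p. const_poly 0 * p :: ('v, 'a) mpoly)" by simp
  then have zero: "(\<lambda>p. 0) \<in> alg_gen (\<iota> ` L)" by (simp only: alg_gen.scal)
  have sum: "(\<lambda>p. \<Sum>x\<in>A. F x p) \<in> alg_gen (\<iota> ` L)"
    if "finite A" "\<And>x. x \<in> A \<Longrightarrow> F x \<in> alg_gen (\<iota> ` L)" for A and F :: "'g list \<Rightarrow> ('v, 'a) dop"
    using that by (induction A rule: finite_induct) (auto simp: zero intro: alg_gen.add)
  show "fa_hom \<iota> ` fa_on L \<subseteq> alg_gen (\<iota> ` L)"
  proof
    fix D assume "D \<in> fa_hom \<iota> ` fa_on L"
    then obtain f where f: "f \<in> fa_on L" "D = fa_hom \<iota> f" by blast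
    have "(\<lambda>p. const_poly (lookup f w) * word_op \<iota> w p) \<in> alg_gen (\<iota> ` L)" if "w \<in> keys f" for w
      using alg_gen.comp[OF alg_gen.scal word[of w]] f(1) that by (auto simp: fa_on_def comp_def)
    then show "D \<in> alg_gen (\<iota> ` L)"
      unfolding f(2) fa_hom_def by (intro sum) auto
  qed
  show "alg_gen (\<iota> ` L) \<subseteq> fa_hom \<iota> ` fa_on L"
  proof
    fix D assume "D \<in> alg_gen (\<iota> ` L)"
    then show "D \<in> fa_hom \<iota> ` fa_on L"
    proof induction
      case (scal c)
      have "fa_hom \<iota> (single [] c) = (\<lambda>p. const_poly c * p)"
        by (subst app[symmetric]) (auto intro: fa_on_single simp: fhom_single)
      then show ?case by (metis fa_on_single empty_subsetI image_eqI list.set(1))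
    next
      case (gen D)
      then obtain x where x: "x \<in> L" "D = \<iota> x" by blast
      have "fa_hom \<iota> (single [x] 1) = \<iota> x"
        using x(1) by (subst app[symmetric]) (auto intro!: fa_on_single ext simp: fhom_single lin app_Lop)
      moreover have "single [x] 1 \<in> fa_on L" using x(1) by (intro fa_on_single) auto
      ultimately show ?case using x(2) by (metis image_eqI)
    next
      case (add D E)
      then obtain f g where fg: "f \<in> fa_on L" "D = fa_hom \<iota> f" "g \<in> fa_on L" "E = fa_hom \<iota> g" by blast
      have "fa_hom \<iota> (f + g) = (\<lambda>p. D p + E p)"
        using fg by (auto simp: fa_on_add fhom_add simp flip: app)
      then show ?case using fa_on_add[OF fg(1,3)] by (metis image_eqI)
    next
      case (comp D E)
      then obtain f g where fg: "f \<in> fa_on L" "D = fa_hom \<iota> f" "g \<in> fa_on L" "E = fa_hom \<iota> g" by blast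
      have "fa_hom \<iota> (f * g) = D \<circ> E"
        using fg by (auto simp: fa_on_mult fhom_mult simp flip: app)
      then show ?case using fa_on_mult[OF fg(1,3)] by (metis image_eqI)
    qed
  qed
qed

section \<open>Matrix Lie algebras and their enveloping algebras\<close>

text \<open>Spanning is expressed entrywise, since matrices of all sizes share one type and form no
  vector space there. The index type is well-ordered for the sake of the growth argument.\<close>

locale spanned_lie_algebra =
  fixes L :: "'a::field mat set" and d :: nat and e :: "'i::wellorder \<Rightarrow> 'a mat" and I :: "'i set"
  assumes carrier: "L \<subseteq> carrier_mat d d"
    and zero_closed: "0\<^sub>m d d \<in> L"
    and add_closed: "x \<in> L \<Longrightarrow> y \<in> L \<Longrightarrow> x + y \<in> L"
    and smult_closed: "x \<in> L \<Longrightarrow> c \<cdot>\<^sub>m x \<in> L"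
    and bracket_closed: "x \<in> L \<Longrightarrow> y \<in> L \<Longrightarrow> x * y - y * x \<in> L"
    and finite_I: "finite I"
    and e_closed: "i \<in> I \<Longrightarrow> e i \<in> L"
    and spanned: "x \<in> L \<Longrightarrow> \<exists>c. \<forall>a<d. \<forall>b<d. x $$ (a, b) = (\<Sum>i\<in>I. c i * e i $$ (a, b))"
begin

abbreviation "K \<equiv> fa_ideal L (lie_rels L)"

definition lst :: "'i multiset \<Rightarrow> 'i list" where "lst \<mu> = (SOME w. mset w = \<mu>)"

lemma mset_lst: "mset (lst \<mu>) = \<mu>"
  unfolding lst_def by (rule someI_ex) (rule ex_mset)

abbreviation g :: "'i \<Rightarrow> 'a mat list \<Rightarrow>\<^sub>0 'a" where "g i \<equiv> single [e i] 1"

lemma ideal_mult_left: "f \<in> fa_on L \<Longrightarrow> x \<in> K \<Longrightarrow> f * x \<in> K"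
  using fa_ideal.lmul[of x L "lie_rels L" f] by (simp add: fa_mult_eq_times)

lemma ideal_mult_right: "f \<in> fa_on L \<Longrightarrow> x \<in> K \<Longrightarrow> x * f \<in> K"
  using fa_ideal.rmul[of x L "lie_rels L" f] by (simp add: fa_mult_eq_times)

lemma subspace_ideal: "fa.subspace K"
  unfolding fa.subspace_def fscale_def
  by (auto intro: fa_ideal.zero fa_ideal.add intro!: ideal_mult_left[OF fa_on_single])

lemma single_add_ideal:
  "x \<in> L \<Longrightarrow> y \<in> L \<Longrightarrow> single [x + y] 1 - single [x] 1 - single [y] 1 \<in> K"
  by (rule fa_ideal.gen) (unfold lie_rels_def, blast)

lemma single_smult_ideal: "x \<in> L \<Longrightarrow> single [c \<cdot>\<^sub>m x] 1 - single [x] c \<in> K"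
  by (rule fa_ideal.gen) (unfold lie_rels_def, blast)

lemma single_bracket_ideal:
  "x \<in> L \<Longrightarrow> y \<in> L \<Longrightarrow> single [x, y] 1 - single [y, x] 1 - single [x * y - y * x] 1 \<in> K"
  by (rule fa_ideal.gen) (unfold lie_rels_def, blast)

lemma single_spanned:
  assumes "x \<in> L"
  obtains c where "single [x] 1 - (\<Sum>i\<in>I. fscale (c i) (g i)) \<in> K"
proof -
  from spanned[OF assms] obtain c where
    c: "\<And>a b. a < d \<Longrightarrow> b < d \<Longrightarrow> x $$ (a, b) = (\<Sum>i\<in>I. c i * e i $$ (a, b))" by blast
  let ?y = "\<lambda>F. mat d d (\<lambda>ab. \<Sum>i\<in>F. c i * e i $$ ab)"
  have "?y F \<in> L \<and> single [?y F] 1 - (\<Sum>i\<in>F. fscale (c i) (g i)) \<in> K" if "finite F" "F \<subseteq> I" for F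
    using that
  proof (induction F rule: finite_induct)
    \<comment> \<open>The letter of the zero matrix vanishes in U(L) by the scaling relation with
      scalar 0.\<close>
    case empty
    have y: "?y {} = 0\<^sub>m d d" by auto
    have "0 \<cdot>\<^sub>m 0\<^sub>m d d = (0\<^sub>m d d :: 'a mat)" by auto
    then show ?case
      unfolding y using zero_closed single_smult_ideal[OF zero_closed, of 0] by simp
  next
    case (insert i F)
    then have IH: "?y F \<in> L" "single [?y F] 1 - (\<Sum>i\<in>F. fscale (c i) (g i)) \<in> K" and iI: "e i \<in> L"
      using e_closed by auto
    have "e i \<in> carrier_mat d d" using iI carrier by blast
    then have y: "?y (insert i F) = c i \<cdot>\<^sub>m e i + ?y F"
      using insert.hyps by (intro eq_matI) auto
    have "(single [c i \<cdot>\<^sub>m e i + ?y F] 1 - single [c i \<cdot>\<^sub>m e i] 1 - single [?y F] 1)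
        + (single [c i \<cdot>\<^sub>m e i] 1 - single [e i] (c i)) + (single [?y F] 1 - (\<Sum>i\<in>F. fscale (c i) (g i))) \<in> K"
      by (intro fa_ideal.add single_add_ideal single_smult_ideal smult_closed iI IH)
    then have "single [?y (insert i F)] 1 - (\<Sum>i\<in>insert i F. fscale (c i) (g i)) \<in> K"
      using insert.hyps unfolding y by (simp add: fscale_single algebra_simps)
    moreover have "?y (insert i F) \<in> L" unfolding y by (intro add_closed smult_closed iI IH)
    ultimately show ?case by blast
  qed
  moreover have "?y I = x" using assms carrier c by (intro eq_matI) auto
  ultimately show thesis using that finite_I by force
qed

text \<open>The standard filtration of U(L), lifted to the free algebra. Words in the spanning
  letters \<open>e i\<close> generate it; the other letters of \<open>L\<close> enter through the
  ideal.\<close>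

sublocale U: word_filtration fscale K I g "\<lambda>_. Suc 0" lst
proof
  fix i x assume "i \<in> I" "x \<in> K"
  moreover from this have "g i \<in> fa_on L" by (intro fa_on_single) (simp add: e_closed)
  ultimately show "g i * x \<in> K" "x * g i \<in> K" by (simp_all add: ideal_mult_left ideal_mult_right)
qed (simp add: mset_lst)

lemma ideal_low: "x \<in> K \<Longrightarrow> x \<in> U.low n"
  unfolding U.low_def by (rule fa.span_base) simp

lemma g_low: "i \<in> I \<Longrightarrow> g i \<in> U.low 2"
  using U.word_in_low[of "[i]" 2] by simp

lemma bracket_spanned:
  assumes "i \<in> I" "j \<in> I"
  obtains c where "g i * g j - g j * g i - (\<Sum>l\<in>I. fscale (c l) (g l)) \<in> K"
proof -
  have e: "e i \<in> L" "e j \<in> L" using assms e_closed by auto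
  obtain c where c: "single [e i * e j - e j * e i] 1 - (\<Sum>l\<in>I. fscale (c l) (g l)) \<in> K"
    using single_spanned[OF bracket_closed[OF e]] .
  have "g i * g j - g j * g i - (\<Sum>l\<in>I. fscale (c l) (g l)) \<in> K"
    using fa_ideal.add[OF single_bracket_ideal[OF e] c] by (simp add: mult_single plus_list_def)
  then show thesis by (rule that)
qed

sublocale U: commutative_filtration fscale K I g "\<lambda>_. Suc 0" lst
proof
  fix i j assume ij: "i \<in> I" "j \<in> I"
  from bracket_spanned[OF this] obtain c where
    c: "g i * g j - g j * g i - (\<Sum>l\<in>I. fscale (c l) (g l)) \<in> K" .
  have "(\<Sum>l\<in>I. fscale (c l) (g l)) \<in> U.low 2"
    by (intro U.low_sum U.low_scale g_low)
  from U.low_add[OF ideal_low[OF c] this] show "g i * g j - g j * g i \<in> U.low (Suc 0 + Suc 0)"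
    by (simp add: numeral_2_eq_2)
qed

lemma word_in_low: "set w \<subseteq> L \<Longrightarrow> \<exists>n. single w 1 \<in> U.low n"
proof (induction w)
  case Nil
  have "single [] 1 = (1 :: 'a mat list \<Rightarrow>\<^sub>0 'a)" by (metis single_one zero_list_def)
  then show ?case using U.word_in_low[of "[]" 1] by (auto intro!: exI[of _ 1])
next
  case (Cons x w)
  then obtain n where n: "single w 1 \<in> U.low n" by auto
  obtain c where c: "single [x] 1 - (\<Sum>i\<in>I. fscale (c i) (g i)) \<in> K"
    using single_spanned[of x] Cons.prems by auto
  have "(\<Sum>i\<in>I. fscale (c i) (g i * single w 1)) \<in> U.low (Suc 0 + n)"
    by (intro U.low_sum U.low_scale U.low_gen_left n)
  moreover have "(single [x] 1 - (\<Sum>i\<in>I. fscale (c i) (g i))) * single w 1 \<in> U.low (Suc 0 + n)"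
    using Cons.prems by (intro ideal_low ideal_mult_right c fa_on_single) auto
  ultimately have "(single [x] 1 - (\<Sum>i\<in>I. fscale (c i) (g i))) * single w 1
      + (\<Sum>i\<in>I. fscale (c i) (g i * single w 1)) \<in> U.low (Suc 0 + n)"
    by (rule U.low_add[rotated])
  also have "(single [x] 1 - (\<Sum>i\<in>I. fscale (c i) (g i))) * single w 1
      + (\<Sum>i\<in>I. fscale (c i) (g i * single w 1)) = single [x] 1 * single w 1"
    by (simp add: left_diff_distrib sum_distrib_right fa.scale_mult_left)
  also have "\<dots> = single (x # w) 1"
    by (simp add: mult_single plus_list_def)
  finally show ?case by blast
qed

lemma fa_on_low:
  assumes "f \<in> fa_on L"
  obtains n where "f \<in> U.low n"
proof -
  have "\<exists>n. (\<Sum>w\<in>A. fscale (lookup f w) (single w 1)) \<in> U.low n" if "finite A" "A \<subseteq> keys f" for A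
    using that
  proof (induction A rule: finite_induct)
    case empty
    then show ?case by (auto intro: U.low_zero)
  next
    case (insert w A)
    then obtain m n where "single w 1 \<in> U.low m" "(\<Sum>w\<in>A. fscale (lookup f w) (single w 1)) \<in> U.low n"
      using word_in_low[of w] assms by (auto simp: fa_on_def)
    then have "fscale (lookup f w) (single w 1) \<in> U.low (max m n)"
      "(\<Sum>w\<in>A. fscale (lookup f w) (single w 1)) \<in> U.low (max m n)"
      by (auto intro: U.low_scale U.low_mono)
    then show ?case using insert.hyps U.low_add by fastforce
  qed
  from this[of "keys f"] show thesis
    using that by (auto simp: fscale_single simp flip: poly_mapping_sum_single)
qed

lemma fa_on_ordered:
  assumes "f \<in> fa_on L"
  obtains B b where "finite B" "B \<subseteq> {\<mu>. set_mset \<mu> \<subseteq> I}"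
    "f - (\<Sum>\<mu>\<in>B. fscale (b \<mu>) (U.mon \<mu>)) \<in> K"
proof -
  obtain n where "f \<in> U.low n" using fa_on_low[OF assms] .
  then have "f \<in> fa.span (K \<union> U.mon ` {\<mu>. set_mset \<mu> \<subseteq> I \<and> U.mweight \<mu> < n})"
    using U.low_subset_span_mon by blast
  then obtain x y where xy: "f = x + y" "x \<in> fa.span K"
    "y \<in> fa.span (U.mon ` {\<mu>. set_mset \<mu> \<subseteq> I \<and> U.mweight \<mu> < n})"
    unfolding fa.span_Un by blast
  obtain B b where B: "finite B" "B \<subseteq> {\<mu>. set_mset \<mu> \<subseteq> I \<and> U.mweight \<mu> < n}"
    "y = (\<Sum>\<mu>\<in>B. fscale (b \<mu>) (U.mon \<mu>))"
    using fa.span_imageE[OF xy(3)] by blast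
  have "x \<in> K" using xy(2) subspace_ideal by (metis fa.span_eq_iff)
  then have "f - (\<Sum>\<mu>\<in>B. fscale (b \<mu>) (U.mon \<mu>)) \<in> K" using xy(1) B(3) by simp
  then show thesis using B by (intro that[of B b]) auto
qed

end

section \<open>Representations by operators and the image of U(L)\<close>

locale lie_representation = spanned_lie_algebra L d e I
  for L :: "'a::field mat set" and d :: nat and e :: "'i::wellorder \<Rightarrow> 'a mat" and I :: "'i set" +
  fixes D :: "'a mat \<Rightarrow> ('v, 'a) lop"
  assumes D_add: "x \<in> L \<Longrightarrow> y \<in> L \<Longrightarrow> D (x + y) = D x + D y"
    and D_smult: "x \<in> L \<Longrightarrow> D (c \<cdot>\<^sub>m x) = lscale c (D x)"
    and D_bracket: "x \<in> L \<Longrightarrow> y \<in> L \<Longrightarrow> D (x * y - y * x) = D x * D y - D y * D x"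
begin

lemma fhom_ideal: "x \<in> K \<Longrightarrow> fhom D x = 0"
proof (induction rule: fa_ideal.induct)
  case (gen r)
  then show ?case
    by (auto simp: lie_rels_def fhom_diff fhom_single lscale_one D_add D_smult D_bracket)
qed (simp_all add: fhom_add fhom_mult fa_mult_eq_times)

lemma fhom_mon: "fhom D (U.mon \<mu>) = prod_list (map (\<lambda>i. D (e i)) (lst \<mu>))"
proof -
  have "fhom D (U.word w) = prod_list (map (\<lambda>i. D (e i)) w)" for w
    by (induction w)
      (simp_all add: fhom_mult fhom_single lscale_one flip: single_one, simp add: fhom_single zero_list_def lscale_one)
  then show ?thesis by (simp add: U.mon_def)
qed

sublocale R: word_filtration lscale "{}" I "\<lambda>i. D (e i)" "\<lambda>_. Suc 0" lst
  by unfold_locales (auto simp: mset_lst)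

sublocale R: unit_filtration lscale I "\<lambda>i. D (e i)" lst
proof
  fix i j assume ij: "i \<in> I" "j \<in> I"
  from bracket_spanned[OF this] obtain c where
    "g i * g j - g j * g i - (\<Sum>l\<in>I. fscale (c l) (g l)) \<in> K" .
  from fhom_ideal[OF this]
  have "D (e i) * D (e j) - D (e j) * D (e i) = (\<Sum>l\<in>I. lscale (c l) (D (e l)))"
    by (simp add: fhom_diff fhom_sum fhom_fscale fhom_mult fhom_single lscale_one)
  also have "\<dots> \<in> R.low 2"
    using R.word_in_low[of "[l]" 2 for l] by (intro R.low_sum R.low_scale) auto
  finally show "D (e i) * D (e j) - D (e j) * D (e i) \<in> R.low (Suc 0 + Suc 0)"
    by (simp add: numeral_2_eq_2)
qed (rule finite_I)

lemma fhom_eq_sum_mon: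
  assumes "f \<in> fa_on L"
  obtains B b where "finite B" "B \<subseteq> {\<mu>. set_mset \<mu> \<subseteq> I}"
    "f - (\<Sum>\<mu>\<in>B. fscale (b \<mu>) (U.mon \<mu>)) \<in> K" "fhom D f = (\<Sum>\<mu>\<in>B. lscale (b \<mu>) (R.mon \<mu>))"
proof -
  obtain B b where B: "finite B" "B \<subseteq> {\<mu>. set_mset \<mu> \<subseteq> I}"
    "f - (\<Sum>\<mu>\<in>B. fscale (b \<mu>) (U.mon \<mu>)) \<in> K"
    using fa_on_ordered[OF assms] .
  moreover have "fhom D f = (\<Sum>\<mu>\<in>B. lscale (b \<mu>) (R.mon \<mu>))"
    using fhom_ideal[OF B(3)]
    by (simp add: fhom_diff fhom_sum fhom_fscale fhom_mon R.mon_def R.word_def)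
  ultimately show thesis by (rule that)
qed

text \<open>Once \<phi> is known to be onto the invariants, this gives every explicit invariant a
  finite degree in the generators.\<close>

lemma fhom_in_low:
  assumes "f \<in> fa_on L"
  shows "\<exists>n. fhom D f \<in> R.low n"
proof -
  obtain B b where B: "finite B" "B \<subseteq> {\<mu>. set_mset \<mu> \<subseteq> I}"
    "fhom D f = (\<Sum>\<mu>\<in>B. lscale (b \<mu>) (R.mon \<mu>))"
    using fhom_eq_sum_mon[OF assms] by metis
  have "R.mon \<mu> \<in> R.low (Suc (\<Sum>\<mu>\<in>B. size \<mu>))" if "\<mu> \<in> B" for \<mu>
    using B that member_le_sum[of \<mu> B size] by (intro R.mon_in_low) (auto simp: less_Suc_eq_le)
  then show ?thesis unfolding B(3) by (blast intro: R.low_sum R.low_scale)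
qed

lemma kernel_fhom:
  assumes "lop.indep_family R.mon {\<mu>. set_mset \<mu> \<subseteq> I}" "f \<in> fa_on L" "fhom D f = 0"
  shows "f \<in> K"
proof -
  obtain B b where B: "finite B" "B \<subseteq> {\<mu>. set_mset \<mu> \<subseteq> I}"
    "f - (\<Sum>\<mu>\<in>B. fscale (b \<mu>) (U.mon \<mu>)) \<in> K" "fhom D f = (\<Sum>\<mu>\<in>B. lscale (b \<mu>) (R.mon \<mu>))"
    using fhom_eq_sum_mon[OF assms(2)] .
  have "\<forall>\<mu>\<in>B. b \<mu> = 0"
    using lop.indep_familyD[OF assms(1) B(1,2), of b] B(4) assms(3) by auto
  then have "(\<Sum>\<mu>\<in>B. fscale (b \<mu>) (U.mon \<mu>)) = 0"
    by (intro sum.neutral) (simp add: fscale_def)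
  then show ?thesis using B(3) by simp
qed

end

text \<open>The exponents of a product of the monomials \<open>m j\<close> determine its factors: to
  the exponent of \<open>key j\<close> only \<open>j\<close> itself and factors of smaller rank
  \<rho> contribute, so multiplicities are recovered in order of increasing \<rho>.\<close>

lemma inj_on_sum_mset_triangular:
  fixes m :: "'j \<Rightarrow> 'x multiset" and \<rho> :: "'j \<Rightarrow> nat"
  assumes J: "finite J" and key: "\<And>j. j \<in> J \<Longrightarrow> key j \<in># m j"
    and tri: "\<And>i j. i \<in> J \<Longrightarrow> j \<in> J \<Longrightarrow> i \<noteq> j \<Longrightarrow> key j \<in># m i \<Longrightarrow> \<rho> i < \<rho> j"
  shows "inj_on (\<lambda>\<gamma>. sum_mset (image_mset m \<gamma>)) {\<gamma>. set_mset \<gamma> \<subseteq> J}"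
proof (rule inj_onI, rule ccontr)
  fix \<gamma> \<delta>
  assume sub: "\<gamma> \<in> {\<gamma>. set_mset \<gamma> \<subseteq> J}" "\<delta> \<in> {\<gamma>. set_mset \<gamma> \<subseteq> J}"
    and eq: "sum_mset (image_mset m \<gamma>) = sum_mset (image_mset m \<delta>)" and "\<gamma> \<noteq> \<delta>"
  have count: "count (sum_mset (image_mset m \<epsilon>)) x = (\<Sum>j\<in>J. count \<epsilon> j * count (m j) x)"
    if "set_mset \<epsilon> \<subseteq> J" for \<epsilon> x
    using that
  proof (induction \<epsilon>)
    case (add i \<epsilon>)
    have "(\<Sum>j\<in>J. count (add_mset i \<epsilon>) j * count (m j) x)
        = (\<Sum>j\<in>J. (if j = i then count (m j) x else 0) + count \<epsilon> j * count (m j) x)"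
      by (intro sum.cong) auto
    then show ?case using add J by (simp add: sum.distrib)
  qed simp
  obtain j1 where "count \<gamma> j1 \<noteq> count \<delta> j1" using \<open>\<gamma> \<noteq> \<delta>\<close> by (auto simp: multiset_eq_iff)
  \<comment> \<open>At a discrepancy of smallest rank, all other factors that could contribute to
    \<open>key j\<close> already agree.\<close>
  from ex_has_least_nat[of "\<lambda>j. count \<gamma> j \<noteq> count \<delta> j", OF this, of \<rho>]
  obtain j where j: "count \<gamma> j \<noteq> count \<delta> j"
    and least: "\<And>i. count \<gamma> i \<noteq> count \<delta> i \<Longrightarrow> \<rho> j \<le> \<rho> i" by blast
  have jJ: "j \<in> J" using j sub by (metis count_eq_zero_iff mem_Collect_eq subsetD)
  have rest: "(\<Sum>i\<in>J - {j}. count \<gamma> i * count (m i) (key j)) = (\<Sum>i\<in>J - {j}. count \<delta> i * count (m i) (key j))"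
  proof (rule sum.cong)
    fix i assume i: "i \<in> J - {j}"
    show "count \<gamma> i * count (m i) (key j) = count \<delta> i * count (m i) (key j)"
    proof (cases "key j \<in># m i")
      case True
      then have "\<rho> i < \<rho> j" using tri i jJ by auto
      then show ?thesis using least[of i] by auto
    next
      case False
      then show ?thesis by (simp add: not_in_iff)
    qed
  qed simp
  have "(\<Sum>i\<in>J. count \<gamma> i * count (m i) (key j)) = (\<Sum>i\<in>J. count \<delta> i * count (m i) (key j))"
    using count[of \<gamma> "key j"] count[of \<delta> "key j"] sub eq by simp
  then have "count \<gamma> j * count (m j) (key j) = count \<delta> j * count (m j) (key j)"
    using rest by (simp add: sum.remove[OF J jJ])
  then show False using j key[OF jJ] by (auto simp: count_eq_zero_iff)
qed

text \<open>The summand at \<open>peak j\<close> outweighs the others, so the symbol of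
  \<open>Q j\<close> is a two-letter monomial; \<open>key\<close> and \<rho> make these monomials
  multiplicatively independent.\<close>

lemma indep_family_quadratic:
  fixes s :: "'j \<Rightarrow> 'r \<Rightarrow> 'a::field_char_0" and \<alpha> \<beta> :: "'j \<Rightarrow> 'r \<Rightarrow> 'v + 'v" and lst :: "'j multiset \<Rightarrow> 'j list"
  assumes wt: "\<And>v. 0 < wt (Inl v) + (wt (Inr v) :: nat)"
    and J: "finite J" and R: "finite R" and lst: "\<And>\<gamma>. mset (lst \<gamma>) = \<gamma>"
    and Q: "\<And>j. j \<in> J \<Longrightarrow> Q j = (\<Sum>r\<in>R. lscale (s j r) (wgen (\<alpha> j r) * wgen (\<beta> j r)))"
    and peak: "\<And>j. j \<in> J \<Longrightarrow> peak j \<in> R" "\<And>j. j \<in> J \<Longrightarrow> s j (peak j) \<noteq> 0"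
    and dom: "\<And>j r. j \<in> J \<Longrightarrow> r \<in> R \<Longrightarrow> r \<noteq> peak j \<Longrightarrow>
      wt (\<alpha> j r) + wt (\<beta> j r) < wt (\<alpha> j (peak j)) + wt (\<beta> j (peak j))"
    and key: "\<And>j. j \<in> J \<Longrightarrow> key j \<in> {\<alpha> j (peak j), \<beta> j (peak j)}"
    and tri: "\<And>i j. i \<in> J \<Longrightarrow> j \<in> J \<Longrightarrow> i \<noteq> j \<Longrightarrow> key j \<in> {\<alpha> i (peak i), \<beta> i (peak i)} \<Longrightarrow> \<rho> i < (\<rho> j :: nat)"
  shows "lop.indep_family (\<lambda>\<gamma>. prod_list (map Q (lst \<gamma>))) {\<gamma>. set_mset \<gamma> \<subseteq> J}"
proof -
  interpret W: filtration "lscale :: 'a \<Rightarrow> ('v, 'a) lop \<Rightarrow> _" UNIV wgen wt normal_order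
    using wt by (rule filtration_wgen)
  let ?m = "\<lambda>j. {#\<alpha> j (peak j), \<beta> j (peak j)#}"
  have lead: "W.leading (Q j) (s j (peak j)) (?m j)" if j: "j \<in> J" for j
  proof -
    let ?w = "\<lambda>r. [\<alpha> j r, \<beta> j r]"
    have Qj: "Q j = lscale (s j (peak j)) (W.word (?w (peak j))) + (\<Sum>r\<in>R - {peak j}. lscale (s j r) (W.word (?w r)))"
      using Q[OF j] by (simp add: sum.remove[OF R peak(1)[OF j]])
    have mw: "W.mweight (?m j) = W.weight (?w (peak j))"
      using W.mweight_mset[of "?w (peak j)"] by simp
    have "Q j - lscale (s j (peak j)) (W.mon (?m j))
        = lscale (s j (peak j)) (W.word (?w (peak j)) - W.mon (mset (?w (peak j))))
          + (\<Sum>r\<in>R - {peak j}. lscale (s j r) (W.word (?w r)))"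
      unfolding Qj by (simp add: lop.scale_right_diff_distrib)
    also have "\<dots> \<in> W.low (W.weight (?w (peak j)))"
      using dom[OF j]
      by (intro W.low_add W.low_scale W.low_sum W.word_mon W.word_in_low) auto
    finally show ?thesis unfolding W.leading_def mw by simp
  qed
  have lsum: "sum_list (map f (lst \<gamma>)) = sum_mset (image_mset f \<gamma>)" for f :: "'j \<Rightarrow> ('v + 'v) multiset" and \<gamma>
    by (metis lst mset_map sum_mset_sum_list)
  have set: "set (lst \<gamma>) = set_mset \<gamma>" for \<gamma> by (metis lst set_mset_mset)
  show ?thesis
  proof (rule W.indep_family_leading)
    show "lop.indep_family W.mon {\<mu>. set_mset \<mu> \<subseteq> UNIV}"
      using indep_family_normal_order by (simp add: W.mon_def[abs_def] W.word_def)
    show "W.leading (prod_list (map Q (lst \<gamma>))) (prod_list (map (\<lambda>j. s j (peak j)) (lst \<gamma>)))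
        (sum_mset (image_mset ?m \<gamma>))" if "\<gamma> \<in> {\<gamma>. set_mset \<gamma> \<subseteq> J}" for \<gamma>
      using W.leading_prod_list[of "lst \<gamma>" Q "\<lambda>j. s j (peak j)" ?m] lead that
      unfolding lsum by (auto simp: set)
    show "prod_list (map (\<lambda>j. s j (peak j)) (lst \<gamma>)) \<noteq> 0" if "\<gamma> \<in> {\<gamma>. set_mset \<gamma> \<subseteq> J}" for \<gamma>
      using that peak(2) by (auto simp: prod_list_zero_iff set)
    show "inj_on (\<lambda>\<gamma>. sum_mset (image_mset ?m \<gamma>)) {\<gamma>. set_mset \<gamma> \<subseteq> J}"
      using key tri by (intro inj_on_sum_mset_triangular[OF J, where key = key and \<rho> = \<rho>]) auto
  qed
qed

lemma linear_op_weyl: "D \<in> weyl Vs \<Longrightarrow> linear_op D"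
proof (induction rule: weyl.induct)
  case (comp D E)
  then show ?case using linear_op_intros(6)[of D E] by (simp add: comp_def)
qed (auto intro: linear_op_intros linear_op_intros(7)[OF linear_op_intros(2)])

text \<open>Since \<phi> is onto, each \<open>Q j\<close> is a polynomial in the images of the
  spanning set and so has finite degree. Independence of the products of the \<open>Q j\<close> then
  yields that of the ordered monomials, hence the triviality of the kernel.\<close>

theorem phi_iso_of_growth:
  fixes \<iota> :: "'a::field_char_0 mat \<Rightarrow> ('v, 'a) dop" and Q :: "'j \<Rightarrow> ('v, 'a) lop"
    and lst' :: "'j multiset \<Rightarrow> 'j list"
  assumes L: "spanned_lie_algebra L d e I"
    and howe: "howe_embedding L \<iota> Vs DK" and DK: "DK \<subseteq> weyl Vs"
    and J: "finite J" "card I \<le> card J" and Q: "\<And>j. j \<in> J \<Longrightarrow> app (Q j) \<in> DK"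
    and lst': "\<And>\<gamma>. mset (lst' \<gamma>) = \<gamma>"
    and indep: "lop.indep_family (\<lambda>\<gamma>. prod_list (map Q (lst' \<gamma>))) {\<gamma>. set_mset \<gamma> \<subseteq> J}"
  shows "phi_iso L \<iota> DK"
proof -
  note h = howe[unfolded howe_embedding_def]
  have lin: "linear_op (\<iota> x)" if "x \<in> L" for x
  proof -
    have "\<iota> ` L \<subseteq> DK" using h by blast
    then show ?thesis using DK that by (intro linear_op_weyl) blast
  qed
  interpret spanned_lie_algebra L d e I by (rule L)
  let ?D = "\<lambda>x. Lop (\<iota> x)"
  interpret lie_representation L d e I ?D
  proof
    fix x y assume xy: "x \<in> L" "y \<in> L"
    show "?D (x + y) = ?D x + ?D y"
      using h xy by (intro lop_eqI) (simp add: app_Lop lin linear_op_intros)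
    show "?D (x * y - y * x) = ?D x * ?D y - ?D y * ?D x"
      using h xy by (intro lop_eqI) (simp add: app_Lop lin linear_op_intros)
  next
    fix x c assume x: "x \<in> L"
    show "?D (c \<cdot>\<^sub>m x) = lscale c (?D x)"
      using h x by (intro lop_eqI) (simp add: app_Lop lin linear_op_intros)
  qed
  have image: "fa_hom \<iota> ` fa_on L = DK"
    using h fa_hom_image[of L \<iota>] lin by auto
  have "\<exists>n. Q j \<in> R.low n" if j: "j \<in> J" for j
  proof -
    obtain f where f: "f \<in> fa_on L" "app (Q j) = fa_hom \<iota> f"
      using Q[OF j] image by blast
    then have "Q j = fhom ?D f" using app_fhom[of L \<iota> f] lin by (intro lop_eqI) simp
    then show ?thesis using fhom_in_low[OF f(1)] by simp
  qed
  then have "lop.indep_family R.mon {\<mu>. set_mset \<mu> \<subseteq> I}"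
    by (rule R.indep_family_mon[OF J lst' _ indep])
  moreover have "fhom ?D f = 0" if "f \<in> fa_on L" "fa_hom \<iota> f = (\<lambda>p. 0)" for f
    using that app_fhom[of L \<iota> f] lin by (intro lop_eqI) simp
  ultimately show ?thesis
    unfolding phi_iso_def using image kernel_fhom by blast
qed

section \<open>Quadratic invariants\<close>

abbreviation pullback :: "('v \<Rightarrow> ('v, 'a) mpoly) \<Rightarrow> ('v, 'a::comm_ring_1) lop" where
  "pullback \<sigma> \<equiv> Lop (subst \<sigma>)"

lemma app_pullback [simp]: "app (pullback \<sigma>) p = subst \<sigma> p"
  by (simp add: app_Lop linear_op_intros)

text \<open>By \<open>inv\<close>, the tensor with coefficients \<open>\<beta> r\<close> at the
  positions \<open>(r, \<tau> r)\<close> is invariant under \<open>A\<close> and \<open>A'\<close>.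
  For \<tau> the identity and \<beta> constant this is the standard pairing; the symplectic form has
  the dual index as \<tau> and signs as \<beta>.\<close>

lemma quadratic_invariant:
  fixes G H :: "nat \<Rightarrow> ('v, 'a::field) lop"
  assumes G: "\<And>r. r < k \<Longrightarrow> T * G r = (\<Sum>l<k. lscale (A r l) (G l * T))"
    and H: "\<And>r. r < k \<Longrightarrow> T * H r = (\<Sum>l<k. lscale (A' r l) (H l * T))"
    and \<tau>: "\<And>r. r < k \<Longrightarrow> \<tau> r < k"
    and inv: "\<And>l m. l < k \<Longrightarrow> m < k \<Longrightarrow> (\<Sum>r<k. \<beta> r * (A r l * A' (\<tau> r) m)) = (if m = \<tau> l then \<beta> l else 0)"
  shows "T * (\<Sum>r<k. lscale (\<beta> r) (G r * H (\<tau> r))) = (\<Sum>r<k. lscale (\<beta> r) (G r * H (\<tau> r))) * T"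
proof -
  have GH: "T * (G r * H s) = (\<Sum>l<k. \<Sum>m<k. lscale (A r l * A' s m) (G l * H m * T))"
    if "r < k" "s < k" for r s
  proof -
    have "T * (G r * H s) = (\<Sum>l<k. lscale (A r l) (G l * (T * H s)))"
      using that(1) by (simp add: G sum_distrib_right lop.scale_mult_left mult.assoc flip: mult.assoc[of T])
    also have "\<dots> = (\<Sum>l<k. lscale (A r l) (\<Sum>m<k. lscale (A' s m) (G l * H m * T)))"
      using that(2) by (simp add: H sum_distrib_left lop.scale_mult_right mult.assoc)
    finally show ?thesis by (simp add: lop.scale_sum_right)
  qed
  have "T * (\<Sum>r<k. lscale (\<beta> r) (G r * H (\<tau> r)))
      = (\<Sum>r<k. \<Sum>l<k. \<Sum>m<k. lscale (\<beta> r * (A r l * A' (\<tau> r) m)) (G l * H m * T))"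
    by (simp add: sum_distrib_left lop.scale_mult_right GH \<tau> lop.scale_sum_right)
  also have "\<dots> = (\<Sum>l<k. \<Sum>m<k. \<Sum>r<k. lscale (\<beta> r * (A r l * A' (\<tau> r) m)) (G l * H m * T))"
    by (subst sum.swap, rule sum.cong[OF refl], rule sum.swap)
  also have "\<dots> = (\<Sum>l<k. \<Sum>m<k. lscale (if m = \<tau> l then \<beta> l else 0) (G l * H m * T))"
    by (intro sum.cong refl) (simp add: inv flip: lop.scale_sum_left)
  also have "\<dots> = (\<Sum>l<k. \<Sum>m<k. if m = \<tau> l then lscale (\<beta> l) (G l * H m * T) else 0)"
    by (intro sum.cong refl) simp
  also have "\<dots> = (\<Sum>l<k. lscale (\<beta> l) (G l * H (\<tau> l) * T))"
    by (intro sum.cong refl) (simp add: \<tau>)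
  finally show ?thesis by (simp add: sum_distrib_right lop.scale_mult_left)
qed

lemma pullback_Xvar:
  assumes "\<sigma> v = (\<Sum>l<k. const_poly (S l) * Xvar (x l))"
  shows "pullback \<sigma> * wgen (Inl v) = (\<Sum>l<k. lscale (S l) (wgen (Inl (x l)) * pullback \<sigma>))"
  by (intro lop_eqI) (simp add: app_sum subst_mult assms sum_distrib_right mult.assoc)

text \<open>Inverting the chain rule: derivatives transform by the inverse \<open>h\<close> of
  \<open>S\<close>. The map \<open>x\<close> enumerates one row or column of coordinates that
  \<sigma> mixes among themselves, and \<open>other\<close> says that the images of the remaining
  coordinates do not involve it.\<close>

lemma pullback_dX:
  fixes x :: "nat \<Rightarrow> 'v" and h :: "nat \<Rightarrow> nat \<Rightarrow> 'a::field"
  assumes inj: "\<And>r s. r < k \<Longrightarrow> s < k \<Longrightarrow> x r = x s \<Longrightarrow> r = s"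
    and \<sigma>: "\<And>r. r < k \<Longrightarrow> \<sigma> (x r) = (\<Sum>l<k. const_poly (S r l) * Xvar (x l))"
    and other: "\<And>r w. r < k \<Longrightarrow> w \<notin> x ` {..<k} \<Longrightarrow> dX (x r) (\<sigma> w) = 0"
    and h: "\<And>l m. l < k \<Longrightarrow> m < k \<Longrightarrow> (\<Sum>r<k. S l r * h r m) = (if l = m then 1 else 0)"
    and m: "m < k"
  shows "pullback \<sigma> * wgen (Inr (x m)) = (\<Sum>r<k. lscale (h r m) (wgen (Inr (x r)) * pullback \<sigma>))"
proof -
  have injx: "inj_on x {..<k}" using inj by (auto intro: inj_onI)
  have dX: "dX (x r) (subst \<sigma> p) = (\<Sum>l<k. const_poly (S l r) * subst \<sigma> (dX (x l) p))"
    if r: "r < k" for r p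
  proof -
    let ?S = "\<lambda>w. S (the_inv_into {..<k} x w) r"
    have "dX (x r) (\<sigma> w) = const_poly (?S w)" if "w \<in> x ` {..<k}" for w
    proof -
      obtain l where l: "l < k" "w = x l" using \<open>w \<in> x ` {..<k}\<close> by auto
      have "dX (x r) (\<sigma> w) = (\<Sum>j<k. if j = r then const_poly (S l j) else 0)"
        unfolding l(2) \<sigma>[OF l(1)] dX_sum using inj[OF r]
        by (intro sum.cong) (auto simp: dX_mult dX_Xvar)
      also have "\<dots> = const_poly (?S w)"
        using r l by (simp add: the_inv_into_f_f[OF injx])
      finally show ?thesis .
    qed
    then have "dX (x r) (subst \<sigma> p) = (\<Sum>w\<in>x ` {..<k}. const_poly (?S w) * subst \<sigma> (dX w p))"
      using other[OF r] by (intro dX_subst_linear) auto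
    also have "\<dots> = (\<Sum>l<k. const_poly (S l r) * subst \<sigma> (dX (x l) p))"
      by (simp add: sum.reindex[OF injx] the_inv_into_f_f[OF injx])
    finally show ?thesis .
  qed
  show ?thesis
  proof (rule lop_eqI)
    fix p
    have "app (\<Sum>r<k. lscale (h r m) (wgen (Inr (x r)) * pullback \<sigma>)) p
        = (\<Sum>r<k. \<Sum>l<k. const_poly (S l r * h r m) * subst \<sigma> (dX (x l) p))"
      by (simp add: app_sum dX sum_distrib_left const_poly_mult mult_ac)
    also have "\<dots> = (\<Sum>l<k. const_poly (\<Sum>r<k. S l r * h r m) * subst \<sigma> (dX (x l) p))"
      by (subst sum.swap) (simp add: const_poly_sum sum_distrib_right)
    also have "\<dots> = (\<Sum>l<k. if l = m then subst \<sigma> (dX (x l) p) else 0)"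
      using m by (intro sum.cong) (auto simp: h)
    finally show "app (pullback \<sigma> * wgen (Inr (x m))) p
        = app (\<Sum>r<k. lscale (h r m) (wgen (Inr (x r)) * pullback \<sigma>)) p"
      using m by simp
  qed
qed

lemma app_wgen_in_weyl:
  fixes v :: "'v + 'v"
  assumes "v \<in> Inl ` Vs \<union> Inr ` Vs"
  shows "app (wgen v :: ('v, 'a::comm_ring_1) lop) \<in> weyl Vs"
  using assms
proof (elim UnE imageE)
  fix w assume w: "v = Inl w" "w \<in> Vs"
  have "app (wgen v :: ('v, 'a) lop) = (\<lambda>p. Xvar w * p)" by (rule ext) (simp only: w app_wgen)
  then show "app (wgen v :: ('v, 'a) lop) \<in> weyl Vs" using weyl.mulx[OF w(2)] by simp
next
  fix w assume w: "v = Inr w" "w \<in> Vs"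
  have "app (wgen v :: ('v, 'a) lop) = dX w" by (rule ext) (simp only: w app_wgen)
  then show "app (wgen v :: ('v, 'a) lop) \<in> weyl Vs" using weyl.der[OF w(2)] by simp
qed

lemma app_quadratic_in_weyl:
  assumes "\<And>r. r \<in> R \<Longrightarrow> \<alpha> r \<in> Inl ` Vs \<union> Inr ` Vs" "\<And>r. r \<in> R \<Longrightarrow> \<beta> r \<in> Inl ` Vs \<union> Inr ` Vs"
  shows "app (\<Sum>r\<in>R. lscale (s r) (wgen (\<alpha> r) * wgen (\<beta> r))) \<in> weyl Vs"
  using assms
proof (induction R rule: infinite_finite_induct)
  case (insert r R)
  have "(\<lambda>p. const_poly (s r) * p) \<circ> (app (wgen (\<alpha> r)) \<circ> app (wgen (\<beta> r))) \<in> weyl Vs"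
    using insert.prems by (intro weyl.comp weyl.scal app_wgen_in_weyl) auto
  moreover have "app (\<Sum>r\<in>R. lscale (s r) (wgen (\<alpha> r) * wgen (\<beta> r))) \<in> weyl Vs"
    using insert by auto
  ultimately have "(\<lambda>p. ((\<lambda>p. const_poly (s r) * p) \<circ> (app (wgen (\<alpha> r)) \<circ> app (wgen (\<beta> r)))) p
      + app (\<Sum>r\<in>R. lscale (s r) (wgen (\<alpha> r) * wgen (\<beta> r))) p) \<in> weyl Vs"
    by (rule weyl.add)
  moreover have "app (\<Sum>r\<in>insert r R. lscale (s r) (wgen (\<alpha> r) * wgen (\<beta> r)))
      = (\<lambda>p. ((\<lambda>p. const_poly (s r) * p) \<circ> (app (wgen (\<alpha> r)) \<circ> app (wgen (\<beta> r)))) p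
          + app (\<Sum>r\<in>R. lscale (s r) (wgen (\<alpha> r) * wgen (\<beta> r))) p)"
    using insert.hyps by (intro ext) simp
  ultimately show ?case by simp
qed (use weyl.scal[of 0 Vs] in \<open>simp_all add: zero_lop_def app_Lop linear_op_intros lambda_zero\<close>)

lemma app_in_invariant_ops:
  assumes "app D \<in> weyl Vs" "\<And>\<sigma>. \<sigma> \<in> \<Sigma> \<Longrightarrow> pullback \<sigma> * D = D * pullback \<sigma>"
  shows "app D \<in> invariant_ops Vs \<Sigma>"
proof -
  have "app D \<circ> subst \<sigma> = subst \<sigma> \<circ> app D" if "\<sigma> \<in> \<Sigma>" for \<sigma>
    using arg_cong[OF assms(2)[OF that], of app] by (auto simp: fun_eq_iff dest: fun_cong)
  then show ?thesis using assms(1) by (simp add: invariant_ops_def)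
qed

section \<open>The three Lie algebras\<close>

lemma index_mult_mat_sum:
  assumes "A \<in> carrier_mat n m" "B \<in> carrier_mat m l" "i < n" "j < l"
  shows "(A * B) $$ (i, j) = (\<Sum>r<m. A $$ (i, r) * B $$ (r, j))"
  using assms by (auto simp: scalar_prod_def lessThan_atLeast0 intro!: sum.cong)

text \<open>Moving \<open>M\<close> across a product reverses the order: the transpose of
  \<open>Z * W\<close> times \<open>M\<close> is \<open>M * (W * Z)\<close>, the two signs
  cancelling. With \<open>M\<close> as \<open>Jmat n\<close> or the identity, this serves sp and so
  alike.\<close>

lemma bracket_preserves_form:
  fixes M :: "'a::field mat"
  assumes M: "M \<in> carrier_mat n n" and X: "X \<in> carrier_mat n n" and Y: "Y \<in> carrier_mat n n"
    and fX: "transpose_mat X * M + M * X = 0\<^sub>m n n" and fY: "transpose_mat Y * M + M * Y = 0\<^sub>m n n"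
  shows "transpose_mat (X * Y - Y * X) * M + M * (X * Y - Y * X) = 0\<^sub>m n n"
proof -
  have neg: "transpose_mat Z * M = - (M * Z)"
    if Z: "Z \<in> carrier_mat n n" "transpose_mat Z * M + M * Z = 0\<^sub>m n n" for Z
  proof (rule eq_matI)
    fix i j assume "i < dim_row (- (M * Z))" "j < dim_col (- (M * Z))"
    then have ij: "i < n" "j < n" using M Z by auto
    have "(transpose_mat Z * M + M * Z) $$ (i, j) = 0" using ij by (simp add: Z(2))
    then show "(transpose_mat Z * M) $$ (i, j) = (- (M * Z)) $$ (i, j)"
      using ij M Z(1) by (simp add: eq_neg_iff_add_eq_0)
  qed (use M Z in auto)
  have prod: "transpose_mat (Z * W) * M = M * (W * Z)"
    if Z: "Z \<in> carrier_mat n n" "transpose_mat Z * M + M * Z = 0\<^sub>m n n"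
      and W: "W \<in> carrier_mat n n" "transpose_mat W * M + M * W = 0\<^sub>m n n" for Z W
  proof -
    have "transpose_mat (Z * W) * M = transpose_mat W * (transpose_mat Z * M)"
      using M Z(1) W(1) by (simp add: transpose_mult[OF Z(1) W(1)] assoc_mult_mat[of _ n n _ n _ n])
    also have "\<dots> = - (transpose_mat W * M * Z)"
      using M Z(1) W(1) by (simp add: neg[OF Z] assoc_mult_mat[of _ n n _ n _ n])
    also have "\<dots> = M * (W * Z)"
      using M Z(1) W(1) by (simp add: neg[OF W] assoc_mult_mat[of _ n n _ n _ n])
    finally show ?thesis .
  qed
  have XY: "X * Y \<in> carrier_mat n n" "Y * X \<in> carrier_mat n n" using X Y by auto
  have "transpose_mat (X * Y - Y * X) * M = transpose_mat (X * Y) * M - transpose_mat (Y * X) * M"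
    using M XY by (simp add: transpose_minus[OF XY] minus_mult_distrib_mat[of _ n n])
  also have "\<dots> = M * (Y * X) - M * (X * Y)" using prod[OF X fX Y fY] prod[OF Y fY X fX] by simp
  finally have "transpose_mat (X * Y - Y * X) * M = M * (Y * X) - M * (X * Y)" .
  moreover have "M * (X * Y - Y * X) = M * (X * Y) - M * (Y * X)"
    using M XY by (intro mult_minus_distrib_mat)
  moreover have "P - R + (R - P) = 0\<^sub>m n n" if "P \<in> carrier_mat n n" "R \<in> carrier_mat n n" for P R :: "'a mat"
    using that by (intro eq_matI) auto
  ultimately show ?thesis using M XY by simp
qed

lemma spanned_gl_alg:
  "spanned_lie_algebra (gl_alg n :: 'a::field mat set) n
     (\<lambda>ij. mat n n (\<lambda>ab. if ab = ij then 1 else 0)) ({..<n} \<times> {..<n})"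
proof
  fix x :: "'a mat" assume x: "x \<in> gl_alg n"
  show "\<exists>c. \<forall>a<n. \<forall>b<n. x $$ (a, b)
      = (\<Sum>i\<in>{..<n} \<times> {..<n}. c i * mat n n (\<lambda>ab. if ab = i then 1 else 0) $$ (a, b))"
  proof (intro exI[of _ "\<lambda>i. x $$ i"] allI impI)
    fix a b assume ab: "a < n" "b < n"
    have "(\<Sum>i\<in>{..<n} \<times> {..<n}. x $$ i * mat n n (\<lambda>ab. if ab = i then 1 else 0) $$ (a, b))
        = (\<Sum>i\<in>{..<n} \<times> {..<n}. if i = (a, b) then x $$ i else 0)"
      using ab by (intro sum.cong) auto
    then show "x $$ (a, b)
        = (\<Sum>i\<in>{..<n} \<times> {..<n}. x $$ i * mat n n (\<lambda>ab. if ab = i then 1 else 0) $$ (a, b))"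
      using ab by simp
  qed
qed (auto simp: gl_alg_def)

text \<open>\<open>Jmat k\<close> is a signed permutation matrix; \<open>tau\<close> is its index
  involution and \<open>eps\<close> gives its signs.\<close>

definition tau :: "nat \<Rightarrow> nat \<Rightarrow> nat" where "tau k r = (if r < k then r + k else r - k)"

definition eps :: "nat \<Rightarrow> nat \<Rightarrow> 'a::comm_ring_1" where "eps k r = (if r < k then 1 else - 1)"

lemma tau_less: "r < 2 * k \<Longrightarrow> tau k r < 2 * k"
  and tau_tau: "r < 2 * k \<Longrightarrow> tau k (tau k r) = r"
  and eps_tau: "r < 2 * k \<Longrightarrow> eps k (tau k r) = - eps k r"
  and eps_square: "eps k r * eps k r = 1"
  by (auto simp: tau_def eps_def)

lemma tau_eq_iff: "a < 2 * k \<Longrightarrow> b < 2 * k \<Longrightarrow> tau k a = tau k b \<longleftrightarrow> a = b"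
  by (metis tau_tau)

lemma eps_square_left: "eps k r * (eps k r * x) = x"
  by (simp add: eps_square flip: mult.assoc)

lemma Jmat_carrier: "Jmat k \<in> carrier_mat (2 * k) (2 * k)"
  by (simp add: Jmat_def)

lemma Jmat_index:
  "a < 2 * k \<Longrightarrow> b < 2 * k \<Longrightarrow> Jmat k $$ (a, b) = (if b = tau k a then eps k a else 0)"
  by (auto simp: Jmat_def tau_def eps_def)

text \<open>As \<open>Jmat n\<close> is skew, membership means that \<open>Jmat n * X\<close> is
  symmetric; its entry at \<open>(a, b)\<close> is
  \<open>eps n a * X $$ (tau n a, b)\<close>.\<close>

lemma sp_alg_iff:
  "X \<in> sp_alg n \<longleftrightarrow> X \<in> carrier_mat (2 * n) (2 * n) \<and>
     (\<forall>a<2 * n. \<forall>b<2 * n. eps n a * X $$ (tau n a, b) = eps n b * X $$ (tau n b, a))"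
proof (cases "X \<in> carrier_mat (2 * n) (2 * n)")
  case True
  let ?E = "transpose_mat X * Jmat n + Jmat n * X"
  have E: "?E $$ (a, b) = eps n a * X $$ (tau n a, b) - eps n b * X $$ (tau n b, a)"
    if ab: "a < 2 * n" "b < 2 * n" for a b
  proof -
    have XJ: "(transpose_mat X * Jmat n) $$ (a, b) = - eps n b * X $$ (tau n b, a)"
    proof -
      have "(transpose_mat X * Jmat n) $$ (a, b) = (\<Sum>r<2 * n. transpose_mat X $$ (a, r) * Jmat n $$ (r, b))"
        using True ab Jmat_carrier by (intro index_mult_mat_sum) auto
      also have "\<dots> = (\<Sum>r<2 * n. if r = tau n b then - eps n b * X $$ (r, a) else 0)"
        using True ab by (intro sum.cong) (auto simp: Jmat_index tau_tau eps_tau)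
      finally show ?thesis using ab by (simp add: tau_less)
    qed
    have "(Jmat n * X) $$ (a, b) = (\<Sum>r<2 * n. Jmat n $$ (a, r) * X $$ (r, b))"
      using True ab Jmat_carrier by (intro index_mult_mat_sum) auto
    also have "\<dots> = (\<Sum>r<2 * n. if r = tau n a then eps n a * X $$ (r, b) else 0)"
      using ab by (intro sum.cong) (auto simp: Jmat_index)
    finally have JX: "(Jmat n * X) $$ (a, b) = eps n a * X $$ (tau n a, b)"
      using ab by (simp add: tau_less)
    have "?E $$ (a, b) = (transpose_mat X * Jmat n) $$ (a, b) + (Jmat n * X) $$ (a, b)"
      using ab True Jmat_carrier[of n, where 'a = 'a] by (intro index_add_mat) auto
    then show ?thesis by (simp only: XJ JX) simp
  qed
  have "?E = 0\<^sub>m (2 * n) (2 * n) \<longleftrightarrow> (\<forall>a<2 * n. \<forall>b<2 * n. ?E $$ (a, b) = 0)"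
  proof
    assume "\<forall>a<2 * n. \<forall>b<2 * n. ?E $$ (a, b) = 0"
    then show "?E = 0\<^sub>m (2 * n) (2 * n)"
      using True Jmat_carrier[of n, where 'a = 'a] by (intro eq_matI) auto
  qed auto
  then show ?thesis using True by (simp add: sp_alg_def E)
next
  case False
  then show ?thesis by (simp add: sp_alg_def)
qed

lemma so_alg_iff:
  "X \<in> so_alg n \<longleftrightarrow> X \<in> carrier_mat (2 * n) (2 * n) \<and>
     (\<forall>a<2 * n. \<forall>b<2 * n. X $$ (b, a) = - X $$ (a, b))"
proof (cases "X \<in> carrier_mat (2 * n) (2 * n)")
  case True
  let ?E = "transpose_mat X + X"
  have E: "?E $$ (a, b) = X $$ (b, a) + X $$ (a, b)" if "a < 2 * n" "b < 2 * n" for a b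
    using that True by auto
  have "?E = 0\<^sub>m (2 * n) (2 * n) \<longleftrightarrow> (\<forall>a<2 * n. \<forall>b<2 * n. ?E $$ (a, b) = 0)"
  proof
    assume "\<forall>a<2 * n. \<forall>b<2 * n. ?E $$ (a, b) = 0"
    then show "?E = 0\<^sub>m (2 * n) (2 * n)" using True by (intro eq_matI) auto
  qed auto
  then show ?thesis using True by (simp add: so_alg_def E eq_neg_iff_add_eq_0)
next
  case False
  then show ?thesis by (simp add: so_alg_def)
qed

definition upper_pairs :: "nat \<Rightarrow> (nat \<times> nat) set" where
  "upper_pairs d = {(i, j). i \<le> j \<and> j < d}"

definition strict_upper_pairs :: "nat \<Rightarrow> (nat \<times> nat) set" where
  "strict_upper_pairs d = {(i, j). i < j \<and> j < d}"

lemma finite_upper_pairs: "finite (upper_pairs d)" "finite (strict_upper_pairs d)"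
proof -
  have "upper_pairs d \<subseteq> {..<d} \<times> {..<d}" "strict_upper_pairs d \<subseteq> {..<d} \<times> {..<d}"
    by (auto simp: upper_pairs_def strict_upper_pairs_def)
  then show "finite (upper_pairs d)" "finite (strict_upper_pairs d)"
    by (meson finite_SigmaI finite_lessThan finite_subset)+
qed

text \<open>The image of an elementary symmetric matrix \<open>S\<close> under
  \<open>S \<mapsto> - Jmat n * S\<close>, the inverse of \<open>X \<mapsto> Jmat n * X\<close>. The
  disjunction gives diagonal positions of \<open>S\<close> the entry 1 rather than 2.\<close>

definition sp_basis :: "nat \<Rightarrow> nat \<times> nat \<Rightarrow> 'a::comm_ring_1 mat" where
  "sp_basis n ij = mat (2 * n) (2 * n)
     (\<lambda>(a, b). - eps n a * (if (tau n a, b) = ij \<or> (b, tau n a) = ij then 1 else 0))"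

definition so_basis :: "nat \<Rightarrow> nat \<times> nat \<Rightarrow> 'a::comm_ring_1 mat" where
  "so_basis n ij = mat (2 * n) (2 * n)
     (\<lambda>(a, b). (if (a, b) = ij then 1 else 0) - (if (b, a) = ij then 1 else 0))"

lemma spanned_sp_alg:
  "spanned_lie_algebra (sp_alg n :: 'a::field mat set) (2 * n) (sp_basis n) (upper_pairs (2 * n))"
proof
  show "sp_alg n \<subseteq> (carrier_mat (2 * n) (2 * n) :: 'a mat set)" by (auto simp: sp_alg_def)
  show "0\<^sub>m (2 * n) (2 * n) \<in> (sp_alg n :: 'a mat set)"
    by (simp add: sp_alg_iff tau_less)
  show "finite (upper_pairs (2 * n))" by (rule finite_upper_pairs)
  fix x y :: "'a mat" assume x: "x \<in> sp_alg n" and y: "y \<in> sp_alg n"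
  show "x + y \<in> sp_alg n"
    using x y by (auto simp: sp_alg_iff tau_less distrib_left)
  show "x * y - y * x \<in> sp_alg n"
    using x y bracket_preserves_form[OF Jmat_carrier, of x n y] by (auto simp: sp_alg_def)
next
  fix x :: "'a mat" and c assume x: "x \<in> sp_alg n"
  then show "c \<cdot>\<^sub>m x \<in> sp_alg n"
    by (auto simp: sp_alg_iff tau_less mult.left_commute[of _ c])
next
  fix i assume "i \<in> upper_pairs (2 * n)"
  show "sp_basis n i \<in> (sp_alg n :: 'a mat set)"
    by (auto simp: sp_alg_iff sp_basis_def tau_less tau_tau eps_tau eps_square eps_square_left)
next
  fix x :: "'a mat" assume x: "x \<in> sp_alg n"
  define S where "S = (\<lambda>(a, b). eps n a * x $$ (tau n a, b))"
  have sym: "S (a, b) = S (b, a)" if "a < 2 * n" "b < 2 * n" for a b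
    using x that by (auto simp: sp_alg_iff S_def)
  show "\<exists>c. \<forall>a<2 * n. \<forall>b<2 * n. x $$ (a, b) = (\<Sum>i\<in>upper_pairs (2 * n). c i * sp_basis n i $$ (a, b))"
  proof (intro exI[of _ S] allI impI)
    fix a b assume ab: "a < 2 * n" "b < 2 * n"
    define ij where "ij = (if tau n a \<le> b then (tau n a, b) else (b, tau n a))"
    have ij: "ij \<in> upper_pairs (2 * n)" using ab tau_less[of a n] by (auto simp: ij_def upper_pairs_def)
    have "(\<Sum>i\<in>upper_pairs (2 * n). S i * sp_basis n i $$ (a, b))
        = (\<Sum>i\<in>upper_pairs (2 * n). if i = ij then - eps n a * S i else 0)"
      using ab by (intro sum.cong) (auto simp: sp_basis_def ij_def upper_pairs_def)
    also have "\<dots> = - eps n a * S ij" using ij finite_upper_pairs by simp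
    also have "S ij = S (tau n a, b)" using sym[of "tau n a" b] ab by (auto simp: ij_def tau_less)
    also have "- eps n a * \<dots> = x $$ (a, b)"
      using ab by (simp add: S_def tau_tau eps_tau eps_square_left)
    finally show "x $$ (a, b) = (\<Sum>i\<in>upper_pairs (2 * n). S i * sp_basis n i $$ (a, b))" ..
  qed
qed

lemma spanned_so_alg:
  "spanned_lie_algebra (so_alg n :: 'a::field_char_0 mat set) (2 * n) (so_basis n) (strict_upper_pairs (2 * n))"
proof
  show "so_alg n \<subseteq> (carrier_mat (2 * n) (2 * n) :: 'a mat set)" by (auto simp: so_alg_def)
  show "0\<^sub>m (2 * n) (2 * n) \<in> (so_alg n :: 'a mat set)"
    by (simp add: so_alg_iff)
  show "finite (strict_upper_pairs (2 * n))" by (rule finite_upper_pairs)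
  fix x y :: "'a mat" assume x: "x \<in> so_alg n" and y: "y \<in> so_alg n"
  show "x + y \<in> so_alg n"
    unfolding so_alg_iff
  proof (intro conjI allI impI)
    fix a b assume ab: "a < 2 * n" "b < 2 * n"
    have "x $$ (b, a) = - x $$ (a, b)" "y $$ (b, a) = - y $$ (a, b)"
      using x y ab unfolding so_alg_iff by blast+
    moreover have "y \<in> carrier_mat (2 * n) (2 * n)" using y by (simp add: so_alg_def)
    ultimately show "(x + y) $$ (b, a) = - (x + y) $$ (a, b)"
      using ab by auto
  qed (use x y in \<open>simp add: so_alg_def\<close>)
  have so: "z \<in> so_alg n \<longleftrightarrow> z \<in> carrier_mat (2 * n) (2 * n) \<and>
      transpose_mat z * 1\<^sub>m (2 * n) + 1\<^sub>m (2 * n) * z = 0\<^sub>m (2 * n) (2 * n)" for z :: "'a mat"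
    by (auto simp: so_alg_def)
  show "x * y - y * x \<in> so_alg n"
    using x y bracket_preserves_form[OF one_carrier_mat, of x "2 * n" y] unfolding so by auto
next
  fix x :: "'a mat" and c assume x: "x \<in> so_alg n"
  show "c \<cdot>\<^sub>m x \<in> so_alg n"
    unfolding so_alg_iff
  proof (intro conjI allI impI)
    fix a b assume ab: "a < 2 * n" "b < 2 * n"
    have "x $$ (b, a) = - x $$ (a, b)" using x ab unfolding so_alg_iff by blast
    moreover have "x \<in> carrier_mat (2 * n) (2 * n)" using x by (simp add: so_alg_def)
    ultimately show "(c \<cdot>\<^sub>m x) $$ (b, a) = - (c \<cdot>\<^sub>m x) $$ (a, b)"
      using ab by auto
  qed (use x in \<open>simp add: so_alg_def\<close>)
next
  fix i assume "i \<in> strict_upper_pairs (2 * n)"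
  show "so_basis n i \<in> (so_alg n :: 'a mat set)"
    by (auto simp: so_alg_iff so_basis_def)
next
  fix x :: "'a mat" assume x: "x \<in> so_alg n"
  then have anti: "x $$ (b, a) = - x $$ (a, b)" if "a < 2 * n" "b < 2 * n" for a b
    using that unfolding so_alg_iff by blast
  show "\<exists>c. \<forall>a<2 * n. \<forall>b<2 * n. x $$ (a, b) = (\<Sum>i\<in>strict_upper_pairs (2 * n). c i * so_basis n i $$ (a, b))"
  proof (intro exI[of _ "\<lambda>i. x $$ i"] allI impI)
    fix a b assume ab: "a < 2 * n" "b < 2 * n"
    have "(\<Sum>i\<in>strict_upper_pairs (2 * n). x $$ i * so_basis n i $$ (a, b))
        = (\<Sum>i\<in>strict_upper_pairs (2 * n). (if i = (a, b) then x $$ i else 0) - (if i = (b, a) then x $$ i else 0))"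
    proof (rule sum.cong)
      fix i
      have "so_basis n i $$ (a, b) = (if i = (a, b) then 1 else 0) - (if i = (b, a) then (1 :: 'a) else 0)"
        using ab by (simp add: so_basis_def eq_commute[of _ i])
      then show "x $$ i * so_basis n i $$ (a, b) = (if i = (a, b) then x $$ i else 0) - (if i = (b, a) then x $$ i else 0)"
        by (simp only: right_diff_distrib if_distrib[of "(*) (x $$ i)"] mult_1_right mult_zero_right)
    qed simp
    also have "\<dots> = (if a < b then x $$ (a, b) else 0) - (if b < a then x $$ (b, a) else 0)"
      using ab finite_upper_pairs by (simp add: sum_subtractf strict_upper_pairs_def)
    \<comment> \<open>On the diagonal, skewness gives \<open>x $$ (a, a) = - x $$ (a, a)\<close>,
      and characteristic zero makes this entry vanish.\<close>
    also have "\<dots> = x $$ (a, b)"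
      using anti[OF ab] anti[of a a] ab by (cases a b rule: linorder_cases) auto
    finally show "x $$ (a, b) = (\<Sum>i\<in>strict_upper_pairs (2 * n). x $$ i * so_basis n i $$ (a, b))" ..
  qed
qed

theorem phi_iso_of_quadratic_invariants:
  fixes \<iota> :: "'a::field_char_0 mat \<Rightarrow> ('v, 'a) dop" and s :: "'j \<Rightarrow> 'r \<Rightarrow> 'a"
    and \<alpha> \<beta> :: "'j \<Rightarrow> 'r \<Rightarrow> 'v + 'v"
  assumes L: "spanned_lie_algebra L d e I"
    and howe: "howe_embedding L \<iota> Vs DK" and DK: "DK \<subseteq> weyl Vs"
    and J: "finite J" "card I \<le> card J" and R: "finite R"
    and wt: "\<And>v. 0 < wt (Inl v) + (wt (Inr v) :: nat)"
    and Q: "\<And>j. j \<in> J \<Longrightarrow> app (\<Sum>r\<in>R. lscale (s j r) (wgen (\<alpha> j r) * wgen (\<beta> j r))) \<in> DK"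
    and peak: "\<And>j. j \<in> J \<Longrightarrow> peak j \<in> R" "\<And>j. j \<in> J \<Longrightarrow> s j (peak j) \<noteq> 0"
    and dom: "\<And>j r. j \<in> J \<Longrightarrow> r \<in> R \<Longrightarrow> r \<noteq> peak j \<Longrightarrow>
      wt (\<alpha> j r) + wt (\<beta> j r) < wt (\<alpha> j (peak j)) + wt (\<beta> j (peak j))"
    and key: "\<And>j. j \<in> J \<Longrightarrow> key j \<in> {\<alpha> j (peak j), \<beta> j (peak j)}"
    and tri: "\<And>i j. i \<in> J \<Longrightarrow> j \<in> J \<Longrightarrow> i \<noteq> j \<Longrightarrow> key j \<in> {\<alpha> i (peak i), \<beta> i (peak i)} \<Longrightarrow> \<rho> i < (\<rho> j :: nat)"
  shows "phi_iso L \<iota> DK"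
proof -
  let ?Q = "\<lambda>j. \<Sum>r\<in>R. lscale (s j r) (wgen (\<alpha> j r) * wgen (\<beta> j r))"
  obtain lst :: "'j multiset \<Rightarrow> 'j list" where lst: "\<And>\<gamma>. mset (lst \<gamma>) = \<gamma>"
    using ex_mset by metis
  have indep: "lop.indep_family (\<lambda>\<gamma>. prod_list (map ?Q (lst \<gamma>))) {\<gamma>. set_mset \<gamma> \<subseteq> J}"
    by (rule indep_family_quadratic[where wt = wt and R = R and s = s and \<alpha> = \<alpha> and \<beta> = \<beta> and peak = peak
          and key = key and \<rho> = \<rho>]) (use wt J(1) R lst peak dom key tri in auto)
  show ?thesis
    by (rule phi_iso_of_growth[OF L howe DK J _ lst indep]) (rule Q)
qed

section \<open>Case A\<close>

lemma pullA_True: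
  "i < p \<Longrightarrow> r < k \<Longrightarrow> pullA p q k g h (True, i, r) = (\<Sum>l<k. const_poly (h $$ (l, r)) * Xvar (True, i, l))"
  by (auto simp: pullA_def VarsA_def)

lemma pullA_False:
  "j < q \<Longrightarrow> r < k \<Longrightarrow> pullA p q k g h (False, r, j) = (\<Sum>l<k. const_poly (g $$ (r, l)) * Xvar (False, l, j))"
  by (auto simp: pullA_def VarsA_def)

lemma GL_pairs_sums:
  assumes "(g, h) \<in> GL_pairs k" "l < k" "m < k"
  shows "(\<Sum>r<k. g $$ (l, r) * h $$ (r, m)) = (if l = m then 1 else 0)"
    and "(\<Sum>r<k. h $$ (l, r) * g $$ (r, m)) = (if l = m then 1 else 0)"
proof -
  have gh: "g \<in> carrier_mat k k" "h \<in> carrier_mat k k" "g * h = 1\<^sub>m k" "h * g = 1\<^sub>m k"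
    using assms(1) by (auto simp: GL_pairs_def)
  show "(\<Sum>r<k. g $$ (l, r) * h $$ (r, m)) = (if l = m then 1 else 0)"
    using index_mult_mat_sum[OF gh(1,2) assms(2,3)] assms(2,3) by (simp add: gh(3))
  show "(\<Sum>r<k. h $$ (l, r) * g $$ (r, m)) = (if l = m then 1 else 0)"
    using index_mult_mat_sum[OF gh(2,1) assms(2,3)] assms(2,3) by (simp add: gh(4))
qed

context
  fixes p q k :: nat
begin

text \<open>The rows of \<open>a\<close> and of \<open>\<partial>/\<partial>b\<close> are \<open>p + q\<close> copies of the dual standard
  representation; the columns of \<open>\<partial>/\<partial>a\<close> and of \<open>b\<close> are \<open>p + q\<close> copies of the standard one.\<close>
definition covA :: "nat \<Rightarrow> nat \<Rightarrow> (bool \<times> nat \<times> nat) + (bool \<times> nat \<times> nat)" where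
  "covA i r = (if i < p then Inl (True, i, r) else Inr (False, r, i - p))"

definition vecA :: "nat \<Rightarrow> nat \<Rightarrow> (bool \<times> nat \<times> nat) + (bool \<times> nat \<times> nat)" where
  "vecA j r = (if j < p then Inr (True, j, r) else Inl (False, r, j - p))"

text \<open>Every component of a covector gets weight 1; component \<open>r\<close> of vector
  \<open>j\<close> gets weight 1 if \<open>r = j\<close> and 0 otherwise. The shift by
  \<open>p\<close> translates column numbers of \<open>b\<close> back into vector numbers.\<close>

definition wtA :: "(bool \<times> nat \<times> nat) + (bool \<times> nat \<times> nat) \<Rightarrow> nat" where
  "wtA x = (case x of
      Inl (b, i, r) \<Rightarrow> (if b \<or> i = r + p then 1 else 0)
    | Inr (b, i, r) \<Rightarrow> (if \<not> b \<or> i = r then 1 else 0))"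

lemma pullback_covA:
  fixes g h :: "'a::field mat"
  assumes gh: "(g, h) \<in> GL_pairs k" and i: "i < p + q" and r: "r < k"
  shows "pullback (pullA p q k g h) * wgen (covA i r)
    = (\<Sum>l<k. lscale (h $$ (l, r)) (wgen (covA i l) * pullback (pullA p q k g h)))"
proof (cases "i < p")
  case True
  have "pullback (pullA p q k g h) * wgen (Inl (True, i, r))
    = (\<Sum>l<k. lscale (h $$ (l, r)) (wgen (Inl (True, i, l)) * pullback (pullA p q k g h)))"
    by (rule pullback_Xvar) (rule pullA_True[OF True r])
  then show ?thesis using True by (simp add: covA_def)
next
  case False
  then have ip: "i - p < q" using i by auto
  have "pullback (pullA p q k g h) * wgen (Inr (False, r, i - p))
    = (\<Sum>l<k. lscale (h $$ (l, r)) (wgen (Inr (False, l, i - p)) * pullback (pullA p q k g h)))"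
  proof (rule pullback_dX[where S = "\<lambda>r l. g $$ (r, l)" and x = "\<lambda>r. (False, r, i - p)"])
    fix r w assume "r < k" "w \<notin> (\<lambda>r. (False, r, i - p)) ` {..<k}"
    then show "dX (False, r, i - p) (pullA p q k g h w) = 0"
      by (cases w) (auto simp: pullA_def dX_sum dX_mult dX_Xvar VarsA_def intro!: sum.neutral)
  qed (use ip r GL_pairs_sums[OF gh] in \<open>auto simp: pullA_False\<close>)
  then show ?thesis using False by (simp add: covA_def)
qed

lemma pullback_vecA:
  fixes g h :: "'a::field mat"
  assumes gh: "(g, h) \<in> GL_pairs k" and j: "j < p + q" and r: "r < k"
  shows "pullback (pullA p q k g h) * wgen (vecA j r)
    = (\<Sum>l<k. lscale (g $$ (r, l)) (wgen (vecA j l) * pullback (pullA p q k g h)))"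
proof (cases "j < p")
  case True
  have "pullback (pullA p q k g h) * wgen (Inr (True, j, r))
    = (\<Sum>l<k. lscale (g $$ (r, l)) (wgen (Inr (True, j, l)) * pullback (pullA p q k g h)))"
  proof (rule pullback_dX[where S = "\<lambda>r l. h $$ (l, r)" and x = "\<lambda>r. (True, j, r)" and h = "\<lambda>l r. g $$ (r, l)"])
    fix r w assume "r < k" "w \<notin> (\<lambda>r. (True, j, r)) ` {..<k}"
    then show "dX (True, j, r) (pullA p q k g h w) = 0"
      by (cases w) (auto simp: pullA_def dX_sum dX_mult dX_Xvar VarsA_def intro!: sum.neutral)
  next
    fix l m assume "l < k" "m < k"
    then show "(\<Sum>r<k. h $$ (r, l) * g $$ (m, r)) = (if l = m then 1 else 0)"
      using GL_pairs_sums(1)[OF gh, of m l] by (simp add: mult.commute)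
  qed (use True r in \<open>auto simp: pullA_True\<close>)
  then show ?thesis using True by (simp add: vecA_def)
next
  case False
  then have jp: "j - p < q" using j by auto
  have "pullback (pullA p q k g h) * wgen (Inl (False, r, j - p))
    = (\<Sum>l<k. lscale (g $$ (r, l)) (wgen (Inl (False, l, j - p)) * pullback (pullA p q k g h)))"
    by (rule pullback_Xvar) (rule pullA_False[OF jp r])
  then show ?thesis using False by (simp add: vecA_def)
qed

text \<open>In the pairing of covector \<open>i\<close> with vector \<open>j\<close>, only the term
  at \<open>r = j\<close> reaches weight 2, and \<open>j < p + q \<le> k\<close> makes it available.
  Its letter \<open>covA i j\<close> determines both indices, so no key occurs in another leading
  monomial and \<rho> can be constant.\<close>

lemma phi_iso_case_A:
  fixes \<iota> :: "'a::field_char_0 mat \<Rightarrow> (bool \<times> nat \<times> nat, 'a) dop"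
  assumes k: "p + q \<le> k" and howe: "howe_embedding (gl_alg (p + q)) \<iota> (VarsA p q k) (DK_A p q k)"
  shows "phi_iso (gl_alg (p + q)) \<iota> (DK_A p q k)"
proof (rule phi_iso_of_quadratic_invariants[where J = "{..<p + q} \<times> {..<p + q}" and R = "{..<k}"
      and wt = wtA and s = "\<lambda>_ _. 1" and \<alpha> = "\<lambda>(i, j). covA i" and \<beta> = "\<lambda>(i, j). vecA j"
      and key = "\<lambda>(i, j). covA i j" and peak = snd and \<rho> = "\<lambda>_. 0", OF spanned_gl_alg howe])
  fix ij assume "ij \<in> {..<p + q} \<times> {..<p + q}"
  then obtain i j where ij: "ij = (i, j)" "i < p + q" "j < p + q" by auto
  have "app (\<Sum>r<k. lscale 1 (wgen (covA i r) * wgen (vecA j r)) :: (_, 'a) lop) \<in> DK_A p q k"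
    unfolding DK_A_def
  proof (rule app_in_invariant_ops)
    show "app (\<Sum>r<k. lscale 1 (wgen (covA i r) * wgen (vecA j r)) :: (_, 'a) lop) \<in> weyl (VarsA p q k)"
      using ij by (intro app_quadratic_in_weyl) (auto simp: covA_def vecA_def VarsA_def)
    fix \<sigma> :: "_ \<Rightarrow> (_, 'a) mpoly"
    assume "\<sigma> \<in> {pullA p q k g h | g h. (g, h) \<in> GL_pairs k}"
    then obtain g h where gh: "(g, h) \<in> GL_pairs k" and \<sigma>: "\<sigma> = pullA p q k g h" by blast
    show "pullback \<sigma> * (\<Sum>r<k. lscale 1 (wgen (covA i r) * wgen (vecA j r)))
        = (\<Sum>r<k. lscale 1 (wgen (covA i r) * wgen (vecA j r))) * pullback \<sigma>"
      unfolding \<sigma>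
      by (rule quadratic_invariant[where \<tau> = id and \<beta> = "\<lambda>_. 1", simplified id_apply,
            OF pullback_covA[OF gh ij(2)] pullback_vecA[OF gh ij(3)]])
        (use GL_pairs_sums(2)[OF gh] in auto)
  qed
  then show "app (\<Sum>r<k. lscale 1 (wgen ((case ij of (i, j) \<Rightarrow> covA i) r)
      * wgen ((case ij of (i, j) \<Rightarrow> vecA j) r)) :: (_, 'a) lop) \<in> DK_A p q k"
    by (simp add: ij(1))
next
  show "DK_A p q k \<subseteq> (weyl (VarsA p q k) :: (_, 'a) dop set)"
    by (auto simp: DK_A_def invariant_ops_def)
  show "0 < wtA (Inl v) + wtA (Inr v)" for v
    by (cases v) (auto simp: wtA_def)
qed (use k in \<open>auto simp: wtA_def covA_def vecA_def split: if_splits\<close>)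

end

section \<open>Cases B and C\<close>

lemma pullM_Var:
  "r < k \<Longrightarrow> j < n \<Longrightarrow> pullM k n g (r, j) = (\<Sum>l<k. const_poly (g $$ (r, l)) * Xvar (l, j))"
  by (auto simp: pullM_def VarsM_def)

lemma pullback_pullM_Xvar:
  "r < k \<Longrightarrow> j < n \<Longrightarrow> pullback (pullM k n g) * wgen (Inl (r, j))
     = (\<Sum>l<k. lscale (g $$ (r, l)) (wgen (Inl (l, j)) * pullback (pullM k n g)))"
  by (rule pullback_Xvar) (rule pullM_Var)

lemma pullback_pullM_dX:
  fixes g :: "'a::field mat"
  assumes r: "r < k" and j: "j < n"
    and h: "\<And>l m. l < k \<Longrightarrow> m < k \<Longrightarrow> (\<Sum>r<k. g $$ (l, r) * h r m) = (if l = m then 1 else 0)"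
  shows "pullback (pullM k n g) * wgen (Inr (r, j))
     = (\<Sum>l<k. lscale (h l r) (wgen (Inr (l, j)) * pullback (pullM k n g)))"
proof (rule pullback_dX[where S = "\<lambda>r l. g $$ (r, l)" and x = "\<lambda>r. (r, j)"])
  fix r w assume "r < k" "w \<notin> (\<lambda>r. (r, j)) ` {..<k}"
  then show "dX (r, j) (pullM k n g w) = 0"
    by (cases w) (auto simp: pullM_def dX_sum dX_mult dX_Xvar VarsM_def intro!: sum.neutral)
qed (use assms in \<open>auto simp: pullM_Var\<close>)

section \<open>Case B: the orthogonal group\<close>

lemma O_grp_sums:
  fixes g :: "'a::field mat"
  assumes "g \<in> O_grp k" "l < k" "m < k"
  shows "(\<Sum>r<k. g $$ (r, l) * g $$ (r, m)) = (if l = m then 1 else 0)"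
    and "(\<Sum>r<k. g $$ (l, r) * g $$ (m, r)) = (if l = m then 1 else 0)"
proof -
  have g: "g \<in> carrier_mat k k" "transpose_mat g \<in> carrier_mat k k" "transpose_mat g * g = 1\<^sub>m k"
    using assms(1) by (auto simp: O_grp_def)
  have "g * transpose_mat g = 1\<^sub>m k" using mat_mult_left_right_inverse[OF g(2,1,3)] .
  then show "(\<Sum>r<k. g $$ (l, r) * g $$ (m, r)) = (if l = m then 1 else 0)"
    using index_mult_mat_sum[OF g(1,2) assms(2,3)] g(1) assms(2,3) by simp
  show "(\<Sum>r<k. g $$ (r, l) * g $$ (r, m)) = (if l = m then 1 else 0)"
    using index_mult_mat_sum[OF g(2,1) assms(2,3)] g(1) assms(2,3) by (simp add: g(3))
qed

text \<open>Together, the columns of \<open>a\<close> (even indices) and of \<open>\<partial>/\<partial>a\<close> (odd indices) are \<open>2 n\<close> copies of the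
  standard representation.\<close>
definition vecB :: "nat \<Rightarrow> nat \<Rightarrow> (nat \<times> nat) + (nat \<times> nat)" where
  "vecB i r = (if even i then Inl (r, i div 2) else Inr (r, i div 2))"

lemma vecB_eq_iff: "vecB i r = vecB j s \<longleftrightarrow> i = j \<and> r = s"
proof
  assume "vecB i r = vecB j s"
  then have "r = s" "i div 2 = j div 2" "even i \<longleftrightarrow> even j" by (auto simp: vecB_def split: if_splits)
  then show "i = j \<and> r = s" by (metis bit_eq_rec)
qed simp

text \<open>These weights make the lower triangular part of the matrix of all vectors dominant, so that the
  Gram matrix degenerates to its Cholesky leading terms.\<close>
definition levB :: "nat \<Rightarrow> nat \<Rightarrow> nat" where
  "levB i r = (if r = i then 3 else if r < i then 2 else 1)"

definition wtB :: "(nat \<times> nat) + (nat \<times> nat) \<Rightarrow> nat" where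
  "wtB x = (case x of Inl (r, j) \<Rightarrow> levB (2 * j) r | Inr (r, j) \<Rightarrow> levB (2 * j + 1) r)"

lemma wtB_vecB: "wtB (vecB i r) = levB i r"
  by (auto simp: wtB_def vecB_def)

lemma pullback_vecB:
  fixes g :: "'a::field mat"
  assumes g: "g \<in> O_grp k" and i: "i < 2 * n" and r: "r < k"
  shows "pullback (pullM k n g) * wgen (vecB i r)
    = (\<Sum>l<k. lscale (g $$ (r, l)) (wgen (vecB i l) * pullback (pullM k n g)))"
proof -
  have i2: "i div 2 < n" using i by auto
  show ?thesis
    using pullback_pullM_Xvar[OF r i2, of g]
      pullback_pullM_dX[OF r i2, of g "\<lambda>l r. g $$ (r, l)"] O_grp_sums(2)[OF g]
    by (auto simp: vecB_def)
qed

text \<open>For \<open>i \<le> j\<close> the pairing of vectors \<open>i\<close> and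
  \<open>j\<close> peaks at coordinate \<open>i\<close>, with weight 6 if \<open>i = j\<close> and 5
  otherwise, against at most 4 elsewhere; \<open>n \<le> k div 2\<close> gives
  \<open>2 * n \<le> k\<close>, so this coordinate exists. An off-diagonal letter
  \<open>vecB j i\<close> occurs in one leading monomial only, while \<open>vecB i i\<close> occurs
  in those of all pairs \<open>(i, j)\<close>. Diagonal multiplicities are therefore read off last,
  which \<rho> records.\<close>

lemma phi_iso_case_B:
  fixes \<iota> :: "'a::field_char_0 mat \<Rightarrow> (nat \<times> nat, 'a) dop"
  assumes n: "n \<le> k div 2" and howe: "howe_embedding (sp_alg n) \<iota> (VarsM k n) (DK_B k n)"
  shows "phi_iso (sp_alg n) \<iota> (DK_B k n)"
proof (rule phi_iso_of_quadratic_invariants[where J = "upper_pairs (2 * n)" and R = "{..<k}"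
      and wt = wtB and s = "\<lambda>_ _. 1" and \<alpha> = "\<lambda>(i, j). vecB i" and \<beta> = "\<lambda>(i, j). vecB j"
      and key = "\<lambda>(i, j). vecB j i" and peak = fst and \<rho> = "\<lambda>(i, j). if i = j then 1 else 0",
      OF spanned_sp_alg howe])
  fix ij assume "ij \<in> upper_pairs (2 * n)"
  then obtain i j where ij: "ij = (i, j)" "i < 2 * n" "j < 2 * n" by (auto simp: upper_pairs_def)
  have "app (\<Sum>r<k. lscale 1 (wgen (vecB i r) * wgen (vecB j r)) :: (_, 'a) lop) \<in> DK_B k n"
    unfolding DK_B_def
  proof (rule app_in_invariant_ops)
    show "app (\<Sum>r<k. lscale 1 (wgen (vecB i r) * wgen (vecB j r)) :: (_, 'a) lop) \<in> weyl (VarsM k n)"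
      using ij by (intro app_quadratic_in_weyl) (auto simp: vecB_def VarsM_def)
    fix \<sigma> :: "_ \<Rightarrow> (_, 'a) mpoly"
    assume "\<sigma> \<in> pullM k n ` O_grp k"
    then obtain g where g: "g \<in> O_grp k" and \<sigma>: "\<sigma> = pullM k n g" by blast
    show "pullback \<sigma> * (\<Sum>r<k. lscale 1 (wgen (vecB i r) * wgen (vecB j r)))
        = (\<Sum>r<k. lscale 1 (wgen (vecB i r) * wgen (vecB j r))) * pullback \<sigma>"
      unfolding \<sigma>
      by (rule quadratic_invariant[where \<tau> = id and \<beta> = "\<lambda>_. 1", simplified id_apply,
            OF pullback_vecB[OF g ij(2)] pullback_vecB[OF g ij(3)]])
        (use O_grp_sums(1)[OF g] in auto)
  qed
  then show "app (\<Sum>r<k. lscale 1 (wgen ((case ij of (i, j) \<Rightarrow> vecB i) r)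
      * wgen ((case ij of (i, j) \<Rightarrow> vecB j) r)) :: (_, 'a) lop) \<in> DK_B k n"
    by (simp add: ij(1))
next
  show "DK_B k n \<subseteq> (weyl (VarsM k n) :: (_, 'a) dop set)"
    by (auto simp: DK_B_def invariant_ops_def)
  show "0 < wtB (Inl v) + wtB (Inr v)" for v
    by (cases v) (auto simp: wtB_def levB_def)
  show "finite (upper_pairs (2 * n))" by (rule finite_upper_pairs)
qed (use n in \<open>auto simp: wtB_vecB levB_def vecB_eq_iff upper_pairs_def split: if_splits\<close>)

section \<open>Case C: the symplectic group\<close>

lemma Sp_grp_sums:
  fixes g :: "'a::field mat"
  assumes "g \<in> Sp_grp k" "l < 2 * k" "m < 2 * k"
  shows "(\<Sum>r<2 * k. eps k r * (g $$ (r, l) * g $$ (tau k r, m))) = (if m = tau k l then eps k l else 0)"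
    and "(\<Sum>r<2 * k. g $$ (l, r) * (eps k r * eps k m * g $$ (tau k m, tau k r))) = (if l = m then 1 else 0)"
proof -
  let ?d = "2 * k"
  have g: "g \<in> carrier_mat ?d ?d" "transpose_mat g \<in> carrier_mat ?d ?d"
    and J: "transpose_mat g * Jmat k * g = Jmat k"
    using assms(1) by (auto simp: Sp_grp_def)
  have form: "(\<Sum>r<?d. eps k r * (g $$ (r, l) * g $$ (tau k r, m))) = (if m = tau k l then eps k l else 0)"
    if lm: "l < ?d" "m < ?d" for l m
  proof -
    have "(if m = tau k l then eps k l else 0) = (transpose_mat g * Jmat k * g) $$ (l, m)"
      using lm by (simp add: J Jmat_index)
    also have "\<dots> = (\<Sum>t<?d. (transpose_mat g * Jmat k) $$ (l, t) * g $$ (t, m))"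
      using g lm by (intro index_mult_mat_sum mult_carrier_mat[OF _ Jmat_carrier]) auto
    also have "\<dots> = (\<Sum>t<?d. \<Sum>r<?d. g $$ (r, l) * Jmat k $$ (r, t) * g $$ (t, m))"
    proof (intro sum.cong refl)
      fix t assume "t \<in> {..<?d}"
      then have "(transpose_mat g * Jmat k) $$ (l, t) = (\<Sum>r<?d. transpose_mat g $$ (l, r) * Jmat k $$ (r, t))"
        using g lm Jmat_carrier by (intro index_mult_mat_sum) auto
      also have "\<dots> = (\<Sum>r<?d. g $$ (r, l) * Jmat k $$ (r, t))"
        using g lm by (intro sum.cong) auto
      finally show "(transpose_mat g * Jmat k) $$ (l, t) * g $$ (t, m)
          = (\<Sum>r<?d. g $$ (r, l) * Jmat k $$ (r, t) * g $$ (t, m))"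
        by (simp add: sum_distrib_right)
    qed
    also have "\<dots> = (\<Sum>r<?d. \<Sum>t<?d. g $$ (r, l) * Jmat k $$ (r, t) * g $$ (t, m))"
      by (rule sum.swap)
    also have "\<dots> = (\<Sum>r<?d. \<Sum>t<?d. if t = tau k r then eps k r * (g $$ (r, l) * g $$ (t, m)) else 0)"
      by (intro sum.cong refl) (auto simp: Jmat_index)
    also have "\<dots> = (\<Sum>r<?d. eps k r * (g $$ (r, l) * g $$ (tau k r, m)))"
      by (intro sum.cong refl) (simp add: tau_less)
    finally show ?thesis ..
  qed
  then show "(\<Sum>r<?d. eps k r * (g $$ (r, l) * g $$ (tau k r, m))) = (if m = tau k l then eps k l else 0)"
    using assms(2,3) .
  \<comment> \<open>The inverse of \<open>g\<close>, found as \<open>J^-1 g^T J\<close> and written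
    out by entries. It is checked as a left inverse, which for square matrices is also a right
    inverse.\<close>
  define h where "h = mat ?d ?d (\<lambda>(a, b). eps k a * eps k b * g $$ (tau k b, tau k a))"
  have h: "h \<in> carrier_mat ?d ?d" by (simp add: h_def)
  have "h * g = 1\<^sub>m ?d"
  proof (rule eq_matI)
    fix a b assume "a < dim_row (1\<^sub>m ?d :: 'a mat)" "b < dim_col (1\<^sub>m ?d :: 'a mat)"
    then have ab: "a < ?d" "b < ?d" by auto
    have "(h * g) $$ (a, b) = (\<Sum>r<?d. h $$ (a, r) * g $$ (r, b))"
      using h g ab by (intro index_mult_mat_sum) auto
    also have "\<dots> = eps k a * (\<Sum>r<?d. eps k r * (g $$ (r, b) * g $$ (tau k r, tau k a)))"
      using ab unfolding sum_distrib_left by (intro sum.cong) (auto simp: h_def mult_ac)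
    also have "\<dots> = (1\<^sub>m ?d :: 'a mat) $$ (a, b)"
      using ab by (simp add: form tau_less tau_eq_iff eps_square)
    finally show "(h * g) $$ (a, b) = (1\<^sub>m ?d :: 'a mat) $$ (a, b)" .
  qed (use h g in auto)
  then have "g * h = 1\<^sub>m ?d" by (rule mat_mult_left_right_inverse[OF h g(1)])
  then have "(\<Sum>r<?d. g $$ (l, r) * h $$ (r, m)) = (if l = m then 1 else 0)"
    using index_mult_mat_sum[OF g(1) h assms(2,3)] assms(2,3) by simp
  then show "(\<Sum>r<?d. g $$ (l, r) * (eps k r * eps k m * g $$ (tau k m, tau k r))) = (if l = m then 1 else 0)"
    using assms(3) by (simp add: h_def)
qed

context
  fixes k :: nat
begin

text \<open>The symplectic analogue of \<open>vecB\<close>: the odd vectors are the columns of \<open>J \<partial>/\<partial>a\<close>, whose signs are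
  recorded in \<open>sgnC\<close>. The vector with index \<open>i\<close> is paired off with the coordinate \<open>diagC i\<close>,
  even and odd vectors of a block \<open>i div 2\<close> with dual coordinates.\<close>
definition vecC :: "nat \<Rightarrow> nat \<Rightarrow> (nat \<times> nat) + (nat \<times> nat)" where
  "vecC i r = (if even i then Inl (r, i div 2) else Inr (tau k r, i div 2))"

definition sgnC :: "nat \<Rightarrow> nat \<Rightarrow> 'a::comm_ring_1" where
  "sgnC i r = (if even i then 1 else eps k r)"

definition diagC :: "nat \<Rightarrow> nat" where
  "diagC i = (if even i then i div 2 else i div 2 + k)"

text \<open>The number of the hyperbolic plane that contains the coordinate
  \<open>r\<close>.\<close>

definition blockC :: "nat \<Rightarrow> nat" where
  "blockC r = (if r < k then r else r - k)"

text \<open>The block version of \<open>levB\<close>: the own coordinate counts 3, other coordinates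
  in earlier blocks 2, all else 1. The dual of the own coordinate is among the latter, which
  separates the two coordinates of a block.\<close>

definition levC :: "nat \<Rightarrow> nat \<Rightarrow> nat" where
  "levC i r = (if r = diagC i then 3 else if blockC r < i div 2 then 2 else 1)"

definition wtC :: "(nat \<times> nat) + (nat \<times> nat) \<Rightarrow> nat" where
  "wtC x = (case x of Inl (r, j) \<Rightarrow> levC (2 * j) r | Inr (r, j) \<Rightarrow> levC (2 * j + 1) (tau k r))"

lemma vecC_eq_iff:
  assumes "r < 2 * k" "s < 2 * k"
  shows "vecC i r = vecC j s \<longleftrightarrow> i = j \<and> r = s"
proof
  assume "vecC i r = vecC j s"
  then have "r = s" "i div 2 = j div 2" "even i \<longleftrightarrow> even j"
    using assms by (auto simp: vecC_def tau_eq_iff split: if_splits)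
  then show "i = j \<and> r = s" by (metis bit_eq_rec)
qed simp

lemma wtC_vecC: "r < 2 * k \<Longrightarrow> wtC (vecC i r) = levC i r"
  by (auto simp: wtC_def vecC_def tau_tau)

lemma diagC_less: "i < 2 * k \<Longrightarrow> diagC i < 2 * k"
  by (auto simp: diagC_def)

lemma blockC_diagC: "i < 2 * k \<Longrightarrow> blockC (diagC i) = i div 2"
  by (auto simp: diagC_def blockC_def)

lemma blockC_tau: "r < 2 * k \<Longrightarrow> blockC (tau k r) = blockC r"
  by (auto simp: tau_def blockC_def)

lemma diagC_eq_iff:
  assumes "i < 2 * k" "j < 2 * k"
  shows "diagC i = diagC j \<longleftrightarrow> i = j"
proof
  assume "diagC i = diagC j"
  then have "i div 2 = j div 2" "even i \<longleftrightarrow> even j"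
    using assms by (auto simp: diagC_def split: if_splits)
  then show "i = j" by (metis bit_eq_rec)
qed simp

lemma tau_diagC_eq_iff:
  assumes "i < j" "j < 2 * k"
  shows "tau k (diagC i) = diagC j \<longleftrightarrow> i div 2 = j div 2"
proof
  assume "tau k (diagC i) = diagC j"
  then show "i div 2 = j div 2"
    using assms blockC_tau[OF diagC_less, of i] blockC_diagC[of i] blockC_diagC[of j] by simp
next
  assume eq: "i div 2 = j div 2"
  then have "even i" "odd j" using assms(1) by presburger+
  then show "tau k (diagC i) = diagC j" using eq assms by (auto simp: diagC_def tau_def)
qed

text \<open>Inside a block the peak is 3 + 3, the absolute maximum. Across blocks it is 3 + 2, and a
  competitor reaches at most 4: either both levels are at most 2, or vector \<open>j\<close> is at
  its own coordinate, in a later block, where vector \<open>i\<close> has level 1.\<close>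

lemma levC_dominant:
  assumes ij: "i < j" "j < 2 * k" and r: "r < 2 * k" "r \<noteq> diagC i"
  shows "levC i r + levC j (tau k r) < levC i (diagC i) + levC j (tau k (diagC i))"
proof (cases "i div 2 = j div 2")
  case True
  then have "levC j (tau k (diagC i)) = 3"
    using tau_diagC_eq_iff[OF ij] by (simp add: levC_def)
  then show ?thesis using r(2) by (auto simp: levC_def)
next
  case False
  then have less: "i div 2 < j div 2" using ij(1) by (simp add: div_le_mono le_neq_implies_less)
  have lev: "levC j (tau k (diagC i)) = 2"
    using False less tau_diagC_eq_iff[OF ij] ij blockC_tau[OF diagC_less, of i] blockC_diagC[of i]
    by (simp add: levC_def)
  show ?thesis
  proof (cases "tau k r = diagC j")
    case True
    then have "blockC r = j div 2" using blockC_tau[OF r(1)] blockC_diagC[OF ij(2)] by simp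
    then have "levC i r = 1" using r(2) less by (simp add: levC_def)
    then show ?thesis using lev by (simp add: levC_def)
  next
    case False
    then have "levC j (tau k r) \<le> 2" by (simp add: levC_def)
    moreover have "levC i r \<le> 2" using r(2) by (simp add: levC_def)
    moreover have "levC i (diagC i) = 3" by (simp add: levC_def)
    ultimately show ?thesis using lev by linarith
  qed
qed

text \<open>For symplectic \<open>g\<close> the inverse transpose is the conjugate of
  \<open>g\<close> by \<open>Jmat k\<close>. Derivatives twisted by \<open>tau\<close> and
  \<open>eps\<close> therefore transform like the columns of \<open>a\<close>.\<close>

lemma pullback_vecC:
  fixes g :: "'a::field mat"
  assumes g: "g \<in> Sp_grp k" and i: "i < 2 * n" and r: "r < 2 * k"
  shows "pullback (pullM (2 * k) n g) * lscale (sgnC i r) (wgen (vecC i r))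
    = (\<Sum>l<2 * k. lscale (g $$ (r, l)) (lscale (sgnC i l) (wgen (vecC i l)) * pullback (pullM (2 * k) n g)))"
proof -
  let ?T = "pullback (pullM (2 * k) n g)"
  have i2: "i div 2 < n" using i by auto
  show ?thesis
  proof (cases "even i")
    case True
    then show ?thesis
      using pullback_pullM_Xvar[OF r i2, of g] by (simp add: vecC_def sgnC_def)
  next
    case False
    have "?T * wgen (Inr (tau k r, i div 2))
        = (\<Sum>l<2 * k. lscale (eps k l * eps k (tau k r) * g $$ (r, tau k l)) (wgen (Inr (l, i div 2)) * ?T))"
      using pullback_pullM_dX[OF tau_less[OF r] i2, of g "\<lambda>l m. eps k l * eps k m * g $$ (tau k m, tau k l)"]
        Sp_grp_sums(2)[OF g] r by (simp add: tau_tau)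
    \<comment> \<open>Relabelling the sum by the involution \<open>tau\<close> restores the twisted
      index of the derivatives.\<close>
    also have "\<dots> = (\<Sum>l<2 * k. lscale (eps k (tau k l) * eps k (tau k r) * g $$ (r, l)) (wgen (Inr (tau k l, i div 2)) * ?T))"
      by (rule sum.reindex_bij_witness[of _ "tau k" "tau k"]) (auto simp: tau_tau tau_less)
    also have "\<dots> = (\<Sum>l<2 * k. lscale (eps k l * eps k r * g $$ (r, l)) (wgen (Inr (tau k l, i div 2)) * ?T))"
      using r by (intro sum.cong refl) (simp add: eps_tau)
    finally have "?T * lscale (eps k r) (wgen (Inr (tau k r, i div 2)))
        = lscale (eps k r) (\<Sum>l<2 * k. lscale (eps k l * eps k r * g $$ (r, l)) (wgen (Inr (tau k l, i div 2)) * ?T))"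
      by (simp only: lop.scale_mult_right)
    also have "\<dots> = (\<Sum>l<2 * k. lscale (g $$ (r, l)) (lscale (eps k l) (wgen (Inr (tau k l, i div 2))) * ?T))"
      unfolding lop.scale_sum_right
      by (intro sum.cong refl) (simp add: lop.scale_mult_left mult_ac eps_square_left)
    finally show ?thesis using False by (simp add: vecC_def sgnC_def)
  qed
qed

text \<open>The leading monomial for \<open>i < j\<close> consists of
  \<open>vecC i (diagC i)\<close> and \<open>vecC j (tau k (diagC i))\<close>, the latter being the
  key. For \<open>i\<close> and \<open>j\<close> in one block the key is vector \<open>j\<close> at
  its own coordinate and recurs in the leading monomials of the pairs starting with
  \<open>j\<close>; \<rho> lets these be read off before.\<close>

lemma phi_iso_case_C:
  fixes \<iota> :: "'a::field_char_0 mat \<Rightarrow> (nat \<times> nat, 'a) dop"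
  assumes n: "n \<le> k" and howe: "howe_embedding (so_alg n) \<iota> (VarsM (2 * k) n) (DK_C k n)"
  shows "phi_iso (so_alg n) \<iota> (DK_C k n)"
proof (rule phi_iso_of_quadratic_invariants[where J = "strict_upper_pairs (2 * n)" and R = "{..<2 * k}"
      and wt = wtC and s = "\<lambda>(i, j) r. eps k r * (sgnC i r * sgnC j (tau k r))"
      and \<alpha> = "\<lambda>(i, j). vecC i" and \<beta> = "\<lambda>(i, j) r. vecC j (tau k r)"
      and key = "\<lambda>(i, j). vecC j (tau k (diagC i))" and peak = "\<lambda>(i, j). diagC i"
      and \<rho> = "\<lambda>(i, j). if i div 2 = j div 2 then 1 else 0",
      OF spanned_so_alg howe])
  fix ij assume "ij \<in> strict_upper_pairs (2 * n)"
  then obtain i j where ij: "ij = (i, j)" "i < 2 * n" "j < 2 * n" "i < j"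
    by (auto simp: strict_upper_pairs_def)
  let ?Q = "\<Sum>r<2 * k. lscale (eps k r * (sgnC i r * sgnC j (tau k r))) (wgen (vecC i r) * wgen (vecC j (tau k r))) :: (_, 'a) lop"
  have Q: "?Q = (\<Sum>r<2 * k. lscale (eps k r)
      (lscale (sgnC i r) (wgen (vecC i r)) * lscale (sgnC j (tau k r)) (wgen (vecC j (tau k r)))))"
    by (simp add: lop.scale_mult_left lop.scale_mult_right mult_ac)
  have "app ?Q \<in> DK_C k n"
    unfolding DK_C_def
  proof (rule app_in_invariant_ops)
    show "app ?Q \<in> weyl (VarsM (2 * k) n)"
      using ij by (intro app_quadratic_in_weyl) (auto simp: vecC_def VarsM_def tau_less tau_tau)
    fix \<sigma> :: "_ \<Rightarrow> (_, 'a) mpoly"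
    assume "\<sigma> \<in> pullM (2 * k) n ` Sp_grp k"
    then obtain g where g: "g \<in> Sp_grp k" and \<sigma>: "\<sigma> = pullM (2 * k) n g" by blast
    show "pullback \<sigma> * ?Q = ?Q * pullback \<sigma>"
      unfolding \<sigma> Q
      by (rule quadratic_invariant[OF pullback_vecC[OF g ij(2)] pullback_vecC[OF g ij(3)] tau_less
            Sp_grp_sums(1)[OF g]])
  qed
  then show "app (\<Sum>r<2 * k. lscale ((case ij of (i, j) \<Rightarrow> \<lambda>r. eps k r * (sgnC i r * sgnC j (tau k r))) r)
      (wgen ((case ij of (i, j) \<Rightarrow> vecC i) r) * wgen ((case ij of (i, j) \<Rightarrow> \<lambda>r. vecC j (tau k r)) r)) :: (_, 'a) lop)
      \<in> DK_C k n"
    by (simp add: ij(1))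
  have eps: "eps k r \<noteq> (0 :: 'a)" for r by (simp add: eps_def)
  show "(case ij of (i, j) \<Rightarrow> diagC i) \<in> {..<2 * k}"
    using ij n by (simp add: diagC_less)
  show "(case ij of (i, j) \<Rightarrow> \<lambda>r. eps k r * (sgnC i r * sgnC j (tau k r)))
      (case ij of (i, j) \<Rightarrow> diagC i) \<noteq> (0 :: 'a)"
    using ij eps by (simp add: sgnC_def)
  show "(case ij of (i, j) \<Rightarrow> vecC j (tau k (diagC i)))
    \<in> {(case ij of (i, j) \<Rightarrow> vecC i) (case ij of (i, j) \<Rightarrow> diagC i),
       (case ij of (i, j) \<Rightarrow> \<lambda>r. vecC j (tau k r)) (case ij of (i, j) \<Rightarrow> diagC i)}"
    using ij by simp
  fix r assume "r \<in> {..<2 * k}" "r \<noteq> (case ij of (i, j) \<Rightarrow> diagC i)"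
  then show "wtC ((case ij of (i, j) \<Rightarrow> vecC i) r) + wtC ((case ij of (i, j) \<Rightarrow> \<lambda>r. vecC j (tau k r)) r)
      < wtC ((case ij of (i, j) \<Rightarrow> vecC i) (case ij of (i, j) \<Rightarrow> diagC i))
        + wtC ((case ij of (i, j) \<Rightarrow> \<lambda>r. vecC j (tau k r)) (case ij of (i, j) \<Rightarrow> diagC i))"
    using ij n levC_dominant[of i j r] by (simp add: wtC_vecC tau_less diagC_less)
next
  fix ab ij assume *: "ab \<in> strict_upper_pairs (2 * n)" "ij \<in> strict_upper_pairs (2 * n)" "ab \<noteq> ij"
    and mem: "(case ij of (i, j) \<Rightarrow> vecC j (tau k (diagC i)))
      \<in> {(case ab of (i, j) \<Rightarrow> vecC i) (case ab of (i, j) \<Rightarrow> diagC i),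
         (case ab of (i, j) \<Rightarrow> \<lambda>r. vecC j (tau k r)) (case ab of (i, j) \<Rightarrow> diagC i)}"
  obtain a b where ab: "ab = (a, b)" "a < b" "b < 2 * k"
    using *(1) n by (auto simp: strict_upper_pairs_def)
  obtain i j where ij: "ij = (i, j)" "i < j" "j < 2 * k"
    using *(2) n by (auto simp: strict_upper_pairs_def)
  have ne: "a \<noteq> i \<or> b \<noteq> j" using *(3) ab(1) ij(1) by simp
  have bounds: "diagC a < 2 * k" "diagC i < 2 * k" "tau k (diagC a) < 2 * k" "tau k (diagC i) < 2 * k"
    using ab ij by (simp_all add: diagC_less tau_less)
  \<comment> \<open>The second letter determines its pair, so a key can recur only as the first
    letter of another leading monomial, that is, at the own coordinate of that vector.\<close>
  have "j = a \<and> tau k (diagC i) = diagC j"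
    using mem bounds ne diagC_eq_iff[of i a] ab ij by (auto simp: vecC_eq_iff tau_eq_iff)
  then have "a = j" "i div 2 = j div 2" using tau_diagC_eq_iff[OF ij(2,3)] by auto
  \<comment> \<open>As \<open>i < j\<close> share a block, \<open>j\<close> is odd; hence
    \<open>b > j\<close> belongs to a later block and \<open>(a, b)\<close> has the smaller
    rank.\<close>
  moreover from this have "a div 2 \<noteq> b div 2" using ab(2) ij(2) by presburger
  ultimately show "(case ab of (i, j) \<Rightarrow> if i div 2 = j div 2 then 1 else 0)
      < (case ij of (i, j) \<Rightarrow> if i div 2 = j div 2 then 1 else (0 :: nat))"
    using ab(1) ij(1) by simp
next
  show "DK_C k n \<subseteq> (weyl (VarsM (2 * k) n) :: (_, 'a) dop set)"
    by (auto simp: DK_C_def invariant_ops_def)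
  show "0 < wtC (Inl v) + wtC (Inr v)" for v
    by (cases v) (auto simp: wtC_def levC_def)
qed (simp_all add: finite_upper_pairs)

end

text \<open>The inequalities compare ranks: p + q for gl of size p + q and k for GL of size k; n for
  sp of size 2n and floor(k/2) for O of size k; n for so of size 2n and k for Sp of size 2k.\<close>

theorem mainTheorem19:
  assumes "alg_closed TYPE('a::field_char_0)"
  shows
    "(\<forall>p q k (\<iota> :: 'a mat \<Rightarrow> (bool \<times> nat \<times> nat, 'a) dop).
        p + q \<le> k \<longrightarrow> howe_embedding (gl_alg (p + q)) \<iota> (VarsA p q k) (DK_A p q k) \<longrightarrow>
        phi_iso (gl_alg (p + q)) \<iota> (DK_A p q k))
   \<and> (\<forall>k n (\<iota> :: 'a mat \<Rightarrow> (nat \<times> nat, 'a) dop).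
        n \<le> k div 2 \<longrightarrow> howe_embedding (sp_alg n) \<iota> (VarsM k n) (DK_B k n) \<longrightarrow>
        phi_iso (sp_alg n) \<iota> (DK_B k n))
   \<and> (\<forall>k n (\<iota> :: 'a mat \<Rightarrow> (nat \<times> nat, 'a) dop).
        n \<le> k \<longrightarrow> howe_embedding (so_alg n) \<iota> (VarsM (2 * k) n) (DK_C k n) \<longrightarrow>
        phi_iso (so_alg n) \<iota> (DK_C k n))"
  by (intro conjI allI impI) (rule phi_iso_case_A phi_iso_case_B phi_iso_case_C; assumption)+

end
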